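(* Let $f\in\mathcal O_{n+1}$ define an isolated hypersurface singularity $(V(f),0)$ with Milnor number $\mu$ and Tjurina number $\tau$, and let $d=\mu-\tau$. Let $\alpha_1\le\alpha_2\le\dots\le\alpha_\mu$ be all spectrum numbers of $f$ (with multiplicity). Let $\alpha_{j_1}<\alpha_{j_2}<\dots<\alpha_{j_t}$ be all the distinct values among them, with indices chosen so that $\alpha_{j_l}<\alpha_{j_l+1}$ for $l<t$ and $j_t=\mu$; thus, with $j_0=0$, the number $h_l=\dim_{\mathbb C}\mathrm{Gr}_V^{\alpha_{j_l}}\Omega_f^{n+1}=j_l-j_{l-1}$ is the multiplicity of $\alpha_{j_l}$. Let $\alpha_{i_1}\le\alpha_{i_2}\le\dots\le\alpha_{i_d}$ be all spectrum numbers not in the Tjurina spectrum (with multiplicity). For each $1\le k\le d$, let $r_k$ be the maximal integer such that $\#\{j\mid\alpha_j\le\alpha_{j_{r_k}}\}\le k$. Then $$\alpha_{i_k}\ge\alpha_{j_{r_k}}+1 .$$ In particular, $\alpha_{i_1}\ge\alpha_1+1$ (if $d\ge1$), and $\alpha_{i_2}\ge\alpha_2+1$ if $d\ge2$.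
   Context: $\mathcal O_{n+1}=\mathbb C\{x_0,\dots,x_n\}$. For $f\in\mathcal O_{n+1}$ with $f(0)=0$ put $J(f)=(\partial f/\partial x_0,\dots,\partial f/\partial x_n)$, $\mu=\dim_{\mathbb C}\mathcal O_{n+1}/J(f)$ (Milnor number) and $\tau=\dim_{\mathbb C}\mathcal O_{n+1}/(f,J(f))$ (Tjurina number); both are finite when the singularity is isolated. Spectrum numbers: let $\Omega^k$ be the module of germs at $0$ of holomorphic $k$-forms on $\mathbb C^{n+1}$. The Brieskorn lattice is $\mathcal H^{(0)}=\Omega^{n+1}/df\wedge d\Omega^{n-1}$, with operators $\partial_t^{-1}[d\varpi]=[df\wedge\varpi]$ ($\varpi\in\Omega^n$) and $t[\omega]=[f\omega]$. It is a free module of rank $\mu$ over $\mathbb C\{\{\partial_t^{-1}\}\}=\{\sum_{i\ge0}c_i\partial_t^{-i}:\sum_i|c_i|\varepsilon^i/i!<\infty\text{ for some }\varepsilon>0\}$. Let $\mathcal H$ be its localization by $\partial_t^{-1}$, and for $\alpha\in\mathbb Q$ set $H^\alpha=\{u\in\mathcal H:(\partial_tt-\alpha)^mu=0\text{ for some }m>0\}$ and $V^\alpha\mathcal H=\sum_{\beta\ge\alpha}\mathbb C\{\{\partial_t^{-1}\}\}H^\beta$, a decreasing filtration. It induces a filtration $V^\bullet$ on $\mathcal H^{(0)}$ (by intersection) and then on the quotient $\Omega_f^{n+1}=\Omega^{n+1}/df\wedge\Omega^n$ (by image). With $\mathrm{Gr}_V^\alpha=V^\alpha/\bigcup_{\beta>\alpha}V^\beta$,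 the spectrum numbers (exponents) of $f$ are the $\mu$ rational numbers $\alpha_1\le\dots\le\alpha_\mu$ in which each $\alpha\in\mathbb Q$ occurs exactly $\dim_{\mathbb C}\mathrm{Gr}_V^\alpha\Omega_f^{n+1}$ times. Tjurina spectrum: the $\tau$ rational numbers in which each $\beta\in\mathbb Q$ occurs exactly $\dim_{\mathbb C}\mathrm{Gr}_V^\beta(\Omega_f^{n+1}/f\Omega_f^{n+1})$ times, where $\Omega_f^{n+1}/f\Omega_f^{n+1}$ carries the quotient filtration of $V^\bullet$. (This agrees with the definition by Hodge ideals.) It is a sub-multiset of the spectrum; "spectrum numbers not in the Tjurina spectrum" means the elements of the multiset difference, which has $d=\mu-\tau$ elements. It is known that $\alpha_1$ has multiplicity $1$ in the spectrum, so each $r_k$ exists. *)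

theory Defs
  imports
    "HOL-Analysis.Infinite_Sum"
    "HOL-Algebra.Ideal"
    "HOL-Library.Poly_Mapping"
    "HOL-Library.Multiset"
    "Jordan_Normal_Form.VS_Connect"
begin

text \<open>
  Complex vector spaces are \<open>module\<close> records over \<open>class_ring :: complex ring\<close>. The ring fields
  \<open>mult\<close> and \<open>one\<close> of such a record are left unspecified when there is no multiplication.
\<close>

subsection \<open>Quotients and dimensions of complex vector spaces\<close>

text \<open>The map into the quotient by \<open>U\<close> of the space \<open>M\<close> which is induced on cosets by \<open>g\<close>.\<close>

definition coset_map :: "(complex, 'w) module \<Rightarrow> 'w set \<Rightarrow> ('v \<Rightarrow> 'w) \<Rightarrow> 'v set \<Rightarrow> 'w set" where
  "coset_map M U g A = (\<Union>a\<in>A. U +>\<^bsub>M\<^esub> g a)"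

definition quot_space :: "(complex, 'v) module \<Rightarrow> 'v set \<Rightarrow> (complex, 'v set) module" where
  "quot_space M U =
     \<lparr>carrier = a_rcosets\<^bsub>M\<^esub> U, mult = undefined, one = undefined, zero = U,
      add = (\<lambda>A B. A <+>\<^bsub>M\<^esub> B), smult = (\<lambda>c. coset_map M U (\<lambda>a. c \<odot>\<^bsub>M\<^esub> a))\<rparr>"

text \<open>\<open>vectorspace.dim\<close> is not specified for spaces of infinite dimension; these get dimension \<open>0\<close>.\<close>

definition cdim :: "(complex, 'v) module \<Rightarrow> nat" where
  "cdim M = (if vectorspace.fin_dim (class_ring :: complex ring) M
             then vectorspace.dim (class_ring :: complex ring) M else 0)"

text \<open>\<open>dim Gr\<^sub>V\<^sup>\<alpha> M\<close> for a decreasing filtration \<open>V\<close> of \<open>M\<close> indexed by the rationals.\<close>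

definition gr_dim :: "(complex, 'v) module \<Rightarrow> (rat \<Rightarrow> 'v set) \<Rightarrow> rat \<Rightarrow> nat" where
  "gr_dim M V a = cdim (quot_space (M\<lparr>carrier := V a\<rparr>) (\<Union>b\<in>{a<..}. V b))"

subsection \<open>Localization\<close>

text \<open>
  The localization of \<open>M\<close> by an endomorphism \<open>s\<close>: the pair \<open>(a, k)\<close> stands for the fraction
  \<open>s\<^sup>-\<^sup>k a\<close>. Injectivity of \<open>s\<close> is not presupposed.
\<close>

definition loc_rel ::
  "(complex, 'v) module \<Rightarrow> ('v \<Rightarrow> 'v) \<Rightarrow> (('v \<times> nat) \<times> ('v \<times> nat)) set" where
  "loc_rel M s = {((a, j), (b, k)) | a j b k.
     a \<in> carrier M \<and> b \<in> carrier M \<and> (\<exists>l. (s ^^ (l + k)) a = (s ^^ (l + j)) b)}"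

definition frac ::
  "(complex, 'v) module \<Rightarrow> ('v \<Rightarrow> 'v) \<Rightarrow> 'v \<Rightarrow> nat \<Rightarrow> ('v \<times> nat) set" where
  "frac M s a k = loc_rel M s `` {(a, k)}"

definition localization ::
  "(complex, 'v) module \<Rightarrow> ('v \<Rightarrow> 'v) \<Rightarrow> (complex, ('v \<times> nat) set) module" where
  "localization M s =
     \<lparr>carrier = (carrier M \<times> UNIV) // loc_rel M s, mult = undefined, one = undefined,
      zero = frac M s \<zero>\<^bsub>M\<^esub> 0,
      add = (\<lambda>X Y. \<Union>(a, j)\<in>X. \<Union>(b, k)\<in>Y. frac M s ((s ^^ k) a \<oplus>\<^bsub>M\<^esub> (s ^^ j) b) (j + k)),
      smult = (\<lambda>c X. \<Union>(a, k)\<in>X. frac M s (c \<odot>\<^bsub>M\<^esub> a) k)\<rparr>"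

subsection \<open>Convergent power series\<close>

type_synonym pseries = "(nat \<Rightarrow>\<^sub>0 nat) \<Rightarrow> complex"

definition mono_deg :: "(nat \<Rightarrow>\<^sub>0 nat) \<Rightarrow> nat" where
  "mono_deg a = (\<Sum>i\<in>Poly_Mapping.keys a. Poly_Mapping.lookup a i)"

definition ps_mult :: "pseries \<Rightarrow> pseries \<Rightarrow> pseries" where
  "ps_mult f g = (\<lambda>c. \<Sum>(a, b) | a + b = c. f a * g b)"

text \<open>The algebra \<open>\<complex>{x\<^sub>0, \<dots>, x\<^sub>n}\<close> in \<open>n + 1\<close> variables.\<close>

definition conv_ps :: "nat \<Rightarrow> (complex, pseries) module" where
  "conv_ps n =
     \<lparr>carrier = {f. (\<forall>a. f a \<noteq> 0 \<longrightarrow> Poly_Mapping.keys a \<subseteq> {..n}) \<and>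
                    (\<exists>r>0. (\<lambda>a. norm (f a) * r ^ mono_deg a) summable_on UNIV)},
      mult = ps_mult, one = (\<lambda>a. if a = 0 then 1 else 0), zero = (\<lambda>_. 0),
      add = (\<lambda>f g a. f a + g a), smult = (\<lambda>c f a. c * f a)\<rparr>"

definition pderiv_ps :: "nat \<Rightarrow> pseries \<Rightarrow> pseries" where
  "pderiv_ps i f = (\<lambda>a. of_nat (Poly_Mapping.lookup a i + 1) * f (a + Poly_Mapping.single i 1))"

definition ps_eval :: "pseries \<Rightarrow> (nat \<Rightarrow> complex) \<Rightarrow> complex" where
  "ps_eval f x = (\<Sum>\<^sub>\<infinity>a. f a * (\<Prod>i\<in>Poly_Mapping.keys a. x i ^ Poly_Mapping.lookup a i))"

definition sing_point :: "nat \<Rightarrow> pseries \<Rightarrow> (nat \<Rightarrow> complex) \<Rightarrow> bool" where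
  "sing_point n f x \<longleftrightarrow> ps_eval f x = 0 \<and> (\<forall>i\<le>n. ps_eval (pderiv_ps i f) x = 0)"

text \<open>
  The origin is an isolated point of the singular locus of \<open>V(f)\<close>. Only the coordinates
  \<open>x 0, \<dots>, x n\<close> matter, and \<open>\<rho>\<close> may be taken so small that all series converge.
\<close>

definition isolated_hypersurface_singularity :: "nat \<Rightarrow> pseries \<Rightarrow> bool" where
  "isolated_hypersurface_singularity n f \<longleftrightarrow>
     sing_point n f (\<lambda>_. 0) \<and>
     (\<exists>\<rho>>0. \<forall>x. (\<forall>i\<le>n. norm (x i) < \<rho>) \<and> sing_point n f x \<longrightarrow> (\<forall>i\<le>n. x i = 0))"

definition milnor_number :: "nat \<Rightarrow> pseries \<Rightarrow> nat" where
  "milnor_number n f =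
     cdim (quot_space (conv_ps n) (Idl\<^bsub>conv_ps n\<^esub> ((\<lambda>i. pderiv_ps i f) ` {..n})))"

definition tjurina_number :: "nat \<Rightarrow> pseries \<Rightarrow> nat" where
  "tjurina_number n f =
     cdim (quot_space (conv_ps n) (Idl\<^bsub>conv_ps n\<^esub> (insert f ((\<lambda>i. pderiv_ps i f) ` {..n}))))"

subsection \<open>Germs of holomorphic differential forms\<close>

text \<open>
  A form is given by its coefficients: \<open>\<omega>\<close> stands for the sum of \<open>\<omega> I dx\<^sub>I\<close> over the finite sets
  \<open>I \<subseteq> {0..n}\<close>, where \<open>dx\<^sub>I\<close> is the wedge product of the \<open>dx\<^sub>i\<close>, \<open>i \<in> I\<close>, in increasing order.
\<close>

type_synonym form = "nat set \<Rightarrow> pseries"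

text \<open>\<open>dx\<^sub>I \<and> dx\<^sub>J = shuffle_sign I J dx\<^bsub>I \<union> J\<^esub>\<close> for disjoint \<open>I\<close> and \<open>J\<close>.\<close>

definition shuffle_sign :: "nat set \<Rightarrow> nat set \<Rightarrow> complex" where
  "shuffle_sign I J = (- 1) ^ card {(i, j). i \<in> I \<and> j \<in> J \<and> j < i}"

definition wedge :: "form \<Rightarrow> form \<Rightarrow> form" where
  "wedge \<omega> \<eta> = (\<lambda>K a. \<Sum>I\<in>Pow K. shuffle_sign I (K - I) * ps_mult (\<omega> I) (\<eta> (K - I)) a)"

definition ext_deriv :: "form \<Rightarrow> form" where
  "ext_deriv \<omega> = (\<lambda>K a. \<Sum>i\<in>K. shuffle_sign {i} (K - {i}) * pderiv_ps i (\<omega> (K - {i})) a)"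

definition zero_form :: "pseries \<Rightarrow> form" where
  "zero_form f = (\<lambda>I. if I = {} then f else (\<lambda>_. 0))"

text \<open>The degree \<open>k\<close> is an integer so that forms of degree \<open>n - 1\<close> are \<open>0\<close> when \<open>n = 0\<close>.\<close>

definition Omega :: "nat \<Rightarrow> int \<Rightarrow> (complex, form) module" where
  "Omega n k =
     \<lparr>carrier = {\<omega>. (\<forall>I. \<omega> I \<in> carrier (conv_ps n)) \<and>
                    (\<forall>I. \<omega> I \<noteq> (\<lambda>_. 0) \<longrightarrow> I \<subseteq> {..n} \<and> int (card I) = k)},
      mult = undefined, one = undefined, zero = (\<lambda>_ _. 0),
      add = (\<lambda>\<omega> \<eta> I a. \<omega> I a + \<eta> I a), smult = (\<lambda>c \<omega> I a. c * \<omega> I a)\<rparr>"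

abbreviation Omega_top :: "nat \<Rightarrow> (complex, form) module" where
  "Omega_top n \<equiv> Omega n (int n + 1)"

definition df_wedge :: "pseries \<Rightarrow> form \<Rightarrow> form" where
  "df_wedge f \<omega> = wedge (ext_deriv (zero_form f)) \<omega>"

definition fun_mult :: "pseries \<Rightarrow> form \<Rightarrow> form" where
  "fun_mult f \<omega> = wedge (zero_form f) \<omega>"

subsection \<open>The Brieskorn lattice and its localization\<close>

definition brieskorn_denom :: "nat \<Rightarrow> pseries \<Rightarrow> form set" where
  "brieskorn_denom n f = (\<lambda>\<eta>. df_wedge f (ext_deriv \<eta>)) ` carrier (Omega n (int n - 1))"

definition brieskorn :: "nat \<Rightarrow> pseries \<Rightarrow> (complex, form set) module" where
  "brieskorn n f = quot_space (Omega_top n) (brieskorn_denom n f)"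

text \<open>\<open>\<partial>\<^sub>t\<^sup>-\<^sup>1 [d\<eta>] = [df \<and> \<eta>]\<close> and \<open>t [\<omega>] = [f \<omega>]\<close>.\<close>

definition dt_inv :: "nat \<Rightarrow> pseries \<Rightarrow> form set \<Rightarrow> form set" where
  "dt_inv n f A =
     (\<Union>\<eta>\<in>{\<eta> \<in> carrier (Omega n (int n)). ext_deriv \<eta> \<in> A}.
        brieskorn_denom n f +>\<^bsub>Omega_top n\<^esub> df_wedge f \<eta>)"

definition t_op :: "nat \<Rightarrow> pseries \<Rightarrow> form set \<Rightarrow> form set" where
  "t_op n f = coset_map (Omega_top n) (brieskorn_denom n f) (fun_mult f)"

definition gauss_manin :: "nat \<Rightarrow> pseries \<Rightarrow> (complex, (form set \<times> nat) set) module" where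
  "gauss_manin n f = localization (brieskorn n f) (dt_inv n f)"

abbreviation gm_frac :: "nat \<Rightarrow> pseries \<Rightarrow> form set \<Rightarrow> nat \<Rightarrow> (form set \<times> nat) set" where
  "gm_frac n f \<equiv> frac (brieskorn n f) (dt_inv n f)"

definition gm_dt :: "nat \<Rightarrow> pseries \<Rightarrow> (form set \<times> nat) set \<Rightarrow> (form set \<times> nat) set" where
  "gm_dt n f X = (\<Union>(a, k)\<in>X. gm_frac n f a (k + 1))"

definition gm_dt_inv :: "nat \<Rightarrow> pseries \<Rightarrow> (form set \<times> nat) set \<Rightarrow> (form set \<times> nat) set" where
  "gm_dt_inv n f X = (\<Union>(a, k)\<in>X. gm_frac n f (dt_inv n f a) k)"

text \<open>
  On the Brieskorn lattice \<open>t \<partial>\<^sub>t\<^sup>-\<^sup>1 - \<partial>\<^sub>t\<^sup>-\<^sup>1 t = \<partial>\<^sub>t\<^sup>-\<^sup>2\<close>, because \<open>d(f\<eta>) = df \<and> \<eta> + f d\<eta>\<close>. Hence the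
  extension of \<open>t\<close> to the localization satisfies \<open>\<partial>\<^sub>t t - t \<partial>\<^sub>t = 1\<close>, which gives
  \<open>t \<partial>\<^sub>t\<^sup>k a = \<partial>\<^sub>t\<^sup>k (t a - k \<partial>\<^sub>t\<^sup>-\<^sup>1 a)\<close>.
\<close>

definition gm_t :: "nat \<Rightarrow> pseries \<Rightarrow> (form set \<times> nat) set \<Rightarrow> (form set \<times> nat) set" where
  "gm_t n f X =
     (\<Union>(a, k)\<in>X. gm_frac n f
        (t_op n f a \<ominus>\<^bsub>brieskorn n f\<^esub> of_nat k \<odot>\<^bsub>brieskorn n f\<^esub> dt_inv n f a) k)"

subsection \<open>The V-filtration\<close>

definition gm_eigen :: "nat \<Rightarrow> pseries \<Rightarrow> rat \<Rightarrow> (form set \<times> nat) set set" where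
  "gm_eigen n f a = {u \<in> carrier (gauss_manin n f). \<exists>m>0.
     ((\<lambda>v. gm_dt n f (gm_t n f v) \<ominus>\<^bsub>gauss_manin n f\<^esub> of_rat a \<odot>\<^bsub>gauss_manin n f\<^esub> v) ^^ m) u
       = \<zero>\<^bsub>gauss_manin n f\<^esub>}"

text \<open>Coefficient sequences of the elements of \<open>\<complex>{{\<partial>\<^sub>t\<^sup>-\<^sup>1}}\<close>.\<close>

definition micro_series :: "(nat \<Rightarrow> complex) set" where
  "micro_series = {c. \<exists>\<epsilon>>0. summable (\<lambda>i. norm (c i) * \<epsilon> ^ i / fact i)}"

text \<open>
  \<open>gm_sums n f c h u\<close>: the series of the \<open>c i \<partial>\<^sub>t\<^sup>-\<^sup>i h\<close> converges to \<open>u\<close> in the \<open>\<partial>\<^sub>t\<^sup>-\<^sup>1\<close>-adic topology,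
  for which the images \<open>\<partial>\<^sub>t\<^sup>-\<^sup>N H\<^sup>(\<^sup>0\<^sup>)\<close> of the Brieskorn lattice are a basis of neighbourhoods of \<open>0\<close>.
  This is the action of \<open>\<complex>{{\<partial>\<^sub>t\<^sup>-\<^sup>1}}\<close>: multiplication by a series and by its truncation at order \<open>N\<close>
  differ by an element of \<open>\<partial>\<^sub>t\<^sup>-\<^sup>N \<complex>{{\<partial>\<^sub>t\<^sup>-\<^sup>1}}h\<close>, and the intersection of the \<open>\<partial>\<^sub>t\<^sup>-\<^sup>N H\<^sup>(\<^sup>0\<^sup>)\<close> is \<open>0\<close>
  because the Brieskorn lattice is free of finite rank.
\<close>

definition gm_sums ::
  "nat \<Rightarrow> pseries \<Rightarrow> (nat \<Rightarrow> complex) \<Rightarrow> (form set \<times> nat) set \<Rightarrow> (form set \<times> nat) set \<Rightarrow> bool" where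
  "gm_sums n f c h u \<longleftrightarrow>
     (\<forall>N. \<forall>\<^sub>F k in sequentially.
        u \<ominus>\<^bsub>gauss_manin n f\<^esub>
          (\<Oplus>\<^bsub>gauss_manin n f\<^esub>i\<in>{..<k}. c i \<odot>\<^bsub>gauss_manin n f\<^esub> (gm_dt_inv n f ^^ i) h)
        \<in> (gm_dt_inv n f ^^ N) ` ((\<lambda>a. gm_frac n f a 0) ` carrier (brieskorn n f)))"

definition gm_V :: "nat \<Rightarrow> pseries \<Rightarrow> rat \<Rightarrow> (form set \<times> nat) set set" where
  "gm_V n f a = LinearCombinations.module.span (class_ring :: complex ring) (gauss_manin n f)
     {u \<in> carrier (gauss_manin n f).
        \<exists>b\<ge>a. \<exists>h\<in>gm_eigen n f b. \<exists>c\<in>micro_series. gm_sums n f c h u}"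

definition brieskorn_V :: "nat \<Rightarrow> pseries \<Rightarrow> rat \<Rightarrow> form set set" where
  "brieskorn_V n f a = {A \<in> carrier (brieskorn n f). gm_frac n f A 0 \<in> gm_V n f a}"

subsection \<open>Spectrum and Tjurina spectrum\<close>

definition Omega_f_denom :: "nat \<Rightarrow> pseries \<Rightarrow> form set" where
  "Omega_f_denom n f = df_wedge f ` carrier (Omega n (int n))"

definition Omega_f :: "nat \<Rightarrow> pseries \<Rightarrow> (complex, form set) module" where
  "Omega_f n f = quot_space (Omega_top n) (Omega_f_denom n f)"

definition Omega_f_V :: "nat \<Rightarrow> pseries \<Rightarrow> rat \<Rightarrow> form set set" where
  "Omega_f_V n f a =
     coset_map (Omega_top n) (Omega_f_denom n f) (\<lambda>\<omega>. \<omega>) ` brieskorn_V n f a"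

definition f_Omega_f :: "nat \<Rightarrow> pseries \<Rightarrow> form set set" where
  "f_Omega_f n f =
     coset_map (Omega_top n) (Omega_f_denom n f) (fun_mult f) ` carrier (Omega_f n f)"

definition Omega_T :: "nat \<Rightarrow> pseries \<Rightarrow> (complex, form set set) module" where
  "Omega_T n f = quot_space (Omega_f n f) (f_Omega_f n f)"

definition Omega_T_V :: "nat \<Rightarrow> pseries \<Rightarrow> rat \<Rightarrow> form set set set" where
  "Omega_T_V n f a = (\<lambda>A. f_Omega_f n f +>\<^bsub>Omega_f n f\<^esub> A) ` Omega_f_V n f a"

definition is_spectrum :: "nat \<Rightarrow> pseries \<Rightarrow> rat multiset \<Rightarrow> bool" where
  "is_spectrum n f S \<longleftrightarrow>
     size S = milnor_number n f \<and> (\<forall>a. count S a = gr_dim (Omega_f n f) (Omega_f_V n f) a)"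

definition is_tjurina_spectrum :: "nat \<Rightarrow> pseries \<Rightarrow> rat multiset \<Rightarrow> bool" where
  "is_tjurina_spectrum n f S \<longleftrightarrow>
     size S = tjurina_number n f \<and> (\<forall>a. count S a = gr_dim (Omega_T n f) (Omega_T_V n f) a)"

end

theory Submission
  imports Defs "HOL-Analysis.FPS_Convergence"
begin

text \<open>
  Multiplication by \<open>f\<close> maps \<open>V\<^sup>\<alpha> \<Omega>\<^sub>f\<close> into \<open>V\<^bsup>\<alpha>+1\<^esup> \<Omega>\<^sub>f\<close>: it is induced by \<open>t\<close>, and \<open>t\<close> shifts the
  generalized eigenspaces of \<open>\<partial>\<^sub>t t\<close> by \<open>1\<close>. Since \<open>\<Omega>\<^sub>f\<close> is the Brieskorn lattice modulo the image of
  \<open>\<partial>\<^sub>t\<^sup>-\<^sup>1\<close>, a series in \<open>\<complex>{{\<partial>\<^sub>t\<^sup>-\<^sup>1}}\<close> may be truncated before \<open>t\<close> is applied, so neither convergence nor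
  the freeness of the lattice plays a role. The number of spectrum numbers below \<open>\<beta> + 1\<close> that are
  missing from the Tjurina spectrum is the codimension of \<open>f\<Omega>\<^sub>f \<inter> V\<^bsup>\<beta>+1\<^esup>\<close> in \<open>f\<Omega>\<^sub>f\<close>, hence at most the
  codimension of \<open>V\<^sup>\<beta>\<close> in \<open>\<Omega>\<^sub>f\<close>, which is the number of spectrum numbers below \<open>\<beta>\<close>. This gives the
  stronger inequality \<open>\<alpha>\<^bsub>i\<^sub>k\<^esub> \<ge> \<alpha>\<^sub>k + 1\<close> for all \<open>k\<close>. If \<open>n = 0\<close>, then \<open>f\<close> is a multiple of \<open>f'\<close> and
  nothing is missing.
\<close>

subsection \<open>Complex vector spaces\<close>

text \<open>The definitions alone do not say that \<open>Omega_f\<close> has finite dimension or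
  that V exhausts it; counting supplies both. A missing number forces \<mu> > 0, and
  \<open>cdim\<close> is 0 on infinite-dimensional spaces, so the Jacobian algebra has finite
  dimension \<mu>; multiplying dx_0 ... dx_n by functions maps it onto \<open>Omega_f\<close>. At
  most dim V^b of the \<mu> \<ge> dim \<open>Omega_f\<close> spectrum numbers are \<ge> b, so at
  least codim V^b of them are < b. The codimension estimate comes from rank-nullity: the kernel of f
  on V^b lies in the kernel of f on the whole space, hence f V^b has in the image of f at most the
  codimension that V^b has in \<open>Omega_f\<close>. The bound by \<alpha>_k implies the one by
  r_k: a value larger than \<alpha>_k has at least k + 1 spectrum numbers less than or equal to it,
  so a value with at most k such numbers is \<le> \<alpha>_k.\<close>

abbreviation cvs :: "(complex, 'v) module \<Rightarrow> bool" where
  "cvs \<equiv> vectorspace (class_ring :: complex ring)"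

abbreviation csub :: "'v set \<Rightarrow> (complex, 'v) module \<Rightarrow> bool" where
  "csub \<equiv> VectorSpace.subspace (class_ring :: complex ring)"

abbreviation chom :: "(complex, 'v) module \<Rightarrow> (complex, 'w) module \<Rightarrow> ('v \<Rightarrow> 'w) set" where
  "chom \<equiv> module_hom (class_ring :: complex ring)"

lemma csubI:
  assumes "cvs M" "W \<subseteq> carrier M" "\<zero>\<^bsub>M\<^esub> \<in> W"
    "\<And>v w. v \<in> W \<Longrightarrow> w \<in> W \<Longrightarrow> v \<oplus>\<^bsub>M\<^esub> w \<in> W" "\<And>c v. v \<in> W \<Longrightarrow> c \<odot>\<^bsub>M\<^esub> v \<in> W"
  shows "csub W M"
  using assms unfolding subspace_def submodule_def vectorspace_def by auto

lemma csubD: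
  assumes "csub W M"
  shows "cvs M" "W \<subseteq> carrier M" "\<zero>\<^bsub>M\<^esub> \<in> W"
    "\<And>v w. v \<in> W \<Longrightarrow> w \<in> W \<Longrightarrow> v \<oplus>\<^bsub>M\<^esub> w \<in> W" "\<And>c v. v \<in> W \<Longrightarrow> c \<odot>\<^bsub>M\<^esub> v \<in> W"
  using assms unfolding subspace_def submodule_def by auto

lemma csub_minus:
  assumes "csub W M" "v \<in> W" "w \<in> W"
  shows "v \<ominus>\<^bsub>M\<^esub> w \<in> W"
proof -
  interpret vectorspace class_ring M by (rule csubD(1)[OF assms(1)])
  have w: "w \<in> carrier M" using csubD(2)[OF assms(1)] assms(3) by auto
  have "\<ominus>\<^bsub>M\<^esub> w = (\<ominus>\<^bsub>class_ring\<^esub> \<one>\<^bsub>class_ring\<^esub>) \<odot>\<^bsub>M\<^esub> w"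
    using smult_minus_1[OF w] by metis
  then show ?thesis
    using csubD(4,5)[OF assms(1)] assms(2,3) by (simp add: a_minus_def)
qed

lemma csub_vs: "csub W M \<Longrightarrow> cvs (M\<lparr>carrier := W\<rparr>)"
  using vectorspace.subspace_is_vs csubD(1) by blast

lemma chomD:
  assumes "T \<in> chom M N"
  shows "v \<in> carrier M \<Longrightarrow> T v \<in> carrier N"
    "v \<in> carrier M \<Longrightarrow> w \<in> carrier M \<Longrightarrow> T (v \<oplus>\<^bsub>M\<^esub> w) = T v \<oplus>\<^bsub>N\<^esub> T w"
    "v \<in> carrier M \<Longrightarrow> T (c \<odot>\<^bsub>M\<^esub> v) = c \<odot>\<^bsub>N\<^esub> T v"
  using assms unfolding module_hom_def by auto

lemma chomI:
  assumes "\<And>v. v \<in> carrier M \<Longrightarrow> T v \<in> carrier N"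
    "\<And>v w. v \<in> carrier M \<Longrightarrow> w \<in> carrier M \<Longrightarrow> T (v \<oplus>\<^bsub>M\<^esub> w) = T v \<oplus>\<^bsub>N\<^esub> T w"
    "\<And>c v. v \<in> carrier M \<Longrightarrow> T (c \<odot>\<^bsub>M\<^esub> v) = c \<odot>\<^bsub>N\<^esub> T v"
  shows "T \<in> chom M N"
  using assms unfolding module_hom_def by auto

lemma chom_linear_map: "cvs M \<Longrightarrow> cvs N \<Longrightarrow> T \<in> chom M N \<Longrightarrow> linear_map class_ring M N T"
  by (simp add: linear_map_def mod_hom_def mod_hom_axioms_def vectorspace_def)

lemma chom_zero: "cvs M \<Longrightarrow> cvs N \<Longrightarrow> T \<in> chom M N \<Longrightarrow> T \<zero>\<^bsub>M\<^esub> = \<zero>\<^bsub>N\<^esub>"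
  using chom_linear_map linear_map.T0_is_0 by blast

lemma chom_minus:
  assumes "cvs M" "cvs N" "T \<in> chom M N" "v \<in> carrier M" "w \<in> carrier M"
  shows "T (v \<ominus>\<^bsub>M\<^esub> w) = T v \<ominus>\<^bsub>N\<^esub> T w"
proof -
  interpret linear_map class_ring M N T by (rule chom_linear_map[OF assms(1-3)])
  show ?thesis using T_minus assms(4,5) by blast
qed

lemma csub_image:
  assumes "cvs N" "T \<in> chom M N" "csub W M"
  shows "csub (T ` W) N"
proof (rule csubI[OF assms(1)])
  note W = csubD[OF assms(3)] and T = chomD[OF assms(2)]
  show "T ` W \<subseteq> carrier N" using T(1) W(2) by auto
  show "\<zero>\<^bsub>N\<^esub> \<in> T ` W" using chom_zero[OF W(1) assms(1,2)] W(3) by force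
  show "v \<oplus>\<^bsub>N\<^esub> w \<in> T ` W" if "v \<in> T ` W" "w \<in> T ` W" for v w
  proof -
    from that obtain x y where "x \<in> W" "v = T x" "y \<in> W" "w = T y" by auto
    moreover from this have "v \<oplus>\<^bsub>N\<^esub> w = T (x \<oplus>\<^bsub>M\<^esub> y)" using T(2)[of x y] W(2) by (simp add: subset_iff)
    ultimately show ?thesis using W(4)[of x y] by auto
  qed
  show "c \<odot>\<^bsub>N\<^esub> v \<in> T ` W" if "v \<in> T ` W" for c v
  proof -
    from that obtain x where x: "x \<in> W" "v = T x" by auto
    then have "c \<odot>\<^bsub>N\<^esub> v = T (c \<odot>\<^bsub>M\<^esub> x)" using T(3)[of x c] W(2) by auto
    then show ?thesis using W(5)[OF x(1)] by auto
  qed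
qed

lemma csub_vimage:
  assumes "cvs M" "T \<in> chom M N" "csub W N"
  shows "csub {v \<in> carrier M. T v \<in> W} M"
proof -
  interpret vectorspace class_ring M by (rule assms(1))
  note W = csubD[OF assms(3)] and T = chomD[OF assms(2)]
  have sm: "c \<odot>\<^bsub>M\<^esub> v \<in> carrier M" if "v \<in> carrier M" for c v using smult_closed[of c v] that by simp
  show ?thesis
    using chom_zero[OF assms(1) W(1) assms(2)] W(3-5) T sm by (intro csubI[OF assms(1)]) auto
qed

lemma csub_ker:
  assumes "cvs M" "cvs N" "T \<in> chom M N"
  shows "csub {v \<in> carrier M. T v = \<zero>\<^bsub>N\<^esub>} M"
proof -
  interpret N: vectorspace class_ring N by (rule assms(2))
  have "c \<odot>\<^bsub>N\<^esub> \<zero>\<^bsub>N\<^esub> = \<zero>\<^bsub>N\<^esub>" for c using N.rmult_0[of c] by simp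
  then have "csub {\<zero>\<^bsub>N\<^esub>} N" by (intro csubI[OF assms(2)]) auto
  from csub_vimage[OF assms(1,3) this] show ?thesis by simp
qed

lemma csub_carrier:
  assumes "cvs M" shows "csub (carrier M) M"
proof -
  interpret vectorspace class_ring M by (rule assms(1))
  have sm: "c \<odot>\<^bsub>M\<^esub> v \<in> carrier M" if "v \<in> carrier M" for c v using smult_closed[of c v] that by simp
  show ?thesis using sm by (intro csubI[OF assms(1)]) auto
qed

lemma csub_Int: "csub U M \<Longrightarrow> csub W M \<Longrightarrow> csub (U \<inter> W) M"
  by (rule csubI) (auto dest: csubD)

lemma csub_restrict: "csub U M \<Longrightarrow> csub W M \<Longrightarrow> U \<subseteq> W \<Longrightarrow> csub U (M\<lparr>carrier := W\<rparr>)"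
  by (rule csubI[OF csub_vs]) (auto dest: csubD)

lemma csub_li_le_dim:
  assumes "csub W M" "vectorspace.fin_dim (class_ring :: complex ring) M"
    and "A \<subseteq> W" "\<not> module.lin_dep (class_ring :: complex ring) (M\<lparr>carrier := W\<rparr>) A"
  shows "finite A \<and> card A \<le> vectorspace.dim (class_ring :: complex ring) M"
proof -
  interpret V: vectorspace class_ring M by (rule csubD(1)[OF assms(1)])
  have sub: "submodule class_ring W M" using assms(1) unfolding subspace_def by auto
  have c: "A \<subseteq> carrier M" by (rule order_trans[OF assms(3) csubD(2)[OF assms(1)]])
  have "\<not> V.lin_dep A" using assms(4) unfolding V.span_li_not_depend(2)[OF assms(3) sub] .
  from V.li_le_dim[OF assms(2) c this] show ?thesis by (rule conjI)
qed

text \<open>Independent subsets of W stay independent in M, which bounds their size by dim M. So a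
  maximal one exists, and it is a basis of W.\<close>

lemma csub_fin_dim:
  assumes "csub W M" "vectorspace.fin_dim (class_ring :: complex ring) M"
  shows "vectorspace.fin_dim (class_ring :: complex ring) (M\<lparr>carrier := W\<rparr>)"
proof -
  interpret W: vectorspace class_ring "M\<lparr>carrier := W\<rparr>" by (rule csub_vs[OF assms(1)])
  have "\<exists>A. finite A \<and> maximal A (\<lambda>S. S \<subseteq> carrier (M\<lparr>carrier := W\<rparr>) \<and> W.lin_indpt S)"
  proof (rule maximal_exists[where B = "{}"])
    show "finite A \<and> card A \<le> vectorspace.dim (class_ring :: complex ring) M"
      if "A \<subseteq> carrier (M\<lparr>carrier := W\<rparr>) \<and> W.lin_indpt A" for A
      using csub_li_le_dim[OF assms, of A] that by auto
    show "{} \<subseteq> carrier (M\<lparr>carrier := W\<rparr>) \<and> W.lin_indpt {}" by (auto simp: W.lin_dep_def)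
  qed
  then show ?thesis
    using W.max_li_is_basis unfolding W.fin_dim_def W.basis_def by blast
qed

text \<open>Finite dimension is assumed of M alone; the second part hands it on to the image.
  Quotients and \<open>Omega_f\<close> inherit their finite dimension in this way.\<close>

lemma rank_nullity_csub:
  assumes "cvs N" "T \<in> chom M N" "csub W M" "vectorspace.fin_dim (class_ring :: complex ring) M"
  shows "cdim (N\<lparr>carrier := T ` W\<rparr>) + cdim (M\<lparr>carrier := {v \<in> W. T v = \<zero>\<^bsub>N\<^esub>}\<rparr>)
    = cdim (M\<lparr>carrier := W\<rparr>)"
    and "vectorspace.fin_dim (class_ring :: complex ring) (N\<lparr>carrier := T ` W\<rparr>)"
proof -
  let ?W = "M\<lparr>carrier := W\<rparr>" and ?N = "N\<lparr>carrier := T ` W\<rparr>"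
  have vW: "cvs ?W" and vN: "cvs ?N"
    using assms csub_vs csub_image by blast+
  have T: "T \<in> chom ?W ?N"
    using chomD[OF assms(2)] csubD(2)[OF assms(3)] by (intro chomI) (auto simp: subset_iff)
  interpret linear_map class_ring ?W ?N T by (rule chom_linear_map[OF vW vN T])
  have fW: "V.fin_dim" by (rule csub_fin_dim[OF assms(3,4)])
  have ker: "kerT = {v \<in> W. T v = \<zero>\<^bsub>N\<^esub>}" by (simp add: ker_def)
  have fker: "vectorspace.fin_dim (class_ring :: complex ring) (?W\<lparr>carrier := kerT\<rparr>)"
    by (rule csub_fin_dim[OF kerT_is_subspace fW])
  show fN: "W.fin_dim" by (rule rank_nullity_main(2)[OF fW]) auto
  have "im = T ` W" by (simp add: im_def)
  then show "cdim ?N + cdim (M\<lparr>carrier := {v \<in> W. T v = \<zero>\<^bsub>N\<^esub>}\<rparr>) = cdim ?W"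
    using rank_nullity[OF fW] fN fW fker by (simp add: cdim_def ker)
qed

lemma cdim_mono:
  assumes "csub W M" "csub W' M" "W \<subseteq> W'" "vectorspace.fin_dim (class_ring :: complex ring) M"
  shows "cdim (M\<lparr>carrier := W\<rparr>) \<le> cdim (M\<lparr>carrier := W'\<rparr>)"
proof -
  have f: "vectorspace.fin_dim (class_ring :: complex ring) (M\<lparr>carrier := W\<rparr>)"
    "vectorspace.fin_dim (class_ring :: complex ring) (M\<lparr>carrier := W'\<rparr>)"
    using csub_fin_dim assms by blast+
  have sub: "csub W (M\<lparr>carrier := W'\<rparr>)" by (rule csub_restrict[OF assms(1-3)])
  interpret W: vectorspace class_ring "M\<lparr>carrier := W\<rparr>" by (rule csub_vs[OF assms(1)])
  obtain B where B: "finite B" "W.basis B" using W.finite_basis_exists[OF f(1)] by auto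
  then have "B \<subseteq> W" "W.lin_indpt B" by (auto simp: W.basis_def)
  then have "card B \<le> vectorspace.dim (class_ring :: complex ring) (M\<lparr>carrier := W'\<rparr>)"
    using csub_li_le_dim[OF sub f(2), of B] by simp
  then show ?thesis using W.dim_basis[OF B] f by (simp add: cdim_def)
qed

subsection \<open>Quotient spaces\<close>

lemma csub_abelian_subgroup: "csub U M \<Longrightarrow> abelian_subgroup U M"
proof -
  assume U: "csub U M"
  interpret vectorspace class_ring M by (rule csubD(1)[OF U])
  have "\<ominus>\<^bsub>M\<^esub> w \<in> U" if "w \<in> U" for w
    using csub_minus[OF U csubD(3)[OF U] that] csubD(2)[OF U] that by (auto simp: a_minus_def)
  then have "subgroup U (add_monoid M)"
    using csubD[OF U] by (intro group.subgroupI) (auto simp: a_inv_def intro: a_group)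
  then show ?thesis
    by (intro abelian_subgroupI3 additive_subgroup.intro) (simp_all add: abelian_group_axioms)
qed

lemma quot_coset_mem:
  assumes "csub U M" "a \<in> carrier M"
  shows "b \<in> U +>\<^bsub>M\<^esub> a \<longleftrightarrow> b \<in> carrier M \<and> b \<ominus>\<^bsub>M\<^esub> a \<in> U"
proof -
  interpret vectorspace class_ring M by (rule csubD(1)[OF assms(1)])
  note U = csubD(2)[OF assms(1)]
  have *: "(b \<ominus>\<^bsub>M\<^esub> a) \<oplus>\<^bsub>M\<^esub> a = b" if "b \<in> carrier M"
    using that assms(2) by (simp add: a_minus_def a_assoc l_neg)
  have **: "(h \<oplus>\<^bsub>M\<^esub> a) \<ominus>\<^bsub>M\<^esub> a = h" if "h \<in> U" for h
    using that assms(2) U by (auto simp: a_minus_def a_assoc r_neg subset_iff)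
  show ?thesis
  proof
    assume "b \<in> U +>\<^bsub>M\<^esub> a"
    then show "b \<in> carrier M \<and> b \<ominus>\<^bsub>M\<^esub> a \<in> U"
      unfolding a_r_coset_def' using ** U assms(2) by (auto simp: subset_iff)
  next
    assume "b \<in> carrier M \<and> b \<ominus>\<^bsub>M\<^esub> a \<in> U"
    then show "b \<in> U +>\<^bsub>M\<^esub> a"
      unfolding a_r_coset_def' using * by (metis (no_types, lifting) UN_I singletonI)
  qed
qed

lemma quot_coset_eq_iff:
  assumes "csub U M" "a \<in> carrier M" "b \<in> carrier M"
  shows "U +>\<^bsub>M\<^esub> a = U +>\<^bsub>M\<^esub> b \<longleftrightarrow> a \<ominus>\<^bsub>M\<^esub> b \<in> U"
proof
  interpret vectorspace class_ring M by (rule csubD(1)[OF assms(1)])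
  note U = csubD[OF assms(1)]
  show "a \<ominus>\<^bsub>M\<^esub> b \<in> U" if "U +>\<^bsub>M\<^esub> a = U +>\<^bsub>M\<^esub> b"
  proof -
    have "a \<in> U +>\<^bsub>M\<^esub> a" using U(3) assms(2) by (simp add: quot_coset_mem[OF assms(1)] a_minus_def r_neg)
    then show ?thesis using that by (simp add: quot_coset_mem[OF assms(1)] assms)
  qed
  show "U +>\<^bsub>M\<^esub> a = U +>\<^bsub>M\<^esub> b" if ab: "a \<ominus>\<^bsub>M\<^esub> b \<in> U"
  proof -
    have 1: "x \<ominus>\<^bsub>M\<^esub> b = (x \<ominus>\<^bsub>M\<^esub> a) \<oplus>\<^bsub>M\<^esub> (a \<ominus>\<^bsub>M\<^esub> b)" if "x \<in> carrier M" for x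
      using that assms(2,3) by (simp add: a_minus_def a_assoc l_neg r_neg1)
    have 2: "x \<ominus>\<^bsub>M\<^esub> a = (x \<ominus>\<^bsub>M\<^esub> b) \<ominus>\<^bsub>M\<^esub> (a \<ominus>\<^bsub>M\<^esub> b)" if "x \<in> carrier M" for x
    proof -
      have "(x \<ominus>\<^bsub>M\<^esub> b) \<ominus>\<^bsub>M\<^esub> (a \<ominus>\<^bsub>M\<^esub> b) = (\<ominus>\<^bsub>M\<^esub> b \<oplus>\<^bsub>M\<^esub> b) \<oplus>\<^bsub>M\<^esub> (x \<oplus>\<^bsub>M\<^esub> \<ominus>\<^bsub>M\<^esub> a)"
        using that assms(2,3) unfolding a_minus_def minus_add[OF assms(2) a_inv_closed[OF assms(3)]]
        by (simp add: a_ac del: l_neg r_neg)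
      then show ?thesis using that assms(2,3) by (simp add: l_neg a_minus_def)
    qed
    have "x \<ominus>\<^bsub>M\<^esub> a \<in> U \<longleftrightarrow> x \<ominus>\<^bsub>M\<^esub> b \<in> U" if "x \<in> carrier M" for x
      using 1[OF that] 2[OF that] U(4)[OF _ ab] csub_minus[OF assms(1) _ ab] by metis
    then show ?thesis using assms by (auto simp: quot_coset_mem)
  qed
qed

lemma coset_map_eq:
  assumes "csub U M" "a \<in> A" "\<And>x. x \<in> A \<Longrightarrow> g x \<in> carrier M"
    and "\<And>x. x \<in> A \<Longrightarrow> g x \<ominus>\<^bsub>M\<^esub> g a \<in> U"
  shows "coset_map M U g A = U +>\<^bsub>M\<^esub> g a"
proof -
  have "U +>\<^bsub>M\<^esub> g x = U +>\<^bsub>M\<^esub> g a" if "x \<in> A" for x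
    using assms that by (simp add: quot_coset_eq_iff)
  then show ?thesis using assms(2) unfolding coset_map_def by blast
qed

text \<open>\<open>coset_map\<close> is a union of cosets. It collapses to a single one because g
  maps U' into U, so that all members of the source coset have the same class.\<close>

lemma coset_map_coset:
  assumes "csub U M" "csub U' N" "g \<in> chom N M" "a \<in> carrier N" "\<And>u. u \<in> U' \<Longrightarrow> g u \<in> U"
  shows "coset_map M U g (U' +>\<^bsub>N\<^esub> a) = U +>\<^bsub>M\<^esub> g a"
proof (rule coset_map_eq[OF assms(1)])
  note N = csubD(1)[OF assms(2)] and M = csubD(1)[OF assms(1)]
  interpret vectorspace class_ring N by (rule N)
  show "a \<in> U' +>\<^bsub>N\<^esub> a"
    using assms csubD(3)[OF assms(2)] by (simp add: quot_coset_mem[OF assms(2)] a_minus_def r_neg)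
  fix x assume x: "x \<in> U' +>\<^bsub>N\<^esub> a"
  then show "g x \<in> carrier M" using chomD(1)[OF assms(3)] assms(2,4) by (simp add: quot_coset_mem)
  show "g x \<ominus>\<^bsub>M\<^esub> g a \<in> U"
    using x assms(4,5) chom_minus[OF N M assms(3)] by (auto simp: quot_coset_mem[OF assms(2)] simp flip: chom_minus[OF N M assms(3)])
qed

lemma quot_space_simps:
  "carrier (quot_space M U) = (\<lambda>a. U +>\<^bsub>M\<^esub> a) ` carrier M" "\<zero>\<^bsub>quot_space M U\<^esub> = U"
  by (auto simp: quot_space_def A_RCOSETS_def')

lemma quot_add:
  assumes "csub U M" "a \<in> carrier M" "b \<in> carrier M"
  shows "(U +>\<^bsub>M\<^esub> a) \<oplus>\<^bsub>quot_space M U\<^esub> (U +>\<^bsub>M\<^esub> b) = U +>\<^bsub>M\<^esub> (a \<oplus>\<^bsub>M\<^esub> b)"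
  using abelian_subgroup.a_rcos_sum[OF csub_abelian_subgroup[OF assms(1)] assms(2,3)]
  by (simp add: quot_space_def)

lemma quot_smult:
  assumes "csub U M" "a \<in> carrier M"
  shows "c \<odot>\<^bsub>quot_space M U\<^esub> (U +>\<^bsub>M\<^esub> a) = U +>\<^bsub>M\<^esub> (c \<odot>\<^bsub>M\<^esub> a)"
proof -
  interpret vectorspace class_ring M by (rule csubD(1)[OF assms(1)])
  have "(\<lambda>a. c \<odot>\<^bsub>M\<^esub> a) \<in> chom M M"
  proof (intro chomI)
    fix d v assume v: "v \<in> carrier M"
    show "c \<odot>\<^bsub>M\<^esub> (d \<odot>\<^bsub>M\<^esub> v) = d \<odot>\<^bsub>M\<^esub> (c \<odot>\<^bsub>M\<^esub> v)"
      using smult_assoc1[of c d v] smult_assoc1[of d c v] v by (simp add: mult.commute)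
  qed (use smult_closed[of c] smult_r_distr[of c] in auto)
  from coset_map_coset[OF assms(1,1) this assms(2)] csubD(5)[OF assms(1)] show ?thesis
    by (simp add: quot_space_def)
qed

lemma quot_vs:
  assumes "csub U M"
  shows "cvs (quot_space M U)"
proof -
  interpret vectorspace class_ring M by (rule csubD(1)[OF assms(1)])
  let ?Q = "quot_space M U"
  have z0: "a \<ominus>\<^bsub>M\<^esub> \<zero>\<^bsub>M\<^esub> = a" if "a \<in> carrier M" for a
    using that by (simp add: a_minus_def)
  have U: "U +>\<^bsub>M\<^esub> \<zero>\<^bsub>M\<^esub> = U"
    using csubD(2)[OF assms] by (auto simp: quot_coset_mem[OF assms zero_closed] z0)
  note q = quot_add[OF assms] quot_smult[OF assms] 
  have sm: "c \<odot>\<^bsub>M\<^esub> v \<in> carrier M" if "v \<in> carrier M" for c v using smult_closed[of c v] that by simp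
  have one: "1 \<odot>\<^bsub>M\<^esub> v = v" if "v \<in> carrier M" for v using smult_one[of v] that by simp
  have sa: "(c * d) \<odot>\<^bsub>M\<^esub> v = c \<odot>\<^bsub>M\<^esub> (d \<odot>\<^bsub>M\<^esub> v)" if "v \<in> carrier M" for c d v
    using smult_assoc1[of c d v] that by simp
  have dl: "(c + d) \<odot>\<^bsub>M\<^esub> v = c \<odot>\<^bsub>M\<^esub> v \<oplus>\<^bsub>M\<^esub> d \<odot>\<^bsub>M\<^esub> v" if "v \<in> carrier M" for c d v
    using smult_l_distr[of c d v] that by simp
  have dr: "c \<odot>\<^bsub>M\<^esub> (v \<oplus>\<^bsub>M\<^esub> w) = c \<odot>\<^bsub>M\<^esub> v \<oplus>\<^bsub>M\<^esub> c \<odot>\<^bsub>M\<^esub> w" if "v \<in> carrier M" "w \<in> carrier M" for c v w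
    using smult_r_distr[of c v w] that by simp
  show ?thesis
  proof (rule vs_criteria[OF class_field])
    show "\<zero>\<^bsub>?Q\<^esub> \<in> carrier ?Q"
      unfolding quot_space_simps by (rule image_eqI[where x = "\<zero>\<^bsub>M\<^esub>"]) (simp_all add: U)
    show "\<forall>v\<in>carrier ?Q. v \<oplus>\<^bsub>?Q\<^esub> \<zero>\<^bsub>?Q\<^esub> = v"
    proof
      fix v assume "v \<in> carrier ?Q"
      then obtain a where a: "a \<in> carrier M" "v = U +>\<^bsub>M\<^esub> a" by (auto simp: quot_space_simps)
      show "v \<oplus>\<^bsub>?Q\<^esub> \<zero>\<^bsub>?Q\<^esub> = v" using q(1)[of a "\<zero>\<^bsub>M\<^esub>"] a by (simp add: quot_space_simps U)
    qed
    show "\<forall>v w. v \<in> carrier ?Q \<and> w \<in> carrier ?Q \<longrightarrow> v \<oplus>\<^bsub>?Q\<^esub> w = w \<oplus>\<^bsub>?Q\<^esub> v"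
      using a_comm by (auto simp: quot_space_simps q)
    show "\<forall>v\<in>carrier ?Q. \<exists>w\<in>carrier ?Q. v \<oplus>\<^bsub>?Q\<^esub> w = \<zero>\<^bsub>?Q\<^esub>"
    proof
      fix v assume "v \<in> carrier ?Q"
      then obtain a where a: "a \<in> carrier M" "v = U +>\<^bsub>M\<^esub> a" by (auto simp: quot_space_simps)
      then have "v \<oplus>\<^bsub>?Q\<^esub> (U +>\<^bsub>M\<^esub> (\<ominus>\<^bsub>M\<^esub> a)) = \<zero>\<^bsub>?Q\<^esub>"
        using q(1)[of a "\<ominus>\<^bsub>M\<^esub> a"] by (simp add: quot_space_simps r_neg U)
      then show "\<exists>w\<in>carrier ?Q. v \<oplus>\<^bsub>?Q\<^esub> w = \<zero>\<^bsub>?Q\<^esub>" using a by (auto simp: quot_space_simps)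
    qed
    show "\<forall>v w. v \<in> carrier ?Q \<and> w \<in> carrier ?Q \<longrightarrow> v \<oplus>\<^bsub>?Q\<^esub> w \<in> carrier ?Q"
      by (auto simp: quot_space_simps(1) q)
    show "\<forall>c v. c \<in> carrier class_ring \<and> v \<in> carrier ?Q \<longrightarrow> c \<odot>\<^bsub>?Q\<^esub> v \<in> carrier ?Q"
      using sm by (auto simp: quot_space_simps(1) q)
    show "\<forall>u v w. u \<in> carrier ?Q \<and> v \<in> carrier ?Q \<and> w \<in> carrier ?Q \<longrightarrow>
        (u \<oplus>\<^bsub>?Q\<^esub> v) \<oplus>\<^bsub>?Q\<^esub> w = u \<oplus>\<^bsub>?Q\<^esub> (v \<oplus>\<^bsub>?Q\<^esub> w)"
      by (auto simp: quot_space_simps(1) q a_assoc)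
  qed (auto simp: quot_space_simps(1) q sm one sa dl dr)
qed

lemma quot_proj_chom: "csub U M \<Longrightarrow> (\<lambda>a. U +>\<^bsub>M\<^esub> a) \<in> chom M (quot_space M U)"
  by (intro chomI) (auto simp: quot_space_simps quot_add quot_smult)

lemma quot_proj_eq_zero_iff:
  assumes "csub U M" "a \<in> carrier M"
  shows "U +>\<^bsub>M\<^esub> a = \<zero>\<^bsub>quot_space M U\<^esub> \<longleftrightarrow> a \<in> U"
proof -
  interpret vectorspace class_ring M by (rule csubD(1)[OF assms(1)])
  have z0: "a \<ominus>\<^bsub>M\<^esub> \<zero>\<^bsub>M\<^esub> = a" if "a \<in> carrier M" for a
    using that by (simp add: a_minus_def)
  have U: "U +>\<^bsub>M\<^esub> \<zero>\<^bsub>M\<^esub> = U"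
    using csubD(2)[OF assms(1)] by (auto simp: quot_coset_mem[OF assms(1)] z0)
  show ?thesis using quot_coset_eq_iff[OF assms zero_closed] assms(2)
    by (simp add: quot_space_simps U z0)
qed

lemma cdim_quot_space:
  assumes "csub U M" "vectorspace.fin_dim (class_ring :: complex ring) M"
  shows "cdim (quot_space M U) + cdim (M\<lparr>carrier := U\<rparr>) = cdim M"
    and "vectorspace.fin_dim (class_ring :: complex ring) (quot_space M U)"
proof -
  note r = rank_nullity_csub[OF quot_vs[OF assms(1)] quot_proj_chom[OF assms(1)]
      csub_carrier[OF csubD(1)[OF assms(1)]] assms(2)]
  have 1: "{v \<in> carrier M. U +>\<^bsub>M\<^esub> v = \<zero>\<^bsub>quot_space M U\<^esub>} = U"
    using quot_proj_eq_zero_iff[OF assms(1)] csubD(2)[OF assms(1)] by blast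
  have 2: "(quot_space M U)\<lparr>carrier := (\<lambda>a. U +>\<^bsub>M\<^esub> a) ` carrier M\<rparr> = quot_space M U"
    unfolding quot_space_simps(1)[symmetric] by simp
  have 3: "M\<lparr>carrier := carrier M\<rparr> = M" by simp
  show "cdim (quot_space M U) + cdim (M\<lparr>carrier := U\<rparr>) = cdim M"
    using r(1) unfolding 1 2 3 .
  show "vectorspace.fin_dim (class_ring :: complex ring) (quot_space M U)"
    using r(2) unfolding 2 .
qed

subsection \<open>Filtrations\<close>

text \<open>Read e a as dim V^a and e' a as the dimension just after a. The intervals from e' a to e
  a at different points do not overlap and lie between l and m, so their lengths add up to at most m
  - l. The induction splits off the smallest point b; the remaining drops fit below e' b.\<close>

lemma sum_drops_le:
  fixes e e' :: "rat \<Rightarrow> nat"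
  assumes "finite A" "\<And>a. e' a \<le> e a" "\<And>a b. a < b \<Longrightarrow> e b \<le> e' a"
  shows "(\<And>a. a \<in> A \<Longrightarrow> e a \<le> m) \<Longrightarrow> (\<And>a. a \<in> A \<Longrightarrow> l \<le> e' a) \<Longrightarrow> l \<le> m
    \<Longrightarrow> (\<Sum>a\<in>A. e a - e' a) + l \<le> m"
  using assms(1)
proof (induction A arbitrary: m rule: finite_linorder_min_induct)
  case (insert b A)
  have "(\<Sum>a\<in>A. e a - e' a) + l \<le> e' b"
    by (rule insert.IH) (use insert assms(3) in auto)
  moreover have "b \<notin> A" using insert.hyps(2) by auto
  ultimately show ?case
    using insert.hyps(1) insert.prems(1)[of b] assms(2)[of b] by simp
qed simp

lemma size_filter_mset_eq_sum: "size {#x \<in># S. P x#} = (\<Sum>a | a \<in># S \<and> P a. count S a)"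
  by (auto simp: size_multiset_overloaded_eq intro!: sum.cong)

text \<open>A filtration in this sense may fail to be exhaustive or separated, so sums of graded
  dimensions are bounded by dimensions rather than equal to them.\<close>

locale filtered_space =
  fixes M :: "(complex, 'v) module" and V :: "rat \<Rightarrow> 'v set"
  assumes fin_dim: "vectorspace.fin_dim (class_ring :: complex ring) M"
    and V_csub: "\<And>a. csub (V a) M"
    and V_antimono: "\<And>a b. a \<le> b \<Longrightarrow> V b \<subseteq> V a"
begin

abbreviation sdim :: "'v set \<Rightarrow> nat" where
  "sdim W \<equiv> cdim (M\<lparr>carrier := W\<rparr>)"

abbreviation Vgt :: "rat \<Rightarrow> 'v set" where
  "Vgt a \<equiv> \<Union>b\<in>{a<..}. V b"

lemma vs: "cvs M"
  using V_csub csubD(1) by blast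

text \<open>The union runs over a chain: two of its members lie together in V at the smaller of
  their two indices.\<close>

lemma Vgt_csub: "csub (Vgt a) M"
proof (rule csubI[OF vs])
  note V = csubD[OF V_csub]
  show "Vgt a \<subseteq> carrier M" using V(2) by auto
  show "\<zero>\<^bsub>M\<^esub> \<in> Vgt a" using V(3) gt_ex[of a] by auto
  show "c \<odot>\<^bsub>M\<^esub> v \<in> Vgt a" if "v \<in> Vgt a" for c v using that V(5) by auto
  fix v w assume "v \<in> Vgt a" "w \<in> Vgt a"
  then obtain b c where "a < b" "a < c" "v \<in> V b" "w \<in> V c" by auto
  then have "a < min b c" "v \<in> V (min b c)" "w \<in> V (min b c)"
    using V_antimono[of "min b c" b] V_antimono[of "min b c" c] by auto
  then show "v \<oplus>\<^bsub>M\<^esub> w \<in> Vgt a" using V(4) by blast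
qed

lemma Vgt_le: "Vgt a \<subseteq> V a"
  by (intro UN_least V_antimono) auto

lemma gr_dim_eq: "gr_dim M V a + sdim (Vgt a) = sdim (V a)"
proof -
  from cdim_quot_space(1)[OF csub_restrict[OF Vgt_csub V_csub Vgt_le] csub_fin_dim[OF V_csub fin_dim]]
  show ?thesis by (simp add: gr_dim_def)
qed

lemma quot_filtered_space:
  assumes K: "csub K M"
  shows "filtered_space (quot_space M K) (\<lambda>a. (\<lambda>v. K +>\<^bsub>M\<^esub> v) ` V a)"
proof (rule filtered_space.intro)
  show "vectorspace.fin_dim (class_ring :: complex ring) (quot_space M K)"
    by (rule cdim_quot_space(2)[OF K fin_dim])
  show "csub ((\<lambda>v. K +>\<^bsub>M\<^esub> v) ` V a) (quot_space M K)" for a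
    by (rule csub_image[OF quot_vs[OF K] quot_proj_chom[OF K] V_csub])
qed (rule image_mono[OF V_antimono])

lemma sdim_quot:
  assumes K: "csub K M" and W: "csub W M"
  shows "cdim ((quot_space M K)\<lparr>carrier := (\<lambda>v. K +>\<^bsub>M\<^esub> v) ` W\<rparr>) + sdim (W \<inter> K) = sdim W"
proof -
  have "{v \<in> W. K +>\<^bsub>M\<^esub> v = \<zero>\<^bsub>quot_space M K\<^esub>} = W \<inter> K"
    using quot_proj_eq_zero_iff[OF K] csubD(2)[OF W] by blast
  then show ?thesis
    using rank_nullity_csub(1)[OF quot_vs[OF K] quot_proj_chom[OF K] W fin_dim] by simp
qed

text \<open>By rank-nullity the image of W in M/K has dimension dim W - dim (W \<inter> K). What the
  graded piece loses in the quotient is therefore the jump of the filtration induced on K. The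
  subtractions on \<open>nat\<close> do not truncate, since V^a \<inter> K contains the later
  intersections.\<close>

lemma gr_dim_quot:
  assumes K: "csub K M"
  shows "gr_dim M V a - gr_dim (quot_space M K) (\<lambda>a. (\<lambda>v. K +>\<^bsub>M\<^esub> v) ` V a) a
    = sdim (V a \<inter> K) - sdim (Vgt a \<inter> K)"
proof -
  interpret Q: filtered_space "quot_space M K" "\<lambda>a. (\<lambda>v. K +>\<^bsub>M\<^esub> v) ` V a"
    by (rule quot_filtered_space[OF K])
  have im: "Q.Vgt a = (\<lambda>v. K +>\<^bsub>M\<^esub> v) ` Vgt a" by auto
  have "sdim (Vgt a \<inter> K) \<le> sdim (V a \<inter> K)"
    by (intro cdim_mono[OF _ _ _ fin_dim] csub_Int V_csub Vgt_csub K Int_mono Vgt_le order_refl)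
  moreover note gr_dim_eq[of a] Q.gr_dim_eq[of a, unfolded im]
    sdim_quot[OF K V_csub[of a]] sdim_quot[OF K Vgt_csub[of a]]
  ultimately show ?thesis by linarith
qed

text \<open>All jumps at indices \<ge> b take place inside V b, so \<open>sum_drops_le\<close>
  applies with the bounds 0 and dim V b.\<close>

lemma sum_gr_le_sdim:
  assumes "finite A" "\<And>a. a \<in> A \<Longrightarrow> b \<le> a"
  shows "(\<Sum>a\<in>A. gr_dim M V a) \<le> sdim (V b)"
proof -
  have gr: "gr_dim M V a = sdim (V a) - sdim (Vgt a)" for a using gr_dim_eq[of a] by linarith
  have "(\<Sum>a\<in>A. sdim (V a) - sdim (Vgt a)) + 0 \<le> sdim (V b)"
  proof (rule sum_drops_le[OF assms(1)])
    show "sdim (Vgt a) \<le> sdim (V a)" for a using gr_dim_eq[of a] by linarith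
    show "sdim (V c) \<le> sdim (Vgt a)" if "a < c" for a c
      using that by (intro cdim_mono[OF V_csub Vgt_csub _ fin_dim]) auto
    show "sdim (V a) \<le> sdim (V b)" if "a \<in> A" for a
      by (intro cdim_mono[OF V_csub V_csub _ fin_dim] V_antimono assms(2)[OF that])
  qed auto
  then show ?thesis by (simp add: gr)
qed

text \<open>The left-hand side is at most the codimension of \<open>K \<inter> V (b + 1)\<close> in \<open>K = \<phi> M\<close>; since \<open>\<phi>\<close>
  maps \<open>V b\<close> into \<open>V (b + 1)\<close>, this is at most the codimension of \<open>V b\<close> in \<open>M\<close>.\<close>

lemma size_diff_spectra_le:
  assumes \<phi>: "\<phi> \<in> chom M M" and shift: "\<And>a. \<phi> ` V a \<subseteq> V (a + 1)"
    and S: "\<And>a. count S a = gr_dim M V a" "cdim M \<le> size S"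
    and T: "\<And>a. count T a
      = gr_dim (quot_space M (\<phi> ` carrier M)) (\<lambda>a. (\<lambda>v. (\<phi> ` carrier M) +>\<^bsub>M\<^esub> v) ` V a) a"
  shows "size {#x \<in># S - T. x < b + 1#} \<le> size {#x \<in># S. x < b#}"
proof -
  let ?K = "\<phi> ` carrier M"
  have K: "csub ?K M" by (rule csub_image[OF vs \<phi> csub_carrier[OF vs]])
  let ?k = "\<lambda>a. sdim (V a \<inter> ?K)" and ?k' = "\<lambda>a. sdim (Vgt a \<inter> ?K)"
  \<comment> \<open>Multiset difference truncates at 0 exactly like subtraction on
    \<open>nat\<close>, so \<open>gr_dim_quot\<close> gives the multiplicities as they
    stand.\<close>
  have cnt: "count (S - T) a = ?k a - ?k' a" for a
    using gr_dim_quot[OF K] S(1) T by simp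
  let ?A = "{a \<in> set_mset (S - T). a < b + 1}"
  have "size {#x \<in># S - T. x < b + 1#} = (\<Sum>a\<in>?A. count (S - T) a)"
    by (rule size_filter_mset_eq_sum)
  also have "\<dots> = (\<Sum>a\<in>?A. ?k a - ?k' a)" by (simp only: cnt)
  finally have 1: "size {#x \<in># S - T. x < b + 1#} = (\<Sum>a\<in>?A. ?k a - ?k' a)" .
  have "(\<Sum>a\<in>?A. ?k a - ?k' a) + ?k (b + 1) \<le> sdim ?K"
  proof (rule sum_drops_le)
    show "?k' a \<le> ?k a" for a
      by (intro cdim_mono[OF _ _ _ fin_dim] csub_Int V_csub Vgt_csub K Int_mono Vgt_le order_refl)
    show "?k c \<le> ?k' a" if "a < c" for a c
      using that by (intro cdim_mono[OF _ _ _ fin_dim] csub_Int V_csub Vgt_csub K) auto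
    show "?k a \<le> sdim ?K" for a
      by (intro cdim_mono[OF _ _ _ fin_dim] csub_Int V_csub K) auto
    show "?k (b + 1) \<le> sdim ?K"
      by (intro cdim_mono[OF _ _ _ fin_dim] csub_Int V_csub K) auto
    show "?k (b + 1) \<le> ?k' a" if "a \<in> ?A" for a
      using that by (intro cdim_mono[OF _ _ _ fin_dim] csub_Int V_csub Vgt_csub K) auto
  qed auto
  moreover have "sdim (\<phi> ` V b) \<le> ?k (b + 1)"
    by (intro cdim_mono[OF _ _ _ fin_dim] csub_Int V_csub K csub_image[OF vs \<phi>]
        Int_greatest shift image_mono csubD(2)[OF V_csub])
  \<comment> \<open>Two rank-nullity counts, on V b and on M. Since the kernel inside V b is part of
    the whole kernel, their difference bounds dim K - dim \<phi>(V b) by the codimension of V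
    b.\<close>
  moreover have "sdim (\<phi> ` V b) + sdim {v \<in> V b. \<phi> v = \<zero>\<^bsub>M\<^esub>} = sdim (V b)"
    by (rule rank_nullity_csub(1)[OF vs \<phi> V_csub fin_dim])
  moreover have "sdim ?K + sdim {v \<in> carrier M. \<phi> v = \<zero>\<^bsub>M\<^esub>} = cdim M"
    using rank_nullity_csub(1)[OF vs \<phi> csub_carrier[OF vs] fin_dim] by simp
  moreover have "sdim {v \<in> V b. \<phi> v = \<zero>\<^bsub>M\<^esub>} \<le> sdim {v \<in> carrier M. \<phi> v = \<zero>\<^bsub>M\<^esub>}"
  proof (rule cdim_mono[OF _ _ _ fin_dim])
    show k: "csub {v \<in> carrier M. \<phi> v = \<zero>\<^bsub>M\<^esub>} M" by (rule csub_ker[OF vs vs \<phi>])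
    have "{v \<in> V b. \<phi> v = \<zero>\<^bsub>M\<^esub>} = V b \<inter> {v \<in> carrier M. \<phi> v = \<zero>\<^bsub>M\<^esub>}"
      using csubD(2)[OF V_csub] by auto
    then show "csub {v \<in> V b. \<phi> v = \<zero>\<^bsub>M\<^esub>} M" using csub_Int[OF V_csub k] by simp
  qed (use csubD(2)[OF V_csub] in auto)
  ultimately have 2: "size {#x \<in># S - T. x < b + 1#} + sdim (V b) \<le> cdim M"
    using 1 by linarith
  \<comment> \<open>Here the size of S stands in for exhaustion: at most dim V b members are \<ge>
    b, and S has at least dim M members, so at least codim V b of them are < b.\<close>
  have "size {#x \<in># S. \<not> x < b#} = (\<Sum>a | a \<in># S \<and> \<not> a < b. count S a)"
    by (rule size_filter_mset_eq_sum)
  also have "\<dots> \<le> sdim (V b)"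
    unfolding S(1) by (rule sum_gr_le_sdim) auto
  finally have "size {#x \<in># S. \<not> x < b#} \<le> sdim (V b)" .
  moreover have "size S = size {#x \<in># S. x < b#} + size {#x \<in># S. \<not> x < b#}"
    by (subst multiset_partition[of S "\<lambda>x. x < b"]) (rule size_union)
  ultimately show ?thesis using 2 S(2) by linarith
qed

end

section \<open>Arithmetic in complex vector spaces\<close>

lemma cvs_closed:
  assumes "cvs M"
  shows "\<zero>\<^bsub>M\<^esub> \<in> carrier M"
    and "v \<in> carrier M \<Longrightarrow> w \<in> carrier M \<Longrightarrow> v \<oplus>\<^bsub>M\<^esub> w \<in> carrier M"
    and "v \<in> carrier M \<Longrightarrow> w \<in> carrier M \<Longrightarrow> v \<ominus>\<^bsub>M\<^esub> w \<in> carrier M"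
    and "v \<in> carrier M \<Longrightarrow> c \<odot>\<^bsub>M\<^esub> v \<in> carrier M"
  by (rule csubD(3,4)[OF csub_carrier[OF assms]] csub_minus[OF csub_carrier[OF assms]]
      csubD(5)[OF csub_carrier[OF assms]]; assumption)+

lemma cvs_add:
  assumes "cvs M" "v \<in> carrier M"
  shows "v \<oplus>\<^bsub>M\<^esub> \<zero>\<^bsub>M\<^esub> = v" "\<zero>\<^bsub>M\<^esub> \<oplus>\<^bsub>M\<^esub> v = v" "v \<ominus>\<^bsub>M\<^esub> v = \<zero>\<^bsub>M\<^esub>"
    "w \<in> carrier M \<Longrightarrow> v \<oplus>\<^bsub>M\<^esub> w = w \<oplus>\<^bsub>M\<^esub> v"
    "w \<in> carrier M \<Longrightarrow> x \<in> carrier M \<Longrightarrow> (v \<oplus>\<^bsub>M\<^esub> w) \<oplus>\<^bsub>M\<^esub> x = v \<oplus>\<^bsub>M\<^esub> (w \<oplus>\<^bsub>M\<^esub> x)"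
    "w \<in> carrier M \<Longrightarrow> x \<in> carrier M \<Longrightarrow> v \<oplus>\<^bsub>M\<^esub> (w \<oplus>\<^bsub>M\<^esub> x) = w \<oplus>\<^bsub>M\<^esub> (v \<oplus>\<^bsub>M\<^esub> x)"
proof -
  interpret vectorspace class_ring M by (rule assms(1))
  show "v \<oplus>\<^bsub>M\<^esub> \<zero>\<^bsub>M\<^esub> = v" "\<zero>\<^bsub>M\<^esub> \<oplus>\<^bsub>M\<^esub> v = v" "v \<ominus>\<^bsub>M\<^esub> v = \<zero>\<^bsub>M\<^esub>"
    using assms(2) by (auto simp: a_minus_def r_neg)
  show "w \<in> carrier M \<Longrightarrow> v \<oplus>\<^bsub>M\<^esub> w = w \<oplus>\<^bsub>M\<^esub> v" by (rule a_comm[OF assms(2)])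
  show "w \<in> carrier M \<Longrightarrow> x \<in> carrier M \<Longrightarrow> (v \<oplus>\<^bsub>M\<^esub> w) \<oplus>\<^bsub>M\<^esub> x = v \<oplus>\<^bsub>M\<^esub> (w \<oplus>\<^bsub>M\<^esub> x)"
    by (rule a_assoc[OF assms(2)])
  show "w \<in> carrier M \<Longrightarrow> x \<in> carrier M \<Longrightarrow> v \<oplus>\<^bsub>M\<^esub> (w \<oplus>\<^bsub>M\<^esub> x) = w \<oplus>\<^bsub>M\<^esub> (v \<oplus>\<^bsub>M\<^esub> x)"
    by (rule a_lcomm[OF assms(2)])
qed

lemma cvs_smult:
  assumes "cvs M" "v \<in> carrier M"
  shows "1 \<odot>\<^bsub>M\<^esub> v = v" "0 \<odot>\<^bsub>M\<^esub> v = \<zero>\<^bsub>M\<^esub>"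
    "c \<odot>\<^bsub>M\<^esub> (d \<odot>\<^bsub>M\<^esub> v) = (c * d) \<odot>\<^bsub>M\<^esub> v"
    "(c + d) \<odot>\<^bsub>M\<^esub> v = c \<odot>\<^bsub>M\<^esub> v \<oplus>\<^bsub>M\<^esub> d \<odot>\<^bsub>M\<^esub> v"
    "w \<in> carrier M \<Longrightarrow> c \<odot>\<^bsub>M\<^esub> (v \<oplus>\<^bsub>M\<^esub> w) = c \<odot>\<^bsub>M\<^esub> v \<oplus>\<^bsub>M\<^esub> c \<odot>\<^bsub>M\<^esub> w"
    "w \<in> carrier M \<Longrightarrow> w \<ominus>\<^bsub>M\<^esub> v = w \<oplus>\<^bsub>M\<^esub> (-1) \<odot>\<^bsub>M\<^esub> v"
proof -
  interpret vectorspace class_ring M by (rule assms(1))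
  show 1: "1 \<odot>\<^bsub>M\<^esub> v = v" using smult_one[OF assms(2)] by simp
  show 0: "0 \<odot>\<^bsub>M\<^esub> v = \<zero>\<^bsub>M\<^esub>" using lmult_0[OF assms(2)] by simp
  show "c \<odot>\<^bsub>M\<^esub> (d \<odot>\<^bsub>M\<^esub> v) = (c * d) \<odot>\<^bsub>M\<^esub> v" using smult_assoc1[of c d v] assms(2) by simp
  have d: "(c + d) \<odot>\<^bsub>M\<^esub> v = c \<odot>\<^bsub>M\<^esub> v \<oplus>\<^bsub>M\<^esub> d \<odot>\<^bsub>M\<^esub> v" for c d
    using smult_l_distr[of c d v] assms(2) by simp
  show "(c + d) \<odot>\<^bsub>M\<^esub> v = c \<odot>\<^bsub>M\<^esub> v \<oplus>\<^bsub>M\<^esub> d \<odot>\<^bsub>M\<^esub> v" by (rule d)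
  show "w \<in> carrier M \<Longrightarrow> c \<odot>\<^bsub>M\<^esub> (v \<oplus>\<^bsub>M\<^esub> w) = c \<odot>\<^bsub>M\<^esub> v \<oplus>\<^bsub>M\<^esub> c \<odot>\<^bsub>M\<^esub> w"
    using smult_r_distr[of c v w] assms(2) by simp
  have "(-1) \<odot>\<^bsub>M\<^esub> v \<oplus>\<^bsub>M\<^esub> v = \<zero>\<^bsub>M\<^esub>" using d[of "-1" 1] 0 1 by simp
  then have "\<ominus>\<^bsub>M\<^esub> v = (-1) \<odot>\<^bsub>M\<^esub> v"
    by (rule minus_equality[OF _ assms(2) cvs_closed(4)[OF assms]])
  then show "w \<in> carrier M \<Longrightarrow> w \<ominus>\<^bsub>M\<^esub> v = w \<oplus>\<^bsub>M\<^esub> (-1) \<odot>\<^bsub>M\<^esub> v" by (simp add: a_minus_def)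
qed

lemma cvs_smult_zero: "cvs M \<Longrightarrow> c \<odot>\<^bsub>M\<^esub> \<zero>\<^bsub>M\<^esub> = \<zero>\<^bsub>M\<^esub>"
  using cvs_smult(2,3)[of M "\<zero>\<^bsub>M\<^esub>"] cvs_closed(1)[of M] by (metis mult_zero_right)

text \<open>As rewrite rules these merge adjacent multiples of one vector in a right-nested sum,
  both at its end and in front of a remaining summand x. They let \<open>simp\<close> compare linear
  combinations.\<close>

lemma cvs_add_smult:
  assumes "cvs M" "v \<in> carrier M"
  shows "c \<odot>\<^bsub>M\<^esub> v \<oplus>\<^bsub>M\<^esub> d \<odot>\<^bsub>M\<^esub> v = (c + d) \<odot>\<^bsub>M\<^esub> v"
    "v \<oplus>\<^bsub>M\<^esub> d \<odot>\<^bsub>M\<^esub> v = (1 + d) \<odot>\<^bsub>M\<^esub> v"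
    "x \<in> carrier M \<Longrightarrow> c \<odot>\<^bsub>M\<^esub> v \<oplus>\<^bsub>M\<^esub> (d \<odot>\<^bsub>M\<^esub> v \<oplus>\<^bsub>M\<^esub> x) = (c + d) \<odot>\<^bsub>M\<^esub> v \<oplus>\<^bsub>M\<^esub> x"
    "x \<in> carrier M \<Longrightarrow> v \<oplus>\<^bsub>M\<^esub> (d \<odot>\<^bsub>M\<^esub> v \<oplus>\<^bsub>M\<^esub> x) = (1 + d) \<odot>\<^bsub>M\<^esub> v \<oplus>\<^bsub>M\<^esub> x"
    "d \<odot>\<^bsub>M\<^esub> v \<oplus>\<^bsub>M\<^esub> v = (1 + d) \<odot>\<^bsub>M\<^esub> v"
proof -
  note s = cvs_smult[OF assms] and cl = cvs_closed(4)[OF assms]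
  show "c \<odot>\<^bsub>M\<^esub> v \<oplus>\<^bsub>M\<^esub> d \<odot>\<^bsub>M\<^esub> v = (c + d) \<odot>\<^bsub>M\<^esub> v" by (rule s(4)[symmetric])
  show "v \<oplus>\<^bsub>M\<^esub> d \<odot>\<^bsub>M\<^esub> v = (1 + d) \<odot>\<^bsub>M\<^esub> v" by (simp only: s(1,4))
  show "d \<odot>\<^bsub>M\<^esub> v \<oplus>\<^bsub>M\<^esub> v = (1 + d) \<odot>\<^bsub>M\<^esub> v" by (simp only: s(1,4) add.commute[of 1])
  show "x \<in> carrier M \<Longrightarrow> c \<odot>\<^bsub>M\<^esub> v \<oplus>\<^bsub>M\<^esub> (d \<odot>\<^bsub>M\<^esub> v \<oplus>\<^bsub>M\<^esub> x) = (c + d) \<odot>\<^bsub>M\<^esub> v \<oplus>\<^bsub>M\<^esub> x"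
    using cvs_add(5)[OF assms(1) cl cl] by (simp add: s(4))
  show "x \<in> carrier M \<Longrightarrow> v \<oplus>\<^bsub>M\<^esub> (d \<odot>\<^bsub>M\<^esub> v \<oplus>\<^bsub>M\<^esub> x) = (1 + d) \<odot>\<^bsub>M\<^esub> v \<oplus>\<^bsub>M\<^esub> x"
    using cvs_add(5)[OF assms cl] by (simp add: s(1,4))
qed

lemma csub_finsum_lessThan:
  assumes "csub W M" "\<And>i::nat. i < k \<Longrightarrow> g i \<in> W"
  shows "(\<Oplus>\<^bsub>M\<^esub>i\<in>{..<k}. g i) \<in> W"
proof -
  interpret vectorspace class_ring M by (rule csubD(1)[OF assms(1)])
  note W = csubD[OF assms(1)]
  show ?thesis using assms(2)
  proof (induction k)
    case (Suc k)
    have g: "g i \<in> carrier M" if "i < Suc k" for i using Suc.prems[OF that] W(2) by (rule subsetD[rotated])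
    have "(\<Oplus>\<^bsub>M\<^esub>i\<in>{..<Suc k}. g i) = g k \<oplus>\<^bsub>M\<^esub> (\<Oplus>\<^bsub>M\<^esub>i\<in>{..<k}. g i)"
      unfolding lessThan_Suc by (rule finsum_insert) (simp_all add: g Pi_iff)
    moreover have "g k \<oplus>\<^bsub>M\<^esub> (\<Oplus>\<^bsub>M\<^esub>i\<in>{..<k}. g i) \<in> W"
      by (rule W(4)[OF Suc.prems[OF lessI] Suc.IH[OF Suc.prems[OF less_SucI]]])
    ultimately show ?case by argo
  next
    case 0
    have "(\<Oplus>\<^bsub>M\<^esub>i\<in>{..<0}. g i) = \<zero>\<^bsub>M\<^esub>" by simp
    then show ?case using W(3) by argo
  qed
qed

lemma chom_comp: "S \<in> chom M N \<Longrightarrow> T \<in> chom N P \<Longrightarrow> T \<circ> S \<in> chom M P"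
  by (rule chomI) (simp_all add: chomD)

lemma chom_funpow:
  assumes "s \<in> chom M M"
  shows "(s ^^ k) \<in> chom M M"
proof (induction k)
  case (Suc k)
  show ?case unfolding funpow.simps by (rule chom_comp[OF Suc assms])
qed (simp add: module_hom_def)

lemma chom_funpow_mem: "s \<in> chom M M \<Longrightarrow> a \<in> carrier M \<Longrightarrow> (s ^^ k) a \<in> carrier M"
  by (rule chomD(1)[OF chom_funpow])

subsection \<open>The localization of a vector space by an endomorphism\<close>

locale endomorphism =
  fixes M :: "(complex, 'v) module" and s :: "'v \<Rightarrow> 'v"
  assumes vs: "cvs M" and s: "s \<in> chom M M"
begin

abbreviation "L \<equiv> localization M s"
abbreviation "fr \<equiv> frac M s"

lemmas cl = cvs_closed[OF vs]
lemmas pow_mem = chom_funpow_mem[OF s]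

lemma s_mem: "a \<in> carrier M \<Longrightarrow> s a \<in> carrier M"
  by (rule chomD(1)[OF s])

lemma s_zero: "s \<zero>\<^bsub>M\<^esub> = \<zero>\<^bsub>M\<^esub>"
  by (rule chom_zero[OF vs vs s])

lemma pow_add: "(s ^^ j) ((s ^^ k) a) = (s ^^ (j + k)) a"
  by (simp add: funpow_add)

lemma loc_rel_iff:
  "((a, j), (b, k)) \<in> loc_rel M s \<longleftrightarrow>
    a \<in> carrier M \<and> b \<in> carrier M \<and> (\<exists>l. (s ^^ (l + k)) a = (s ^^ (l + j)) b)"
  by (auto simp: loc_rel_def)

lemma loc_rel_equiv: "equiv (carrier M \<times> UNIV) (loc_rel M s)"
proof (rule equivI)
  show "loc_rel M s \<subseteq> (carrier M \<times> UNIV) \<times> (carrier M \<times> UNIV)" by (auto simp: loc_rel_def)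
  show "refl_on (carrier M \<times> UNIV) (loc_rel M s)" by (auto simp: refl_on_def loc_rel_iff)
  show "sym (loc_rel M s)"
  proof (rule symI)
    fix x y assume "(x, y) \<in> loc_rel M s"
    then show "(y, x) \<in> loc_rel M s" by (cases x; cases y) (metis loc_rel_iff)
  qed
  show "trans (loc_rel M s)"
  proof (rule transI)
    fix x y z assume "(x, y) \<in> loc_rel M s" "(y, z) \<in> loc_rel M s"
    moreover obtain a i b j c k where "x = (a, i)" "y = (b, j)" "z = (c, k)" by (cases x; cases y; cases z)
    ultimately obtain l m where *: "a \<in> carrier M" "b \<in> carrier M" "c \<in> carrier M"
      "(s ^^ (l + j)) a = (s ^^ (l + i)) b" "(s ^^ (m + k)) b = (s ^^ (m + j)) c"
      by (auto simp: loc_rel_iff)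
    \<comment> \<open>The common factor for the transitive step is s^(l + m + j): apply s^(m + k) to
      the first relation and s^(l + i) to the second.\<close>
    have "(s ^^ ((l + m + j) + k)) a = (s ^^ (m + k)) ((s ^^ (l + j)) a)" by (simp add: pow_add ac_simps)
    also have "\<dots> = (s ^^ (l + i)) ((s ^^ (m + k)) b)" unfolding *(4) by (simp add: pow_add ac_simps)
    also have "\<dots> = (s ^^ ((l + m + j) + i)) c" unfolding *(5) by (simp add: pow_add ac_simps)
    finally show "(x, z) \<in> loc_rel M s"
      using * \<open>x = _\<close> \<open>z = _\<close> by (auto simp: loc_rel_iff)
  qed
qed

lemma fr_eq_iff:
  assumes "a \<in> carrier M" "b \<in> carrier M"
  shows "fr a j = fr b k \<longleftrightarrow> (\<exists>l. (s ^^ (l + k)) a = (s ^^ (l + j)) b)"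
  using eq_equiv_class_iff[OF loc_rel_equiv, of "(a, j)" "(b, k)"] assms
  by (simp add: frac_def loc_rel_iff)

lemma fr_eqI: "a \<in> carrier M \<Longrightarrow> b \<in> carrier M \<Longrightarrow> (s ^^ k) a = (s ^^ j) b \<Longrightarrow> fr a j = fr b k"
  by (subst fr_eq_iff) (auto intro: exI[of _ 0])

lemma fr_expand: "a \<in> carrier M \<Longrightarrow> fr ((s ^^ m) a) (m + k) = fr a k"
  by (rule fr_eqI) (simp_all add: pow_mem pow_add add.commute)

lemma fr_s: "a \<in> carrier M \<Longrightarrow> fr (s a) (Suc k) = fr a k"
  using fr_expand[of a 1 k] by simp

lemma carrier_L: "carrier L = {fr a k | a k. a \<in> carrier M}"
  by (auto simp: localization_def quotient_def frac_def)

lemma fr_mem [intro]: "a \<in> carrier M \<Longrightarrow> fr a k \<in> carrier L"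
  by (auto simp: carrier_L)

lemma in_fr_iff: "a \<in> carrier M \<Longrightarrow> (b, j) \<in> fr a k \<longleftrightarrow> b \<in> carrier M \<and> fr b j = fr a k"
  using fr_eq_iff[of a b k j] by (auto simp: frac_def[of _ _ a] loc_rel_iff)

text \<open>Operations on fractions are defined as unions over all representatives. This evaluates
  such a union at one representative once F is known not to depend on the choice.\<close>

lemma fr_UN:
  assumes "a \<in> carrier M"
    and "\<And>b j. b \<in> carrier M \<Longrightarrow> fr b j = fr a k \<Longrightarrow> F b j = F a k"
  shows "(\<Union>(b, j)\<in>fr a k. F b j) = F a k"
proof -
  have "(a, k) \<in> fr a k" using assms(1) by (simp add: in_fr_iff)
  then have "fr a k \<noteq> {}" by blast
  then show ?thesis
  proof (rule SUP_eq_const)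
    show "(case x of (b, j) \<Rightarrow> F b j) = F a k" if "x \<in> fr a k" for x
      using that assms(2) by (cases x) (simp add: in_fr_iff[OF assms(1)])
  qed
qed

lemma common_denominator:
  assumes "X \<in> carrier L" "Y \<in> carrier L"
  obtains a b k where "a \<in> carrier M" "b \<in> carrier M" "X = fr a k" "Y = fr b k"
proof -
  obtain a j b k where ab: "a \<in> carrier M" "b \<in> carrier M" "X = fr a j" "Y = fr b k"
    using assms by (auto simp: carrier_L)
  then have "X = fr ((s ^^ k) a) (k + j)" "Y = fr ((s ^^ j) b) (k + j)"
    using fr_expand[of a k j] fr_expand[of b j k] by (simp_all add: add.commute)
  then show ?thesis using that ab pow_mem by blast
qed

lemma pow_lin:
  assumes "a \<in> carrier M"
  shows "b \<in> carrier M \<Longrightarrow> (s ^^ k) (a \<oplus>\<^bsub>M\<^esub> b) = (s ^^ k) a \<oplus>\<^bsub>M\<^esub> (s ^^ k) b"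
    "b \<in> carrier M \<Longrightarrow> (s ^^ k) (a \<ominus>\<^bsub>M\<^esub> b) = (s ^^ k) a \<ominus>\<^bsub>M\<^esub> (s ^^ k) b"
    "(s ^^ k) (c \<odot>\<^bsub>M\<^esub> a) = c \<odot>\<^bsub>M\<^esub> (s ^^ k) a"
  using assms by (simp_all add: chomD(2,3)[OF chom_funpow[OF s]] chom_minus[OF vs vs chom_funpow[OF s]])

lemma add_L_aux:
  assumes "a \<in> carrier M" "b \<in> carrier M"
  shows "fr a j \<oplus>\<^bsub>L\<^esub> fr b k = fr ((s ^^ k) a \<oplus>\<^bsub>M\<^esub> (s ^^ j) b) (j + k)"
proof -
  have eq: "fr ((s ^^ k') a' \<oplus>\<^bsub>M\<^esub> (s ^^ j') b') (j' + k') = fr ((s ^^ k) a \<oplus>\<^bsub>M\<^esub> (s ^^ j) b) (j + k)"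
    if ab: "a' \<in> carrier M" "b' \<in> carrier M" "fr a' j' = fr a j" "fr b' k' = fr b k" for a' b' j' k'
  proof -
    obtain l m where l: "(s ^^ (l + j)) a' = (s ^^ (l + j')) a" and m: "(s ^^ (m + k)) b' = (s ^^ (m + k')) b"
      using fr_eq_iff[OF ab(1) assms(1)] fr_eq_iff[OF ab(2) assms(2)] ab(3,4) by blast
    have "(s ^^ (l + m + (j + k))) ((s ^^ k') a' \<oplus>\<^bsub>M\<^esub> (s ^^ j') b')
      = (s ^^ (m + k + k')) ((s ^^ (l + j)) a') \<oplus>\<^bsub>M\<^esub> (s ^^ (l + j + j')) ((s ^^ (m + k)) b')"
      using ab by (simp add: pow_lin pow_mem pow_add ac_simps)
    also have "\<dots> = (s ^^ (l + m + (j' + k'))) ((s ^^ k) a \<oplus>\<^bsub>M\<^esub> (s ^^ j) b)"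
      unfolding l m using assms by (simp add: pow_lin pow_mem pow_add ac_simps)
    finally show ?thesis using ab assms by (subst fr_eq_iff) (auto simp: pow_mem cl)
  qed
  have 1: "(\<Union>(b', k')\<in>fr b k. fr ((s ^^ k') a' \<oplus>\<^bsub>M\<^esub> (s ^^ j') b') (j' + k'))
    = fr ((s ^^ k) a \<oplus>\<^bsub>M\<^esub> (s ^^ j) b) (j + k)" if "(a', j') \<in> fr a j" for a' j'
  proof -
    have a': "a' \<in> carrier M" "fr a' j' = fr a j" using that assms by (simp_all add: in_fr_iff)
    have "(\<Union>(b', k')\<in>fr b k. fr ((s ^^ k') a' \<oplus>\<^bsub>M\<^esub> (s ^^ j') b') (j' + k'))
      = fr ((s ^^ k) a' \<oplus>\<^bsub>M\<^esub> (s ^^ j') b) (j' + k)"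
      
    proof (rule fr_UN[OF assms(2)])
      fix b' k' assume b': "b' \<in> carrier M" "fr b' k' = fr b k"
      show "fr ((s ^^ k') a' \<oplus>\<^bsub>M\<^esub> (s ^^ j') b') (j' + k') = fr ((s ^^ k) a' \<oplus>\<^bsub>M\<^esub> (s ^^ j') b) (j' + k)"
        using eq[OF a'(1) b'(1) a'(2) b'(2)] eq[OF a'(1) assms(2) a'(2) refl] by (rule trans[OF _ sym])
    qed
    also have "\<dots> = fr ((s ^^ k) a \<oplus>\<^bsub>M\<^esub> (s ^^ j) b) (j + k)" by (rule eq[OF a'(1) assms(2) a'(2) refl])
    finally show ?thesis .
  qed
  have "(a, j) \<in> fr a j" using assms by (simp add: in_fr_iff)
  then have "fr a j \<noteq> {}" by blast
  then have "(\<Union>(a', j')\<in>fr a j. \<Union>(b', k')\<in>fr b k. fr ((s ^^ k') a' \<oplus>\<^bsub>M\<^esub> (s ^^ j') b') (j' + k'))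
    = fr ((s ^^ k) a \<oplus>\<^bsub>M\<^esub> (s ^^ j) b) (j + k)"
    by (rule SUP_eq_const) (use 1 in \<open>simp only: split_paired_all prod.case\<close>)
  then show ?thesis by (simp add: localization_def)
qed

lemma add_L:
  assumes "a \<in> carrier M" "b \<in> carrier M"
  shows "fr a k \<oplus>\<^bsub>L\<^esub> fr b k = fr (a \<oplus>\<^bsub>M\<^esub> b) k"
  using fr_expand[of "a \<oplus>\<^bsub>M\<^esub> b" k k] add_L_aux[OF assms, of k k] assms
  by (simp add: pow_lin cl)

lemma smult_L:
  assumes "a \<in> carrier M"
  shows "c \<odot>\<^bsub>L\<^esub> fr a k = fr (c \<odot>\<^bsub>M\<^esub> a) k"
proof -
  have "(\<Union>(b, j)\<in>fr a k. fr (c \<odot>\<^bsub>M\<^esub> b) j) = fr (c \<odot>\<^bsub>M\<^esub> a) k"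
  proof (rule fr_UN[OF assms])
    fix b j assume b: "b \<in> carrier M" "fr b j = fr a k"
    then obtain l where "(s ^^ (l + k)) b = (s ^^ (l + j)) a" using assms by (auto simp: fr_eq_iff)
    then have "(s ^^ (l + k)) (c \<odot>\<^bsub>M\<^esub> b) = (s ^^ (l + j)) (c \<odot>\<^bsub>M\<^esub> a)"
      using b assms by (simp add: pow_lin)
    then show "fr (c \<odot>\<^bsub>M\<^esub> b) j = fr (c \<odot>\<^bsub>M\<^esub> a) k"
      using b assms by (subst fr_eq_iff) (auto simp: cl)
  qed
  then show ?thesis by (simp add: localization_def)
qed

lemma zero_L: "\<zero>\<^bsub>L\<^esub> = fr \<zero>\<^bsub>M\<^esub> k"
proof -
  have z: "(s ^^ m) \<zero>\<^bsub>M\<^esub> = \<zero>\<^bsub>M\<^esub>" for m by (rule chom_zero[OF vs vs chom_funpow[OF s]])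
  show ?thesis
    unfolding localization_def by simp (rule fr_eqI; simp add: cl z)
qed

lemma vs_L: "cvs L"
proof (rule vs_criteria[OF class_field])
  note a = cvs_add[OF vs] and m = cvs_smult[OF vs]
  show "\<zero>\<^bsub>L\<^esub> \<in> carrier L" by (auto simp: zero_L[of 0] cl)
  show "\<forall>v w. v \<in> carrier L \<and> w \<in> carrier L \<longrightarrow> v \<oplus>\<^bsub>L\<^esub> w \<in> carrier L"
    by (metis common_denominator add_L cl(2) fr_mem)
  show "\<forall>v\<in>carrier L. \<exists>w\<in>carrier L. v \<oplus>\<^bsub>L\<^esub> w = \<zero>\<^bsub>L\<^esub>"
  proof
    fix v assume "v \<in> carrier L"
    then obtain x k where x: "x \<in> carrier M" "v = fr x k" by (auto simp: carrier_L)
    then have "v \<oplus>\<^bsub>L\<^esub> fr ((-1) \<odot>\<^bsub>M\<^esub> x) k = \<zero>\<^bsub>L\<^esub>"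
      using m(6)[of x x] a(3)[of x] by (simp add: add_L cl zero_L[of k])
    then show "\<exists>w\<in>carrier L. v \<oplus>\<^bsub>L\<^esub> w = \<zero>\<^bsub>L\<^esub>" by (rule bexI) (intro fr_mem cl x)
  qed
  show "\<forall>c v. c \<in> carrier class_ring \<and> v \<in> carrier L \<longrightarrow> c \<odot>\<^bsub>L\<^esub> v \<in> carrier L"
    using fr_mem cl(4) by (auto simp: carrier_L smult_L)
  show "\<forall>v w. v \<in> carrier L \<and> w \<in> carrier L \<longrightarrow> v \<oplus>\<^bsub>L\<^esub> w = w \<oplus>\<^bsub>L\<^esub> v"
    by (metis common_denominator add_L a(4))
  show "\<forall>v w x. v \<in> carrier L \<and> w \<in> carrier L \<and> x \<in> carrier L \<longrightarrow>
      v \<oplus>\<^bsub>L\<^esub> w \<oplus>\<^bsub>L\<^esub> x = v \<oplus>\<^bsub>L\<^esub> (w \<oplus>\<^bsub>L\<^esub> x)"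
  proof (intro allI impI)
    fix u v w assume "u \<in> carrier L \<and> v \<in> carrier L \<and> w \<in> carrier L"
    then obtain a b c i j k where abc: "a \<in> carrier M" "b \<in> carrier M" "c \<in> carrier M"
      "u = fr a i" "v = fr b j" "w = fr c k" by (auto simp: carrier_L)
    then have "u = fr ((s ^^ (j + k)) a) (i + j + k)" "v = fr ((s ^^ (i + k)) b) (i + j + k)"
      "w = fr ((s ^^ (i + j)) c) (i + j + k)"
      using fr_expand[of a "j + k" i] fr_expand[of b "i + k" j] fr_expand[of c "i + j" k]
      by (simp_all add: ac_simps)
    then show "u \<oplus>\<^bsub>L\<^esub> v \<oplus>\<^bsub>L\<^esub> w = u \<oplus>\<^bsub>L\<^esub> (v \<oplus>\<^bsub>L\<^esub> w)"
      using abc(1-3) by (simp add: add_L pow_mem cl a(5))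
  qed
  show "\<forall>v\<in>carrier L. v \<oplus>\<^bsub>L\<^esub> \<zero>\<^bsub>L\<^esub> = v"
  proof
    fix v assume "v \<in> carrier L"
    then obtain x k where x: "x \<in> carrier M" "v = fr x k" by (auto simp: carrier_L)
    then show "v \<oplus>\<^bsub>L\<^esub> \<zero>\<^bsub>L\<^esub> = v" using a(1)[OF x(1)] by (simp add: zero_L[of k] add_L cl)
  qed
  show "\<forall>a b v. a \<in> carrier class_ring \<and> b \<in> carrier class_ring \<and> v \<in> carrier L \<longrightarrow>
      a \<otimes>\<^bsub>class_ring\<^esub> b \<odot>\<^bsub>L\<^esub> v = a \<odot>\<^bsub>L\<^esub> (b \<odot>\<^bsub>L\<^esub> v)"
    by (auto simp: carrier_L smult_L cl m(3))
  show "\<forall>v\<in>carrier L. \<one>\<^bsub>class_ring\<^esub> \<odot>\<^bsub>L\<^esub> v = v"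
    by (auto simp: carrier_L smult_L m(1))
  show "\<forall>a b v. a \<in> carrier class_ring \<and> b \<in> carrier class_ring \<and> v \<in> carrier L \<longrightarrow>
      (a \<oplus>\<^bsub>class_ring\<^esub> b) \<odot>\<^bsub>L\<^esub> v = a \<odot>\<^bsub>L\<^esub> v \<oplus>\<^bsub>L\<^esub> b \<odot>\<^bsub>L\<^esub> v"
    by (auto simp: carrier_L smult_L add_L cl m(4))
  show "\<forall>c v w. c \<in> carrier class_ring \<and> v \<in> carrier L \<and> w \<in> carrier L \<longrightarrow>
      c \<odot>\<^bsub>L\<^esub> (v \<oplus>\<^bsub>L\<^esub> w) = c \<odot>\<^bsub>L\<^esub> v \<oplus>\<^bsub>L\<^esub> c \<odot>\<^bsub>L\<^esub> w"
  proof (intro allI impI)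
    fix c :: complex and v w assume "c \<in> carrier class_ring \<and> v \<in> carrier L \<and> w \<in> carrier L"
    then obtain a b k where "a \<in> carrier M" "b \<in> carrier M" "v = fr a k" "w = fr b k"
      using common_denominator[of v w "\<exists>a b k. a \<in> carrier M \<and> b \<in> carrier M \<and> v = fr a k \<and> w = fr b k"] by blast
    then show "c \<odot>\<^bsub>L\<^esub> (v \<oplus>\<^bsub>L\<^esub> w) = c \<odot>\<^bsub>L\<^esub> v \<oplus>\<^bsub>L\<^esub> c \<odot>\<^bsub>L\<^esub> w"
      by (simp add: add_L smult_L cl m(5))
  qed
qed

lemma minus_L:
  assumes "a \<in> carrier M" "b \<in> carrier M"
  shows "fr a k \<ominus>\<^bsub>L\<^esub> fr b k = fr (a \<ominus>\<^bsub>M\<^esub> b) k"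
  using assms by (simp add: cvs_smult(6)[OF vs_L] cvs_smult(6)[OF vs] fr_mem add_L smult_L cl)

lemma fr_chom: "(\<lambda>a. fr a k) \<in> chom M L"
  by (intro chomI) (auto simp: add_L smult_L)

text \<open>Two fractions can be brought to a common exponent k, so linearity of G only has to be
  seen on the numerators for each fixed k. The new exponent h k must depend on k alone.\<close>

lemma chom_LI:
  assumes "\<And>k. g k \<in> chom M M" "\<And>a k. a \<in> carrier M \<Longrightarrow> G (fr a k) = fr (g k a) (h k)"
  shows "G \<in> chom L L"
proof (rule chomI)
  note g = chomD[OF assms(1)]
  show "G v \<in> carrier L" if "v \<in> carrier L" for v using that g(1) assms(2) by (auto simp: carrier_L) blast
  show "G (c \<odot>\<^bsub>L\<^esub> v) = c \<odot>\<^bsub>L\<^esub> G v" if "v \<in> carrier L" for c v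
    using that g by (auto simp: carrier_L smult_L assms(2) cl)
  show "G (v \<oplus>\<^bsub>L\<^esub> w) = G v \<oplus>\<^bsub>L\<^esub> G w" if vw: "v \<in> carrier L" "w \<in> carrier L" for v w
  proof -
    obtain a b k where "a \<in> carrier M" "b \<in> carrier M" "v = fr a k" "w = fr b k"
      using common_denominator[OF vw] .
    then show ?thesis using g by (simp add: assms(2) add_L cl)
  qed
qed

end

section \<open>The operators and the V-filtration over an abstract lattice with [t, s] = s^2\<close>

locale gauss_manin_operators = endomorphism +
  fixes t :: "'a \<Rightarrow> 'a"
  assumes t: "t \<in> chom M M"
    and commutation: "\<And>a. a \<in> carrier M \<Longrightarrow> t (s a) = s (t a) \<oplus>\<^bsub>M\<^esub> s (s a)"
begin

text \<open>\<open>S\<close>, \<open>D\<close>, \<open>T\<close> and the notions built on them copy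
  \<open>gm_dt_inv\<close>, \<open>gm_dt\<close>, \<open>gm_t\<close>, \<open>gm_eigen\<close>,
  \<open>gm_sums\<close> and \<open>gm_V\<close> for an abstract lattice. \<open>gm_V_eq\<close>
  identifies the two versions.\<close>

definition S :: "('a \<times> nat) set \<Rightarrow> ('a \<times> nat) set" where
  "S X = (\<Union>(a, k)\<in>X. fr (s a) k)"

definition D :: "('a \<times> nat) set \<Rightarrow> ('a \<times> nat) set" where
  "D X = (\<Union>(a, k)\<in>X. fr a (k + 1))"

definition T :: "('a \<times> nat) set \<Rightarrow> ('a \<times> nat) set" where
  "T X = (\<Union>(a, k)\<in>X. fr (t a \<ominus>\<^bsub>M\<^esub> of_nat k \<odot>\<^bsub>M\<^esub> s a) k)"

definition eigen :: "rat \<Rightarrow> ('a \<times> nat) set set" where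
  "eigen b = {u \<in> carrier L. \<exists>m>0. ((\<lambda>v. D (T v) \<ominus>\<^bsub>L\<^esub> of_rat b \<odot>\<^bsub>L\<^esub> v) ^^ m) u = \<zero>\<^bsub>L\<^esub>}"

definition micro_sums :: "(nat \<Rightarrow> complex) \<Rightarrow> ('a \<times> nat) set \<Rightarrow> ('a \<times> nat) set \<Rightarrow> bool" where
  "micro_sums c h u \<longleftrightarrow> (\<forall>N. \<forall>\<^sub>F k in sequentially.
     u \<ominus>\<^bsub>L\<^esub> (\<Oplus>\<^bsub>L\<^esub>i\<in>{..<k}. c i \<odot>\<^bsub>L\<^esub> (S ^^ i) h) \<in> (S ^^ N) ` ((\<lambda>a. fr a 0) ` carrier M))"

definition gen :: "rat \<Rightarrow> ('a \<times> nat) set set" where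
  "gen a = {u \<in> carrier L. \<exists>b\<ge>a. \<exists>h\<in>eigen b. \<exists>c\<in>micro_series. micro_sums c h u}"

definition V :: "rat \<Rightarrow> ('a \<times> nat) set set" where
  "V a = LinearCombinations.module.span (class_ring :: complex ring) L (gen a)"

lemmas cL = cvs_closed[OF vs_L]

lemma t_mem: "a \<in> carrier M \<Longrightarrow> t a \<in> carrier M"
  by (rule chomD(1)[OF t])

lemma s_lin:
  assumes "a \<in> carrier M"
  shows "b \<in> carrier M \<Longrightarrow> s (a \<oplus>\<^bsub>M\<^esub> b) = s a \<oplus>\<^bsub>M\<^esub> s b"
    "b \<in> carrier M \<Longrightarrow> s (a \<ominus>\<^bsub>M\<^esub> b) = s a \<ominus>\<^bsub>M\<^esub> s b" "s (c \<odot>\<^bsub>M\<^esub> a) = c \<odot>\<^bsub>M\<^esub> s a"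
  using pow_lin[OF assms, where k = 1] by simp_all

lemma t_lin:
  assumes "a \<in> carrier M"
  shows "b \<in> carrier M \<Longrightarrow> t (a \<oplus>\<^bsub>M\<^esub> b) = t a \<oplus>\<^bsub>M\<^esub> t b"
    "t (c \<odot>\<^bsub>M\<^esub> a) = c \<odot>\<^bsub>M\<^esub> t a"
  using assms by (simp_all add: chomD(2,3)[OF t])

lemmas Msimps = cl pow_mem s_mem t_mem s_lin t_lin commutation
  cvs_smult(3,5,6)[OF vs] cvs_add(5)[OF vs] cvs_add_smult[OF vs]

text \<open>Iterating [t, s] = s^2 gives [t, s^k] = k s^(k+1). This is the source of the correction
  term with factor k in \<open>T\<close>.\<close>

lemma t_pow: "a \<in> carrier M \<Longrightarrow> t ((s ^^ k) a) = (s ^^ k) (t a) \<oplus>\<^bsub>M\<^esub> of_nat k \<odot>\<^bsub>M\<^esub> (s ^^ Suc k) a"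
proof (induction k)
  case 0
  then show ?case by (simp add: t_mem cvs_add(1)[OF vs] cvs_smult(2)[OF vs] s_mem)
next
  case (Suc k)
  then show ?case
    by (simp add: Msimps)
qed

lemma D_fr: "a \<in> carrier M \<Longrightarrow> D (fr a k) = fr a (Suc k)"
  unfolding D_def Suc_eq_plus1
proof (rule fr_UN)
  fix b j assume "a \<in> carrier M" and b: "b \<in> carrier M" "fr b j = fr a k"
  then obtain l where "(s ^^ (l + k)) b = (s ^^ (l + j)) a" using fr_eq_iff[of b a j k] by blast
  then have "(s ^^ (l + (k + 1))) b = (s ^^ (l + (j + 1))) a" by simp
  then show "fr b (j + 1) = fr a (k + 1)"
    using fr_eq_iff[OF b(1) \<open>a \<in> carrier M\<close>] by blast
qed

lemma S_fr: "a \<in> carrier M \<Longrightarrow> S (fr a k) = fr (s a) k"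
  unfolding S_def
proof (rule fr_UN)
  fix b j assume "a \<in> carrier M" and b: "b \<in> carrier M" "fr b j = fr a k"
  then obtain l where "(s ^^ (l + k)) b = (s ^^ (l + j)) a" using fr_eq_iff[of b a j k] by blast
  then have "(s ^^ (l + k)) (s b) = (s ^^ (l + j)) (s a)" by (metis funpow_swap1)
  then show "fr (s b) j = fr (s a) k"
    using \<open>a \<in> carrier M\<close> b(1) by (subst fr_eq_iff) (auto simp: s_mem)
qed

lemma T_fr:
  assumes a: "a \<in> carrier M"
  shows "T (fr a k) = fr (t a \<ominus>\<^bsub>M\<^esub> of_nat k \<odot>\<^bsub>M\<^esub> s a) k"
  unfolding T_def
proof (rule fr_UN[OF a])
  fix b j assume b: "b \<in> carrier M" "fr b j = fr a k"
  obtain l where l: "(s ^^ (l + k)) b = (s ^^ (l + j)) a" using fr_eq_iff[OF b(1) a] b(2) by blast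
  \<comment> \<open>Moving s^(l + k) through t by \<open>t_pow\<close> costs l + k further copies of
    s. The result depends on b only through s^(l + k) b, and its coefficient l + k + j is symmetric
    in j and k; so both representatives give the same element.\<close>
  have *: "(s ^^ (l + k)) (t b \<ominus>\<^bsub>M\<^esub> of_nat j \<odot>\<^bsub>M\<^esub> s b)
    = t ((s ^^ (l + k)) b) \<oplus>\<^bsub>M\<^esub> (- of_nat (l + k + j)) \<odot>\<^bsub>M\<^esub> s ((s ^^ (l + k)) b)"
    if "b \<in> carrier M" for b j k
  proof -
    have "(s ^^ (l + k)) (s b) = s ((s ^^ (l + k)) b)" by (simp add: funpow_swap1)
    then show ?thesis using that by (simp add: t_pow Msimps pow_lin)
  qed
  have "(s ^^ (l + k)) (t b \<ominus>\<^bsub>M\<^esub> of_nat j \<odot>\<^bsub>M\<^esub> s b) = (s ^^ (l + j)) (t a \<ominus>\<^bsub>M\<^esub> of_nat k \<odot>\<^bsub>M\<^esub> s a)"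
    unfolding *[OF b(1)] *[OF a] l by (simp add: ac_simps)
  then show "fr (t b \<ominus>\<^bsub>M\<^esub> of_nat j \<odot>\<^bsub>M\<^esub> s b) j = fr (t a \<ominus>\<^bsub>M\<^esub> of_nat k \<odot>\<^bsub>M\<^esub> s a) k"
    using a b(1) by (subst fr_eq_iff) (auto simp: s_mem t_mem cl)
qed

lemma D_chom: "D \<in> chom L L"
  by (rule chom_LI[where g = "\<lambda>_ a. a"]) (auto simp: D_fr module_hom_def)

lemma S_chom: "S \<in> chom L L"
  by (rule chom_LI[where g = "\<lambda>_. s", OF s]) (rule S_fr)

lemma T_chom: "T \<in> chom L L"
proof (rule chom_LI[where g = "\<lambda>k a. t a \<ominus>\<^bsub>M\<^esub> of_nat k \<odot>\<^bsub>M\<^esub> s a"])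
  show "(\<lambda>a. t a \<ominus>\<^bsub>M\<^esub> of_nat k \<odot>\<^bsub>M\<^esub> s a) \<in> chom M M" for k
  proof (rule chomI)
    fix c v assume "v \<in> carrier M"
    then show "t (c \<odot>\<^bsub>M\<^esub> v) \<ominus>\<^bsub>M\<^esub> of_nat k \<odot>\<^bsub>M\<^esub> s (c \<odot>\<^bsub>M\<^esub> v) = c \<odot>\<^bsub>M\<^esub> (t v \<ominus>\<^bsub>M\<^esub> of_nat k \<odot>\<^bsub>M\<^esub> s v)"
      by (simp add: Msimps mult.commute)
  qed (simp_all add: Msimps cvs_add(4,6)[OF vs])
qed (rule T_fr)

lemma S_mem: "v \<in> carrier L \<Longrightarrow> S v \<in> carrier L" by (rule chomD(1)[OF S_chom])
lemma T_mem: "v \<in> carrier L \<Longrightarrow> T v \<in> carrier L" by (rule chomD(1)[OF T_chom])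
lemma D_mem: "v \<in> carrier L \<Longrightarrow> D v \<in> carrier L" by (rule chomD(1)[OF D_chom])

lemma in_L_cases:
  assumes "v \<in> carrier L"
  obtains a k where "a \<in> carrier M" "v = fr a k"
  using assms unfolding carrier_L by blast

lemma D_S: "v \<in> carrier L \<Longrightarrow> D (S v) = v"
  by (erule in_L_cases) (simp add: D_fr S_fr s_mem fr_s)

lemma S_D: "v \<in> carrier L \<Longrightarrow> S (D v) = v"
  by (erule in_L_cases) (simp add: D_fr S_fr s_mem fr_s)

lemma T_S:
  assumes "v \<in> carrier L"
  shows "T (S v) = S (T v) \<oplus>\<^bsub>L\<^esub> S (S v)"
proof -
  obtain a k where a: "a \<in> carrier M" "v = fr a k" using assms by (rule in_L_cases)
  have "t (s a) \<ominus>\<^bsub>M\<^esub> of_nat k \<odot>\<^bsub>M\<^esub> s (s a) = s (t a \<ominus>\<^bsub>M\<^esub> of_nat k \<odot>\<^bsub>M\<^esub> s a) \<oplus>\<^bsub>M\<^esub> s (s a)"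
    using a(1) by (simp add: Msimps cvs_add(4,6)[OF vs])
  then show ?thesis using a by (simp add: S_fr T_fr add_L s_mem t_mem cl)
qed

lemma D_T:
  assumes "v \<in> carrier L"
  shows "D (T v) = T (D v) \<oplus>\<^bsub>L\<^esub> v"
proof -
  obtain a k where a: "a \<in> carrier M" "v = fr a k" using assms by (rule in_L_cases)
  have "t a \<ominus>\<^bsub>M\<^esub> of_nat k \<odot>\<^bsub>M\<^esub> s a = (t a \<ominus>\<^bsub>M\<^esub> of_nat (Suc k) \<odot>\<^bsub>M\<^esub> s a) \<oplus>\<^bsub>M\<^esub> s a"
    using a(1) by (simp add: Msimps)
  moreover have "T (D v) \<oplus>\<^bsub>L\<^esub> v = fr (t a \<ominus>\<^bsub>M\<^esub> of_nat (Suc k) \<odot>\<^bsub>M\<^esub> s a) (Suc k) \<oplus>\<^bsub>L\<^esub> fr (s a) (Suc k)"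
    using a by (simp only: D_fr T_fr fr_s)
  ultimately show ?thesis using a by (simp add: D_fr T_fr add_L s_mem t_mem cl del: of_nat_Suc)
qed

abbreviation N :: "rat \<Rightarrow> ('a \<times> nat) set \<Rightarrow> ('a \<times> nat) set" where
  "N b v \<equiv> D (T v) \<ominus>\<^bsub>L\<^esub> of_rat b \<odot>\<^bsub>L\<^esub> v"

lemma N_mem: "v \<in> carrier L \<Longrightarrow> N b v \<in> carrier L"
  by (intro cL D_mem T_mem)

text \<open>R intertwines N b with N (b + 1), hence also their powers, and so it carries generalized
  eigenvectors along. Both R = S and R = T qualify, because D T R = R D T + R: for S this follows
  from \<open>T_S\<close>, for T from D T = T D + 1.\<close>

lemma eigen_shift:
  assumes R: "R \<in> chom L L" "\<And>v. v \<in> carrier L \<Longrightarrow> N (b + 1) (R v) = R (N b v)"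
    and h: "h \<in> eigen b"
  shows "R h \<in> eigen (b + 1)"
proof -
  obtain m where m: "h \<in> carrier L" "m > 0" "(N b ^^ m) h = \<zero>\<^bsub>L\<^esub>"
    using h unfolding eigen_def by blast
  have "(N b ^^ k) h \<in> carrier L \<and> (N (b + 1) ^^ k) (R h) = R ((N b ^^ k) h)" for k
    by (induction k) (use m(1) R(2) N_mem in auto)
  then have "(N (b + 1) ^^ m) (R h) = \<zero>\<^bsub>L\<^esub>" using m(3) chom_zero[OF vs_L vs_L R(1)] by simp
  then show ?thesis unfolding eigen_def using m(1,2) chomD(1)[OF R(1)] by blast
qed

lemmas Lsimps = cL S_mem T_mem D_mem cvs_smult(3,5,6)[OF vs_L] cvs_add(5)[OF vs_L] cvs_add_smult[OF vs_L]

lemma S_eigen: "h \<in> eigen b \<Longrightarrow> S h \<in> eigen (b + 1)"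
proof (rule eigen_shift[OF S_chom])
  fix v assume v: "v \<in> carrier L"
  have "D (T (S v)) = T v \<oplus>\<^bsub>L\<^esub> S v"
    using v by (simp add: T_S D_S S_mem T_mem chomD(2)[OF D_chom])
  moreover have "S (N b v) = T v \<ominus>\<^bsub>L\<^esub> of_rat b \<odot>\<^bsub>L\<^esub> S v"
    using v by (simp add: chom_minus[OF vs_L vs_L S_chom] chomD(3)[OF S_chom] S_D D_mem T_mem cL)
  ultimately show "N (b + 1) (S v) = S (N b v)"
    using v by (simp add: Lsimps of_rat_add)
qed

lemma T_eigen: "h \<in> eigen b \<Longrightarrow> T h \<in> eigen (b + 1)"
proof (rule eigen_shift[OF T_chom])
  fix v assume v: "v \<in> carrier L"
  have "T (N b v) = T (D (T v)) \<ominus>\<^bsub>L\<^esub> of_rat b \<odot>\<^bsub>L\<^esub> T v"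
    using v by (simp add: chom_minus[OF vs_L vs_L T_chom] chomD(3)[OF T_chom] D_mem T_mem cL)
  then show "N (b + 1) (T v) = T (N b v)"
    using v by (simp add: D_T[of "T v"] Lsimps of_rat_add)
qed

lemma gen_subset: "gen a \<subseteq> carrier L"
  unfolding gen_def by blast

lemma V_csub: "csub (V a) L"
proof -
  interpret vectorspace class_ring L by (rule vs_L)
  show ?thesis unfolding V_def by (rule span_is_subspace[OF gen_subset])
qed

lemma gen_V: "gen a \<subseteq> V a"
proof -
  interpret vectorspace class_ring L by (rule vs_L)
  show ?thesis unfolding V_def by (rule in_own_span[OF gen_subset])
qed

lemma V_least:
  assumes "csub W L" "gen a \<subseteq> W"
  shows "V a \<subseteq> W"
proof -
  interpret vectorspace class_ring L by (rule vs_L)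
  show ?thesis unfolding V_def using assms by (intro span_is_subset) (simp_all add: subspace_def)
qed

lemma V_antimono: "a \<le> b \<Longrightarrow> V b \<subseteq> V a"
  by (rule V_least[OF V_csub]) (rule order_trans[OF _ gen_V], auto simp: gen_def intro: order_trans)

text \<open>The coefficients 1, 0, 0, ... present h as a series in itself. All nonempty partial sums
  equal h, so the remainder is 0 from k = 1 on.\<close>

lemma eigen_V:
  assumes "h \<in> eigen b" "a \<le> b"
  shows "h \<in> V a"
proof -
  let ?c = "\<lambda>i::nat. if i = 0 then 1 else (0 :: complex)"
  have hL: "h \<in> carrier L" using assms(1) by (simp add: eigen_def)
  have sm1: "summable (\<lambda>i. norm (?c i) * 1 ^ i / fact i)"
    by (rule summable_finite[of "{0}"]) auto
  have c: "?c \<in> micro_series"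
    unfolding micro_series_def mem_Collect_eq
  proof (rule exI[of _ 1], rule conjI)
    show "summable (\<lambda>i. norm (?c i) * 1 ^ i / fact i)" by (rule sm1)
  qed simp
  have Sp: "(S ^^ i) v \<in> carrier L" if "v \<in> carrier L" for i v by (rule chom_funpow_mem[OF S_chom that])
  have sm: "(\<Oplus>\<^bsub>L\<^esub>i\<in>{..<Suc k}. ?c i \<odot>\<^bsub>L\<^esub> (S ^^ i) h) = h" for k
  proof (induction k)
    case 0
    interpret vectorspace class_ring L by (rule vs_L)
    have "(\<Oplus>\<^bsub>L\<^esub>i\<in>{..<Suc 0}. ?c i \<odot>\<^bsub>L\<^esub> (S ^^ i) h) = ?c 0 \<odot>\<^bsub>L\<^esub> (S ^^ 0) h \<oplus>\<^bsub>L\<^esub> (\<Oplus>\<^bsub>L\<^esub>i\<in>{..<0}. ?c i \<odot>\<^bsub>L\<^esub> (S ^^ i) h)"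
      unfolding lessThan_Suc by (rule finsum_insert) (use hL cL in auto)
    also have "\<dots> = h" using hL cvs_smult(1)[OF vs_L hL] cvs_add(1)[OF vs_L hL] by simp
    finally show ?case .
  next
    case (Suc k)
    interpret vectorspace class_ring L by (rule vs_L)
    have "(\<Oplus>\<^bsub>L\<^esub>i\<in>{..<Suc (Suc k)}. ?c i \<odot>\<^bsub>L\<^esub> (S ^^ i) h)
      = ?c (Suc k) \<odot>\<^bsub>L\<^esub> (S ^^ Suc k) h \<oplus>\<^bsub>L\<^esub> (\<Oplus>\<^bsub>L\<^esub>i\<in>{..<Suc k}. ?c i \<odot>\<^bsub>L\<^esub> (S ^^ i) h)"
      unfolding lessThan_Suc[of "Suc k"]
      by (rule finsum_insert) (simp_all add: Pi_iff cL(4) Sp[OF hL] del: funpow.simps)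
    also have "\<dots> = h"
      unfolding Suc.IH using cvs_smult(2)[OF vs_L Sp[OF hL]] cvs_add(2)[OF vs_L hL] by (simp del: funpow.simps)
    finally show ?case .
  qed
  have z: "\<zero>\<^bsub>L\<^esub> \<in> (S ^^ m) ` ((\<lambda>a. fr a 0) ` carrier M)" for m
  proof (rule image_eqI)
    show "\<zero>\<^bsub>L\<^esub> = (S ^^ m) \<zero>\<^bsub>L\<^esub>" by (rule chom_zero[OF vs_L vs_L chom_funpow[OF S_chom], symmetric])
    show "\<zero>\<^bsub>L\<^esub> \<in> (\<lambda>a. fr a 0) ` carrier M" unfolding zero_L[of 0] by (rule imageI[OF cl(1)])
  qed
  have "micro_sums ?c h h"
    unfolding micro_sums_def
  proof (intro allI eventually_sequentiallyI[of 1])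
    fix m k :: nat assume "1 \<le> k"
    then obtain l where "k = Suc l" by (cases k) auto
    then show "h \<ominus>\<^bsub>L\<^esub> (\<Oplus>\<^bsub>L\<^esub>i\<in>{..<k}. ?c i \<odot>\<^bsub>L\<^esub> (S ^^ i) h) \<in> (S ^^ m) ` ((\<lambda>a. fr a 0) ` carrier M)"
      using sm[of l] cvs_add(3)[OF vs_L hL] z by simp
  qed
  then have "h \<in> gen a" unfolding gen_def using hL assms c by blast
  then show ?thesis using gen_V by blast
qed

lemma pow_S_eigen: "h \<in> eigen b \<Longrightarrow> (S ^^ i) h \<in> eigen (b + of_nat i)"
proof (induction i)
  case (Suc i)
  then show ?case using S_eigen[of "(S ^^ i) h" "b + of_nat i"] by (simp add: add.assoc add.commute[of 1])
qed simp

text \<open>Only a finite partial sum of a generator matters: \<open>T\<close> maps the remainder into the image of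
  \<open>\<partial>\<^sub>t\<^sup>-\<^sup>1\<close> on the lattice.\<close>

lemma T_V:
  assumes "u \<in> V a"
  shows "\<exists>v\<in>V (a + 1). \<exists>x\<in>carrier M. T u = v \<oplus>\<^bsub>L\<^esub> fr (s x) 0"
proof -
  \<comment> \<open>W is V (a + 1) plus the image of s on the lattice. Once W is known to be a
    subspace, it is enough to test T on the generators of V a.\<close>
  define W where "W = {y \<in> carrier L. \<exists>v\<in>V (a + 1). \<exists>x\<in>carrier M. y = v \<oplus>\<^bsub>L\<^esub> fr (s x) 0}"
  note VD = csubD[OF V_csub[of "a + 1"]]
  have VL: "v \<in> carrier L" if "v \<in> V (a + 1)" for v using VD(2) that by blast
  have W: "csub W L"
  proof (rule csubI[OF vs_L])
    show "W \<subseteq> carrier L" by (auto simp: W_def)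
    show "\<zero>\<^bsub>L\<^esub> \<in> W"
    proof -
      have "\<zero>\<^bsub>L\<^esub> = \<zero>\<^bsub>L\<^esub> \<oplus>\<^bsub>L\<^esub> fr (s \<zero>\<^bsub>M\<^esub>) 0"
        unfolding s_zero zero_L[of 0, symmetric] by (rule cvs_add(1)[OF vs_L cL(1), symmetric])
      then show ?thesis unfolding W_def using VD(3) cL(1) cl(1) by blast
    qed
    show "c \<odot>\<^bsub>L\<^esub> y \<in> W" if y: "y \<in> W" for c y
    proof -
      obtain v x where vx: "v \<in> V (a + 1)" "x \<in> carrier M" "y = v \<oplus>\<^bsub>L\<^esub> fr (s x) 0"
        using y unfolding W_def by blast
      then have "c \<odot>\<^bsub>L\<^esub> y = c \<odot>\<^bsub>L\<^esub> v \<oplus>\<^bsub>L\<^esub> fr (s (c \<odot>\<^bsub>M\<^esub> x)) 0"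
        using VL by (simp add: Lsimps fr_mem s_mem smult_L s_lin)
      moreover have "c \<odot>\<^bsub>L\<^esub> y \<in> carrier L" using y cL(4) by (simp add: W_def)
      ultimately show ?thesis unfolding W_def using VD(5)[OF vx(1)] cl(4)[OF vx(2)] by blast
    qed
    show "y \<oplus>\<^bsub>L\<^esub> z \<in> W" if yz: "y \<in> W" "z \<in> W" for y z
    proof -
      obtain v x where vx: "v \<in> V (a + 1)" "x \<in> carrier M" "y = v \<oplus>\<^bsub>L\<^esub> fr (s x) 0"
        using yz(1) unfolding W_def by blast
      obtain v' x' where vx': "v' \<in> V (a + 1)" "x' \<in> carrier M" "z = v' \<oplus>\<^bsub>L\<^esub> fr (s x') 0"
        using yz(2) unfolding W_def by blast
      have "y \<oplus>\<^bsub>L\<^esub> z = (v \<oplus>\<^bsub>L\<^esub> v') \<oplus>\<^bsub>L\<^esub> (fr (s x) 0 \<oplus>\<^bsub>L\<^esub> fr (s x') 0)"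
        using vx vx' VL by (simp add: cL fr_mem s_mem cvs_add(5,6)[OF vs_L])
      also have "\<dots> = (v \<oplus>\<^bsub>L\<^esub> v') \<oplus>\<^bsub>L\<^esub> fr (s (x \<oplus>\<^bsub>M\<^esub> x')) 0"
        using vx(2) vx'(2) by (simp add: add_L s_mem s_lin)
      finally have "y \<oplus>\<^bsub>L\<^esub> z = (v \<oplus>\<^bsub>L\<^esub> v') \<oplus>\<^bsub>L\<^esub> fr (s (x \<oplus>\<^bsub>M\<^esub> x')) 0" .
      moreover have "y \<oplus>\<^bsub>L\<^esub> z \<in> carrier L" using yz cL(2) by (simp add: W_def)
      ultimately show ?thesis
        unfolding W_def using VD(4)[OF vx(1) vx'(1)] cl(2)[OF vx(2) vx'(2)] by blast
    qed
  qed
  have "gen a \<subseteq> {y \<in> carrier L. T y \<in> W}"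
  proof
    fix y assume "y \<in> gen a"
    then obtain b h c where y: "y \<in> carrier L" "a \<le> b" "h \<in> eigen b" "micro_sums c h y"
      unfolding gen_def by blast
    \<comment> \<open>Convergence is used at order N = 1 only: some partial sum p differs from y by
      S of a lattice element x.\<close>
    from y(4) have "\<forall>\<^sub>F k in sequentially.
     y \<ominus>\<^bsub>L\<^esub> (\<Oplus>\<^bsub>L\<^esub>i\<in>{..<k}. c i \<odot>\<^bsub>L\<^esub> (S ^^ i) h) \<in> (S ^^ 1) ` ((\<lambda>a. fr a 0) ` carrier M)"
      unfolding micro_sums_def by (rule spec)
    then obtain k where "y \<ominus>\<^bsub>L\<^esub> (\<Oplus>\<^bsub>L\<^esub>i\<in>{..<k}. c i \<odot>\<^bsub>L\<^esub> (S ^^ i) h) \<in> (S ^^ 1) ` ((\<lambda>a. fr a 0) ` carrier M)"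
      unfolding eventually_sequentially by blast
    then obtain x where x: "x \<in> carrier M"
      "y \<ominus>\<^bsub>L\<^esub> (\<Oplus>\<^bsub>L\<^esub>i\<in>{..<k}. c i \<odot>\<^bsub>L\<^esub> (S ^^ i) h) = S (fr x 0)" by auto
    define p where "p = (\<Oplus>\<^bsub>L\<^esub>i\<in>{..<k}. c i \<odot>\<^bsub>L\<^esub> (S ^^ i) h)"
    have hL: "h \<in> carrier L" using y(3) by (simp add: eigen_def)
    have "p \<in> {v \<in> carrier L. T v \<in> V (a + 1)}"
      unfolding p_def
    proof (rule csub_finsum_lessThan[OF csub_vimage[OF vs_L T_chom V_csub]])
      fix i
      have Si: "(S ^^ i) h \<in> carrier L" by (rule chom_funpow_mem[OF S_chom hL])
      have "T ((S ^^ i) h) \<in> V (a + 1)"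
        by (rule eigen_V[OF T_eigen[OF pow_S_eigen[OF y(3)]]]) (use y(2) in simp)
      then show "c i \<odot>\<^bsub>L\<^esub> (S ^^ i) h \<in> {v \<in> carrier L. T v \<in> V (a + 1)}"
        using Si VD(5) cL(4) by (simp add: chomD(3)[OF T_chom])
    qed
    then have p: "p \<in> carrier L" "T p \<in> V (a + 1)" by auto
    have xL: "fr x 0 \<in> carrier L" by (rule fr_mem[OF x(1)])
    have "y = p \<oplus>\<^bsub>L\<^esub> S (fr x 0)"
    proof -
      have "p \<oplus>\<^bsub>L\<^esub> (y \<ominus>\<^bsub>L\<^esub> p) = y \<oplus>\<^bsub>L\<^esub> (p \<oplus>\<^bsub>L\<^esub> (-1) \<odot>\<^bsub>L\<^esub> p)"
        using y(1) p(1) by (simp add: cvs_smult(6)[OF vs_L] cvs_add(6)[OF vs_L] cL)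
      also have "\<dots> = y"
        using cvs_add_smult(2)[OF vs_L p(1), of "-1"] cvs_smult(2)[OF vs_L p(1)] cvs_add(1)[OF vs_L y(1)] by simp
      finally show ?thesis unfolding x(2)[symmetric] p_def[symmetric] by (rule sym)
    qed
    then have "T y = T p \<oplus>\<^bsub>L\<^esub> T (S (fr x 0))"
      using p(1) xL by (simp add: chomD(2)[OF T_chom] S_mem)
    \<comment> \<open>By the commutation rule t s x = s (t x + s x), so t maps the image of s into
      itself.\<close>
    also have "T (S (fr x 0)) = fr (s (t x \<oplus>\<^bsub>M\<^esub> s x)) 0"
      using x(1) by (simp add: S_fr T_fr s_mem t_mem commutation s_lin cvs_smult(2)[OF vs] cvs_smult(6)[OF vs] cvs_smult_zero[OF vs] cvs_add(1)[OF vs] cl)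
    finally show "y \<in> {y \<in> carrier L. T y \<in> W}"
      unfolding W_def
      by (intro CollectI conjI bexI[OF _ p(2)] bexI[OF _ cl(2)[OF t_mem[OF x(1)] s_mem[OF x(1)]]] y(1) T_mem[OF y(1)])
  qed
  from subsetD[OF V_least[OF csub_vimage[OF vs_L T_chom W] this] assms] have "T u \<in> W" by simp
  then show ?thesis by (simp add: W_def)
qed

text \<open>At exponent 0 the operator T is t itself. The correction s B comes from the tail cut off
  in \<open>T_V\<close>; in \<open>Omega_f\<close> it becomes zero.\<close>

lemma t_V:
  assumes A: "A \<in> carrier M" and V: "fr A 0 \<in> V a"
  shows "\<exists>B\<in>carrier M. fr (t A \<ominus>\<^bsub>M\<^esub> s B) 0 \<in> V (a + 1)"
proof -
  obtain v x where vx: "v \<in> V (a + 1)" "x \<in> carrier M" "T (fr A 0) = v \<oplus>\<^bsub>L\<^esub> fr (s x) 0"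
    using T_V[OF V] by blast
  have vL: "v \<in> carrier L" using csubD(2)[OF V_csub] vx(1) by blast
  have "T (fr A 0) = fr (t A) 0"
    using A by (simp add: T_fr cvs_smult(2)[OF vs] cvs_smult(6)[OF vs] cvs_smult_zero[OF vs] cvs_add(1)[OF vs] s_mem t_mem cl)
  then have "fr (t A \<ominus>\<^bsub>M\<^esub> s x) 0 = (v \<oplus>\<^bsub>L\<^esub> fr (s x) 0) \<ominus>\<^bsub>L\<^esub> fr (s x) 0"
    using A vx(2,3) by (simp add: minus_L s_mem t_mem)
  also have "\<dots> = v"
    using vL fr_mem[OF s_mem[OF vx(2)], of 0]
    by (simp add: cvs_smult(6)[OF vs_L] cvs_add(5)[OF vs_L] cL cvs_smult(2)[OF vs_L] cvs_add(1)[OF vs_L] cvs_add_smult(2)[OF vs_L])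
  finally have "fr (t A \<ominus>\<^bsub>M\<^esub> s x) 0 \<in> V (a + 1)" using vx(1) by argo
  then show ?thesis by (rule bexI[OF _ vx(2)])
qed

end

subsection \<open>Power series\<close>

abbreviation decomps :: "(nat \<Rightarrow>\<^sub>0 nat) \<Rightarrow> ((nat \<Rightarrow>\<^sub>0 nat) \<times> (nat \<Rightarrow>\<^sub>0 nat)) set" where
  "decomps c \<equiv> {(a, b). a + b = c}"

abbreviation unit_exp :: "nat \<Rightarrow> (nat \<Rightarrow>\<^sub>0 nat)" where
  "unit_exp i \<equiv> Poly_Mapping.single i 1"

lemma lookup_unit_exp: "Poly_Mapping.lookup (Poly_Mapping.single i (Suc 0)) j = (if i = j then 1 else 0)"
  by (simp add: lookup_single when_def)

lemma mono_deg_eq_sum: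
  assumes "finite A" "Poly_Mapping.keys a \<subseteq> A"
  shows "mono_deg a = (\<Sum>i\<in>A. Poly_Mapping.lookup a i)"
  unfolding mono_deg_def
  by (rule sum.mono_neutral_left) (use assms in \<open>auto simp: in_keys_iff\<close>)

lemma mono_deg_add: "mono_deg (a + b) = mono_deg a + mono_deg b"
proof -
  let ?A = "Poly_Mapping.keys a \<union> Poly_Mapping.keys b"
  have "Poly_Mapping.keys (a + b) \<subseteq> ?A" by (rule keys_add)
  then show ?thesis
    by (simp add: mono_deg_eq_sum[of ?A] lookup_add sum.distrib)
qed

lemma mono_deg_unit_exp: "mono_deg (Poly_Mapping.single i (Suc 0)) = 1"
  by (simp add: mono_deg_eq_sum[of "{i}"])

lemma lookup_le_mono_deg: "Poly_Mapping.lookup a i \<le> mono_deg a"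
proof (cases "i \<in> Poly_Mapping.keys a")
  case True
  then show ?thesis unfolding mono_deg_def by (intro member_le_sum) auto
qed (simp add: in_keys_iff)

text \<open>A decomposition is determined by its first summand, whose exponents are bounded by those
  of c: a function supported on the keys of c with values at most \<open>mono_deg c\<close>. Every
  later manipulation of \<open>ps_mult\<close> as a sum depends on this finiteness.\<close>

lemma finite_decomps: "finite (decomps c)"
proof -
  let ?F = "{f. \<forall>i. (i \<in> Poly_Mapping.keys c \<longrightarrow> f i \<in> {..mono_deg c}) \<and> (i \<notin> Poly_Mapping.keys c \<longrightarrow> f i = 0)}"
  have "finite ?F" by (rule finite_set_of_finite_funs) auto
  have le: "Poly_Mapping.lookup a \<in> ?F" if "a + b = c" for a b
  proof -
    have *: "Poly_Mapping.lookup a i \<le> Poly_Mapping.lookup c i" for i using that by (auto simp: lookup_add)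
    show ?thesis
    proof (intro CollectI allI conjI impI)
      fix i
      show "Poly_Mapping.lookup a i \<in> {..mono_deg c}" using *[of i] lookup_le_mono_deg[of c i] by simp
      show "Poly_Mapping.lookup a i = 0" if "i \<notin> Poly_Mapping.keys c" using *[of i] that by (simp add: in_keys_iff)
    qed
  qed
  have inj: "inj_on (\<lambda>(a, b). Poly_Mapping.lookup a) (decomps c)"
  proof (rule inj_onI)
    fix x y assume xy: "x \<in> decomps c" "y \<in> decomps c"
      "(case x of (a, b) \<Rightarrow> Poly_Mapping.lookup a) = (case y of (a, b) \<Rightarrow> Poly_Mapping.lookup a)"
    obtain a b where x: "x = (a, b)" by (rule prod.exhaust)
    obtain a' b' where y: "y = (a', b')" by (rule prod.exhaust)
    note ab = x y
    have "a = a'" using xy(3) unfolding ab prod.case by (rule Poly_Mapping.lookup_inject[THEN iffD1])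
    moreover have "a + b = a' + b'" using xy(1,2) ab by simp
    ultimately show "x = y" using ab by simp
  qed
  have "(\<lambda>(a, b). Poly_Mapping.lookup a) ` decomps c \<subseteq> ?F" using le by auto
  then have "finite ((\<lambda>(a, b). Poly_Mapping.lookup a) ` decomps c)"
    using \<open>finite ?F\<close> by (rule finite_subset)
  then show ?thesis using inj by (rule finite_imageD)
qed

lemma ps_mult_sum: "ps_mult f g c = (\<Sum>x\<in>decomps c. f (fst x) * g (snd x))"
  unfolding ps_mult_def by (rule sum.cong) auto

lemma ps_mult_commute: "ps_mult f g = ps_mult g f"
proof
  fix c
  show "ps_mult f g c = ps_mult g f c"
    unfolding ps_mult_sum
    by (rule sum.reindex_bij_witness[of _ prod.swap prod.swap]) (auto simp: add.commute mult.commute)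
qed

lemma ps_mult_assoc: "ps_mult (ps_mult f g) h = ps_mult f (ps_mult g h)"
proof
  fix d
  have "ps_mult (ps_mult f g) h d
    = (\<Sum>(x, y)\<in>Sigma (decomps d) (\<lambda>x. decomps (fst x)). f (fst y) * g (snd y) * h (snd x))"
    unfolding ps_mult_sum by (subst sum.Sigma[symmetric]) (auto simp: finite_decomps sum_distrib_right)
  also have "\<dots> = (\<Sum>(x, y)\<in>Sigma (decomps d) (\<lambda>x. decomps (snd x)). f (fst x) * (g (fst y) * h (snd y)))"
    by (rule sum.reindex_bij_witness[of _ "\<lambda>(x, y). ((fst x + fst y, snd y), (fst x, fst y))"
        "\<lambda>(x, y). ((fst y, snd y + snd x), (snd y, snd x))"]) (auto simp: add.assoc mult.assoc)
  also have "\<dots> = ps_mult f (ps_mult g h) d"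
    unfolding ps_mult_sum by (subst sum.Sigma[symmetric]) (auto simp: finite_decomps sum_distrib_left)
  finally show "ps_mult (ps_mult f g) h d = ps_mult f (ps_mult g h) d" .
qed

lemma ps_mult_left_commute: "ps_mult f (ps_mult g h) = ps_mult g (ps_mult f h)"
  by (metis ps_mult_assoc ps_mult_commute)

lemma ps_mult_lincomb:
  "ps_mult f (\<lambda>a. \<Sum>j\<in>A. c j * g j a) d = (\<Sum>j\<in>A. c j * ps_mult f (g j) d)"
  unfolding ps_mult_sum by (simp add: sum_distrib_left sum.swap[of _ "decomps d"] mult_ac)

lemma ps_mult_add: "ps_mult f (\<lambda>a. g a + h a) = (\<lambda>a. ps_mult f g a + ps_mult f h a)"
  by (rule ext) (simp add: ps_mult_sum distrib_left sum.distrib)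

lemma ps_mult_smult: "ps_mult f (\<lambda>a. c * g a) = (\<lambda>a. c * ps_mult f g a)"
  by (rule ext) (simp add: ps_mult_sum sum_distrib_left mult_ac)

lemma ps_mult_zero: "ps_mult f (\<lambda>_. 0) = (\<lambda>_. 0)" "ps_mult (\<lambda>_. 0) f = (\<lambda>_. 0)"
  by (rule ext, simp add: ps_mult_sum)+

lemma ps_mult_const: "ps_mult (\<lambda>a. if a = 0 then c else 0) f = (\<lambda>a. c * f a)"
proof
  fix d
  have "(\<Sum>x\<in>decomps d. (if fst x = 0 then c else 0) * f (snd x))
    = (\<Sum>x\<in>decomps d. if x = (0, d) then c * f d else 0)"
    by (rule sum.cong) auto
  then show "ps_mult (\<lambda>a. if a = 0 then c else 0) f d = c * f d"
    by (simp add: ps_mult_sum sum.delta finite_decomps)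
qed

lemma pderiv_ps_lincomb:
  "pderiv_ps i (\<lambda>a. \<Sum>j\<in>A. c j * g j a) d = (\<Sum>j\<in>A. c j * pderiv_ps i (g j) d)"
  by (simp add: pderiv_ps_def sum_distrib_left mult_ac)

lemma pderiv_ps_zero: "pderiv_ps i (\<lambda>_. 0) = (\<lambda>_. 0)"
  by (simp add: pderiv_ps_def)

text \<open>The factor produced by differentiating at c + e_i is the exponent of x_i there, and it
  is the sum of the exponents of x_i in the two factors. Each half gives one of the two
  products.\<close>

lemma pderiv_ps_mult:
  "pderiv_ps i (ps_mult f g) c = ps_mult (pderiv_ps i f) g c + ps_mult f (pderiv_ps i g) c"
proof -
  let ?e = "unit_exp i" and ?l = "\<lambda>a. of_nat (Poly_Mapping.lookup a i) :: complex"
  \<comment> \<open>The weight discards the decompositions whose first part does not involve x_i;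
    from the others one e_i can be removed, which leaves the decompositions of c.\<close>
  have *: "(\<Sum>x\<in>decomps (c + ?e). ?l (fst x) * (f (fst x) * g (snd x))) = ps_mult (pderiv_ps i f) g c" for f g
  proof -
    have "(\<Sum>x\<in>decomps (c + ?e). ?l (fst x) * (f (fst x) * g (snd x)))
      = (\<Sum>x\<in>{x \<in> decomps (c + ?e). Poly_Mapping.lookup (fst x) i \<noteq> 0}. ?l (fst x) * (f (fst x) * g (snd x)))"
      by (rule sum.mono_neutral_right) (auto simp: finite_decomps)
    also have "\<dots> = (\<Sum>x\<in>decomps c. pderiv_ps i f (fst x) * g (snd x))"
    proof (rule sum.reindex_bij_witness[of _ "\<lambda>x. (fst x + ?e, snd x)" "\<lambda>x. (fst x - ?e, snd x)"])
      fix x assume "x \<in> {x \<in> decomps (c + ?e). Poly_Mapping.lookup (fst x) i \<noteq> 0}"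
      then obtain a b where x: "x = (a, b)" "a + b = c + ?e" "Poly_Mapping.lookup a i \<noteq> 0" by (cases x) auto
      have a: "a - ?e + ?e = a"
        using x(3) by (intro poly_mapping_eqI) (auto simp: lookup_add lookup_minus lookup_unit_exp)
      then have "a - ?e + b + ?e = c + ?e" using x(2) by (simp add: ac_simps)
      then have "a - ?e + b = c" by simp
      then show "(fst x - ?e, snd x) \<in> decomps c" "(fst (fst x - ?e, snd x) + ?e, snd (fst x - ?e, snd x)) = x"
        using x a by auto
      have "Poly_Mapping.lookup (a - ?e) i + 1 = Poly_Mapping.lookup a i"
        using x(3) by (simp add: lookup_minus)
      then show "pderiv_ps i f (fst (fst x - ?e, snd x)) * g (snd (fst x - ?e, snd x)) = ?l (fst x) * (f (fst x) * g (snd x))"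
        unfolding pderiv_ps_def using x(1) a by simp
    next
      fix y assume y: "y \<in> decomps c"
      show "(fst y + ?e, snd y) \<in> {x \<in> decomps (c + ?e). Poly_Mapping.lookup (fst x) i \<noteq> 0}"
        using y by (auto simp: lookup_add ac_simps)
      show "(fst (fst y + ?e, snd y) - ?e, snd (fst y + ?e, snd y)) = y" by simp
    qed
    finally show ?thesis by (simp add: ps_mult_sum)
  qed
  have "pderiv_ps i (ps_mult f g) c = (\<Sum>x\<in>decomps (c + ?e). (?l (fst x) + ?l (snd x)) * (f (fst x) * g (snd x)))"
    unfolding pderiv_ps_def ps_mult_sum sum_distrib_left
  proof (rule sum.cong)
    fix x assume "x \<in> decomps (c + ?e)"
    then have "fst x + snd x = c + ?e" by auto
    from arg_cong[OF this, of "\<lambda>a. Poly_Mapping.lookup a i"]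
    have "Poly_Mapping.lookup c i + 1 = Poly_Mapping.lookup (fst x) i + Poly_Mapping.lookup (snd x) i"
      by (simp add: lookup_add)
    then have "(of_nat (Poly_Mapping.lookup c i + 1) :: complex) = ?l (fst x) + ?l (snd x)"
      by (simp only: of_nat_add)
    then show "of_nat (Poly_Mapping.lookup c i + 1) * (f (fst x) * g (snd x)) = (?l (fst x) + ?l (snd x)) * (f (fst x) * g (snd x))"
      by (simp only:)
  qed simp
  also have "\<dots> = (\<Sum>x\<in>decomps (c + ?e). ?l (fst x) * (f (fst x) * g (snd x)))
      + (\<Sum>x\<in>decomps (c + ?e). ?l (snd x) * (f (fst x) * g (snd x)))"
    unfolding distrib_right sum.distrib ..
  also have "(\<Sum>x\<in>decomps (c + ?e). ?l (snd x) * (f (fst x) * g (snd x)))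
      = (\<Sum>x\<in>decomps (c + ?e). ?l (fst x) * (g (fst x) * f (snd x)))"
    by (rule sum.reindex_bij_witness[of _ prod.swap prod.swap]) (auto simp: add.commute mult.commute)
  finally show ?thesis unfolding * by (simp add: ps_mult_commute[of f])
qed

lemma pderiv_ps_commute: "pderiv_ps i (pderiv_ps j f) = pderiv_ps j (pderiv_ps i f)"
  by (rule ext) (auto simp: pderiv_ps_def lookup_add lookup_unit_exp ac_simps)

text \<open>Multiplication by x_i. Subtraction of exponents truncates, so monomials without x_i need
  their own case.\<close>

definition var_mult :: "nat \<Rightarrow> pseries \<Rightarrow> pseries" where
  "var_mult i f = (\<lambda>a. if Poly_Mapping.lookup a i = 0 then 0 else f (a - unit_exp i))"

lemma minus_unit_exp_add:
  "Poly_Mapping.lookup a i \<noteq> 0 \<Longrightarrow> a - unit_exp i + unit_exp i = a"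
  by (intro poly_mapping_eqI) (auto simp: lookup_add lookup_minus lookup_unit_exp)

lemma var_mult_lincomb:
  "var_mult i (\<lambda>a. \<Sum>j\<in>A. c j * g j a) d = (\<Sum>j\<in>A. c j * var_mult i (g j) d)"
  by (simp add: var_mult_def)

lemma var_mult_zero: "var_mult i (\<lambda>_. 0) = (\<lambda>_. 0)"
  by (simp add: var_mult_def)

lemma var_mult_pderiv_ps: "var_mult i (pderiv_ps i f) a = of_nat (Poly_Mapping.lookup a i) * f a"
proof (cases "Poly_Mapping.lookup a i = 0")
  case False
  then have "Poly_Mapping.lookup (a - unit_exp i) i + 1 = Poly_Mapping.lookup a i"
    by (simp add: lookup_minus)
  then have "(of_nat (Poly_Mapping.lookup (a - unit_exp i) i + 1) :: complex) = of_nat (Poly_Mapping.lookup a i)"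
    by (simp only:)
  then show ?thesis using False minus_unit_exp_add[OF False] by (simp add: var_mult_def pderiv_ps_def)
qed (simp add: var_mult_def)

lemma pderiv_ps_var_mult: "pderiv_ps i (var_mult i f) a = of_nat (Poly_Mapping.lookup a i + 1) * f a"
  by (simp add: var_mult_def pderiv_ps_def lookup_add)

lemma pderiv_ps_var_mult_neq:
  assumes "i \<noteq> j"
  shows "pderiv_ps i (var_mult j f) = var_mult j (pderiv_ps i f)"
proof
  fix a
  have "a + unit_exp i - unit_exp j = a - unit_exp j + unit_exp i" if "Poly_Mapping.lookup a j \<noteq> 0"
    using assms that by (intro poly_mapping_eqI) (auto simp: lookup_add lookup_minus lookup_unit_exp)
  then show "pderiv_ps i (var_mult j f) a = var_mult j (pderiv_ps i f) a"
    using assms by (auto simp: var_mult_def pderiv_ps_def lookup_add lookup_minus lookup_unit_exp)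
qed

subsection \<open>Convergence\<close>

lemma summable_on_nonneg_iff:
  fixes g :: "'a \<Rightarrow> real"
  assumes "\<And>x. 0 \<le> g x"
  shows "g summable_on UNIV \<longleftrightarrow> (\<exists>B. \<forall>F. finite F \<longrightarrow> sum g F \<le> B)"
proof
  assume "g summable_on UNIV"
  then show "\<exists>B. \<forall>F. finite F \<longrightarrow> sum g F \<le> B"
    using finite_sum_le_infsum[of g UNIV] assms by blast
next
  assume "\<exists>B. \<forall>F. finite F \<longrightarrow> sum g F \<le> B"
  then obtain B where "\<And>F. finite F \<Longrightarrow> sum g F \<le> B" by blast
  then show "g summable_on UNIV"
    by (intro nonneg_bdd_above_summable_on) (auto simp: assms bdd_above_def)
qed

text \<open>A bound for all finite partial sums of the absolute series at radius r. By
  \<open>conv_ps_iff\<close> it expresses convergence, and it reduces every estimate below to finite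
  sums.\<close>

definition bounded_at :: "real \<Rightarrow> pseries \<Rightarrow> real \<Rightarrow> bool" where
  "bounded_at r f B \<longleftrightarrow> (\<forall>F. finite F \<longrightarrow> (\<Sum>a\<in>F. norm (f a) * r ^ mono_deg a) \<le> B)"

lemma conv_ps_iff:
  "f \<in> carrier (conv_ps n) \<longleftrightarrow>
    (\<forall>a. f a \<noteq> 0 \<longrightarrow> Poly_Mapping.keys a \<subseteq> {..n}) \<and> (\<exists>r>0. \<exists>B. bounded_at r f B)"
proof -
  have "(\<lambda>a. norm (f a) * r ^ mono_deg a) summable_on UNIV \<longleftrightarrow> (\<exists>B. bounded_at r f B)" if "r > 0" for r
    unfolding bounded_at_def using that by (intro summable_on_nonneg_iff) auto
  then show ?thesis unfolding conv_ps_def by (auto simp: Bex_def)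
qed

lemma bounded_at_mono:
  assumes "bounded_at r f B" "0 \<le> r'" "r' \<le> r" "\<And>a. norm (g a) \<le> norm (f a)"
  shows "bounded_at r' g B"
  unfolding bounded_at_def
proof (intro allI impI)
  fix F :: "(nat \<Rightarrow>\<^sub>0 nat) set" assume "finite F"
  have "(\<Sum>a\<in>F. norm (g a) * r' ^ mono_deg a) \<le> (\<Sum>a\<in>F. norm (f a) * r ^ mono_deg a)"
    by (intro sum_mono mult_mono power_mono) (use assms in auto)
  also have "\<dots> \<le> B" using assms(1) \<open>finite F\<close> unfolding bounded_at_def by blast
  finally show "(\<Sum>a\<in>F. norm (g a) * r' ^ mono_deg a) \<le> B" .
qed

lemma bounded_at_nonneg: "bounded_at r f B \<Longrightarrow> 0 \<le> B"
  unfolding bounded_at_def by (drule spec[of _ "{}"]) simp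

lemma conv_ps_le:
  assumes "f \<in> carrier (conv_ps n)" "\<And>a. norm (g a) \<le> norm (f a)"
  shows "g \<in> carrier (conv_ps n)"
proof -
  obtain r B where r: "r > 0" "bounded_at r f B" using assms(1) unfolding conv_ps_iff by blast
  have "bounded_at r g B" by (rule bounded_at_mono[OF r(2)]) (use r(1) assms(2) in auto)
  moreover have "f a \<noteq> 0" if "g a \<noteq> 0" for a using assms(2)[of a] that by auto
  ultimately show ?thesis using assms(1) r(1) unfolding conv_ps_iff by blast
qed

lemma conv_ps_zero: "(\<lambda>_. 0) \<in> carrier (conv_ps n)"
  unfolding conv_ps_iff bounded_at_def by (auto intro!: exI[of _ 1])

lemma conv_ps_const: "(\<lambda>a. if a = 0 then c else 0) \<in> carrier (conv_ps n)"
proof -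
  have "(\<Sum>a\<in>F. norm (if a = 0 then c else 0) * 1 ^ mono_deg a) \<le> norm c" if "finite F" for F :: "(nat \<Rightarrow>\<^sub>0 nat) set"
  proof -
    have "(\<Sum>a\<in>F. norm (if a = 0 then c else 0) * 1 ^ mono_deg a) = (\<Sum>a\<in>F. if a = 0 then norm c else 0)"
      by (rule sum.cong) auto
    also have "\<dots> \<le> norm c" by (subst sum.delta[OF that]) simp
    finally show ?thesis .
  qed
  then have "bounded_at 1 (\<lambda>a. if a = 0 then c else 0) (norm c)" unfolding bounded_at_def by blast
  then have "\<exists>r>0. \<exists>B. bounded_at r (\<lambda>a. if a = 0 then c else 0) B"
    by (intro exI[of _ 1] conjI exI[of _ "norm c"]) simp_all
  then show ?thesis unfolding conv_ps_iff by (auto split: if_splits)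
qed

lemma conv_ps_add:
  assumes f: "f \<in> carrier (conv_ps n)" and g: "g \<in> carrier (conv_ps n)"
  shows "(\<lambda>a. f a + g a) \<in> carrier (conv_ps n)"
proof -
  obtain r B where r: "r > 0" "bounded_at r f B" using f unfolding conv_ps_iff by blast
  obtain q C where q: "q > 0" "bounded_at q g C" using g unfolding conv_ps_iff by blast
  let ?m = "min r q"
  have m: "bounded_at ?m f B" "bounded_at ?m g C" "?m > 0"
    using r q by (auto intro!: bounded_at_mono[OF r(2)] bounded_at_mono[OF q(2)])
  have "bounded_at ?m (\<lambda>a. f a + g a) (B + C)"
    unfolding bounded_at_def
  proof (intro allI impI)
    fix F :: "(nat \<Rightarrow>\<^sub>0 nat) set" assume "finite F"
    have "(\<Sum>a\<in>F. norm (f a + g a) * ?m ^ mono_deg a) \<le> (\<Sum>a\<in>F. norm (f a) * ?m ^ mono_deg a + norm (g a) * ?m ^ mono_deg a)"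
      unfolding distrib_right[symmetric] by (intro sum_mono mult_right_mono norm_triangle_ineq) (use m(3) in auto)
    also have "\<dots> \<le> B + C"
      using m(1,2) \<open>finite F\<close> unfolding bounded_at_def sum.distrib by (intro add_mono) blast+
    finally show "(\<Sum>a\<in>F. norm (f a + g a) * ?m ^ mono_deg a) \<le> B + C" .
  qed
  moreover have "f a \<noteq> 0 \<or> g a \<noteq> 0" if "f a + g a \<noteq> 0" for a using that by auto
  ultimately show ?thesis using f g m(3) unfolding conv_ps_iff by blast
qed

lemma conv_ps_smult:
  assumes f: "f \<in> carrier (conv_ps n)"
  shows "(\<lambda>a. c * f a) \<in> carrier (conv_ps n)"
proof -
  obtain r B where r: "r > 0" "bounded_at r f B" using f unfolding conv_ps_iff by blast
  have "bounded_at r (\<lambda>a. c * f a) (norm c * B)"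
    unfolding bounded_at_def
  proof (intro allI impI)
    fix F :: "(nat \<Rightarrow>\<^sub>0 nat) set" assume "finite F"
    then have "norm c * (\<Sum>a\<in>F. norm (f a) * r ^ mono_deg a) \<le> norm c * B"
      using r(2) unfolding bounded_at_def by (intro mult_left_mono) auto
    then show "(\<Sum>a\<in>F. norm (c * f a) * r ^ mono_deg a) \<le> norm c * B"
      by (simp add: norm_mult sum_distrib_left mult.assoc)
  qed
  then show ?thesis using f r(1) unfolding conv_ps_iff by auto
qed

lemma conv_ps_sum:
  assumes "finite A" "\<And>j. j \<in> A \<Longrightarrow> g j \<in> carrier (conv_ps n)"
  shows "(\<lambda>a. \<Sum>j\<in>A. c j * g j a) \<in> carrier (conv_ps n)"
  using assms
proof (induction A rule: finite_induct)
  case (insert x A)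
  have "(\<lambda>a. c x * g x a + (\<Sum>j\<in>A. c j * g j a)) \<in> carrier (conv_ps n)"
    by (intro conv_ps_add conv_ps_smult) (use insert in auto)
  then show ?case using insert.hyps by simp
qed (simp add: conv_ps_zero)

text \<open>A finite partial sum of the product runs over finitely many pairs of exponents. These
  lie in the rectangle spanned by their two projections, where the sum factors into partial sums of
  f and of g at the smaller radius.\<close>

lemma conv_ps_mult:
  assumes f: "f \<in> carrier (conv_ps n)" and g: "g \<in> carrier (conv_ps n)"
  shows "ps_mult f g \<in> carrier (conv_ps n)"
proof -
  obtain r B where r: "r > 0" "bounded_at r f B" using f unfolding conv_ps_iff by blast
  obtain q C where q: "q > 0" "bounded_at q g C" using g unfolding conv_ps_iff by blast
  let ?m = "min r q"
  have m: "bounded_at ?m f B" "bounded_at ?m g C" "?m > 0"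
    using r q by (auto intro!: bounded_at_mono[OF r(2)] bounded_at_mono[OF q(2)])
  let ?n = "\<lambda>f a. norm (f a) * ?m ^ mono_deg a"
  have "bounded_at ?m (ps_mult f g) (B * C)"
    unfolding bounded_at_def
  proof (intro allI impI)
    fix F :: "(nat \<Rightarrow>\<^sub>0 nat) set" assume F: "finite F"
    let ?P = "\<Union>c\<in>F. decomps c"
    have P: "finite ?P" using F finite_decomps by blast
    have "?n (ps_mult f g) c \<le> (\<Sum>x\<in>decomps c. ?n f (fst x) * ?n g (snd x))" for c
    proof -
      have "norm (ps_mult f g c) \<le> (\<Sum>x\<in>decomps c. norm (f (fst x)) * norm (g (snd x)))"
        unfolding ps_mult_sum norm_mult[symmetric] by (rule norm_sum)
      then have "?n (ps_mult f g) c \<le> (\<Sum>x\<in>decomps c. norm (f (fst x)) * norm (g (snd x))) * ?m ^ mono_deg c"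
        using m(3) by (intro mult_right_mono) auto
      also have "\<dots> = (\<Sum>x\<in>decomps c. ?n f (fst x) * ?n g (snd x))"
        unfolding sum_distrib_right by (rule sum.cong) (auto simp: mono_deg_add power_add)
      finally show ?thesis .
    qed
    then have "(\<Sum>c\<in>F. ?n (ps_mult f g) c) \<le> (\<Sum>c\<in>F. \<Sum>x\<in>decomps c. ?n f (fst x) * ?n g (snd x))"
      by (rule sum_mono)
    also have "\<dots> = (\<Sum>x\<in>?P. ?n f (fst x) * ?n g (snd x))"
      by (rule sum.UNION_disjoint[symmetric]) (use F finite_decomps in auto)
    also have "\<dots> \<le> (\<Sum>x\<in>fst ` ?P \<times> snd ` ?P. ?n f (fst x) * ?n g (snd x))"
    proof (rule sum_mono2)
      show "finite (fst ` ?P \<times> snd ` ?P)" using P by blast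
      show "?P \<subseteq> fst ` ?P \<times> snd ` ?P" by force
      show "0 \<le> ?n f (fst b) * ?n g (snd b)" for b using m(3) by simp
    qed
    also have "\<dots> = (\<Sum>a\<in>fst ` ?P. ?n f a) * (\<Sum>b\<in>snd ` ?P. ?n g b)"
      by (simp add: sum_product sum.cartesian_product case_prod_unfold)
    also have "\<dots> \<le> B * C"
    proof (rule mult_mono)
      show "(\<Sum>a\<in>fst ` ?P. ?n f a) \<le> B" using m(1) P unfolding bounded_at_def by blast
      show "(\<Sum>a\<in>snd ` ?P. ?n g a) \<le> C" using m(2) P unfolding bounded_at_def by blast
      show "0 \<le> B" by (rule bounded_at_nonneg[OF m(1)])
      show "0 \<le> (\<Sum>b\<in>snd ` ?P. ?n g b)" using m(3) by (intro sum_nonneg) simp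
    qed
    finally show "(\<Sum>c\<in>F. ?n (ps_mult f g) c) \<le> B * C" .
  qed
  moreover have "Poly_Mapping.keys c \<subseteq> {..n}" if c: "ps_mult f g c \<noteq> 0" for c
  proof -
    obtain x where x: "x \<in> decomps c" "f (fst x) * g (snd x) \<noteq> 0"
      using c unfolding ps_mult_sum by (rule sum.not_neutral_contains_not_neutral)
    then have "Poly_Mapping.keys (fst x) \<subseteq> {..n}" "Poly_Mapping.keys (snd x) \<subseteq> {..n}"
      using f g unfolding conv_ps_iff by auto
    moreover have "c = fst x + snd x" using x(1) by auto
    ultimately show ?thesis using keys_add[of "fst x" "snd x"] by blast
  qed
  ultimately show ?thesis using m(3) unfolding conv_ps_iff by blast
qed

lemma conv_ps_pderiv:
  assumes f: "f \<in> carrier (conv_ps n)"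
  shows "pderiv_ps i f \<in> carrier (conv_ps n)"
proof -
  obtain r B where r: "r > 0" "bounded_at r f B" using f unfolding conv_ps_iff by blast
  let ?e = "unit_exp i"
  \<comment> \<open>Halving the radius gains 2^|a|, which absorbs the factor a_i + 1 of the
    derivative. The divisor r accounts for the degree lost by differentiating.\<close>
  have "bounded_at (r / 2) (pderiv_ps i f) (B / r)"
    unfolding bounded_at_def
  proof (intro allI impI)
    fix F :: "(nat \<Rightarrow>\<^sub>0 nat) set" assume F: "finite F"
    have "norm (pderiv_ps i f a) * (r / 2) ^ mono_deg a \<le> norm (f (a + ?e)) * r ^ mono_deg (a + ?e) / r" for a
    proof -
      have "Poly_Mapping.lookup a i + 1 \<le> 2 ^ mono_deg a"
        using lookup_le_mono_deg[of a i] less_exp[of "mono_deg a"] by linarith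
      then have "real (Poly_Mapping.lookup a i + 1) \<le> 2 ^ mono_deg a"
        by (metis of_nat_le_iff of_nat_numeral of_nat_power)
      then have "real (Poly_Mapping.lookup a i + 1) * (r / 2) ^ mono_deg a \<le> 2 ^ mono_deg a * (r / 2) ^ mono_deg a"
        using r(1) by (intro mult_right_mono) auto
      also have "\<dots> = r ^ mono_deg a" by (simp add: power_divide)
      finally have "norm (f (a + ?e)) * (real (Poly_Mapping.lookup a i + 1) * (r / 2) ^ mono_deg a)
        \<le> norm (f (a + ?e)) * r ^ mono_deg a"
        by (intro mult_left_mono) auto
      moreover have "norm (pderiv_ps i f a) = norm (f (a + ?e)) * real (Poly_Mapping.lookup a i + 1)"
        unfolding pderiv_ps_def norm_mult norm_of_nat by simp
      ultimately show ?thesis using r(1) by (simp add: mono_deg_add mono_deg_unit_exp mult.assoc)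
    qed
    then have "(\<Sum>a\<in>F. norm (pderiv_ps i f a) * (r / 2) ^ mono_deg a)
      \<le> (\<Sum>a\<in>F. norm (f (a + ?e)) * r ^ mono_deg (a + ?e) / r)" by (rule sum_mono)
    also have "\<dots> = (\<Sum>a\<in>(\<lambda>a. a + ?e) ` F. norm (f a) * r ^ mono_deg a) / r"
      by (subst sum.reindex) (auto simp: sum_divide_distrib inj_on_def)
    also have "\<dots> \<le> B / r"
      using r F unfolding bounded_at_def by (intro divide_right_mono) auto
    finally show "(\<Sum>a\<in>F. norm (pderiv_ps i f a) * (r / 2) ^ mono_deg a) \<le> B / r" .
  qed
  moreover have "Poly_Mapping.keys a \<subseteq> {..n}" if "pderiv_ps i f a \<noteq> 0" for a
  proof -
    have "f (a + ?e) \<noteq> 0" using that by (auto simp: pderiv_ps_def)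
    then have "Poly_Mapping.keys (a + ?e) \<subseteq> {..n}" using f unfolding conv_ps_iff by blast
    moreover have "Poly_Mapping.keys a \<subseteq> Poly_Mapping.keys (a + ?e)"
      by (auto simp: in_keys_iff lookup_add)
    ultimately show ?thesis by blast
  qed
  ultimately show ?thesis using f r(1) half_gt_zero[of r] unfolding conv_ps_iff by blast
qed

lemma conv_ps_var_mult:
  assumes f: "f \<in> carrier (conv_ps n)" and i: "i \<le> n"
  shows "var_mult i f \<in> carrier (conv_ps n)"
proof -
  obtain r B where r: "r > 0" "bounded_at r f B" using f unfolding conv_ps_iff by blast
  let ?e = "unit_exp i"
  have "bounded_at r (var_mult i f) (B * r)"
    unfolding bounded_at_def
  proof (intro allI impI)
    fix F :: "(nat \<Rightarrow>\<^sub>0 nat) set" assume F: "finite F"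
    let ?G = "{a \<in> F. Poly_Mapping.lookup a i \<noteq> 0}"
    have inj: "inj_on (\<lambda>a. a - ?e) ?G"
    proof (rule inj_onI)
      fix a b assume "a \<in> ?G" "b \<in> ?G" "a - ?e = b - ?e"
      then show "a = b" using minus_unit_exp_add[of a i] minus_unit_exp_add[of b i] by simp
    qed
    have "(\<Sum>a\<in>F. norm (var_mult i f a) * r ^ mono_deg a) = (\<Sum>a\<in>?G. norm (var_mult i f a) * r ^ mono_deg a)"
      by (rule sum.mono_neutral_right) (use F in \<open>auto simp: var_mult_def\<close>)
    also have "\<dots> = (\<Sum>a\<in>?G. norm (f (a - ?e)) * r ^ mono_deg (a - ?e) * r)"
    proof (rule sum.cong)
      fix a assume "a \<in> ?G"
      then have nz: "Poly_Mapping.lookup a i \<noteq> 0" by simp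
      have "mono_deg a = Suc (mono_deg (a - ?e))"
        using mono_deg_add[of "a - ?e" ?e] minus_unit_exp_add[OF nz] mono_deg_unit_exp[of i] by simp
      then show "norm (var_mult i f a) * r ^ mono_deg a = norm (f (a - ?e)) * r ^ mono_deg (a - ?e) * r"
        using nz by (simp add: var_mult_def)
    qed simp
    also have "\<dots> = (\<Sum>a\<in>(\<lambda>a. a - ?e) ` ?G. norm (f a) * r ^ mono_deg a) * r"
      by (subst sum.reindex[OF inj]) (simp add: sum_distrib_right)
    also have "\<dots> \<le> B * r"
      using r F unfolding bounded_at_def by (intro mult_right_mono) auto
    finally show "(\<Sum>a\<in>F. norm (var_mult i f a) * r ^ mono_deg a) \<le> B * r" .
  qed
  moreover have "Poly_Mapping.keys a \<subseteq> {..n}" if "var_mult i f a \<noteq> 0" for a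
  proof -
    have nz: "Poly_Mapping.lookup a i \<noteq> 0" "f (a - ?e) \<noteq> 0" using that by (auto simp: var_mult_def split: if_splits)
    then have "Poly_Mapping.keys (a - ?e) \<subseteq> {..n}" using f unfolding conv_ps_iff by blast
    then show ?thesis using keys_add[of "a - ?e" ?e] minus_unit_exp_add[OF nz(1)] i by auto
  qed
  ultimately show ?thesis using r(1) unfolding conv_ps_iff by blast
qed

subsection \<open>Graded derivations on forms\<close>

text \<open>For i in K this is the sign in dx_i \<and> dx_(K - {i}) = \<plusminus> dx_K. For i
  outside K it is the sign relating dx_i \<and> dx_K to dx_(insert i K).\<close>

definition sgn_at :: "nat \<Rightarrow> nat set \<Rightarrow> complex" where
  "sgn_at i K = (- 1) ^ card {x \<in> K. x < i}"

lemma shuffle_sign_single: "shuffle_sign {i} (K - {i}) = sgn_at i K"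
proof -
  have "{(i', j). i' \<in> {i} \<and> j \<in> K - {i} \<and> j < i'} = Pair i ` {x \<in> K. x < i}" by auto
  then show ?thesis by (simp add: shuffle_sign_def sgn_at_def card_image inj_on_def)
qed

lemma sgn_at_square: "sgn_at i K * sgn_at i K = 1"
  by (simp add: sgn_at_def flip: power_add power_mult_distrib)

lemma sgn_at_insert_self: "sgn_at i (insert i K) = sgn_at i K" "sgn_at i (K - {i}) = sgn_at i K"
proof -
  have "{x \<in> insert i K. x < i} = {x \<in> K. x < i}" "{x \<in> K - {i}. x < i} = {x \<in> K. x < i}" by auto
  then show "sgn_at i (insert i K) = sgn_at i K" "sgn_at i (K - {i}) = sgn_at i K"
    by (simp_all add: sgn_at_def)
qed

lemma sgn_at_insert:
  assumes "finite K" "i \<notin> K"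
  shows "sgn_at j (insert i K) = (if i < j then - sgn_at j K else sgn_at j K)"
proof (cases "i < j")
  case True
  then have "{x \<in> insert i K. x < j} = insert i {x \<in> K. x < j}" by auto
  then show ?thesis using True assms by (simp add: sgn_at_def)
next
  case False
  then have "{x \<in> insert i K. x < j} = {x \<in> K. x < j}" by auto
  then show ?thesis using False by (simp add: sgn_at_def)
qed

lemma sgn_at_remove:
  assumes "finite K" "i \<in> K"
  shows "sgn_at j (K - {i}) = (if i < j then - sgn_at j K else sgn_at j K)"
  using sgn_at_insert[of "K - {i}" i j] assms by (auto simp: insert_absorb)

lemma sgn_at_swap:
  assumes "finite K" "i \<in> K" "j \<in> K" "i \<noteq> j"
  shows "sgn_at i K * sgn_at j (K - {i}) = - (sgn_at j K * sgn_at i (K - {j}))"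
  using assms by (auto simp: sgn_at_remove)

text \<open>The sign rule by which wedging with dx_i anticommutes with contraction by the j-th
  coordinate field; it cancels the mixed terms of \<open>cartan_formula\<close>.\<close>

lemma sgn_at_exchange:
  assumes "finite K" "i \<in> K" "j \<notin> K"
  shows "sgn_at i K * sgn_at j (K - {i}) = - (sgn_at j K * sgn_at i (insert j K))"
proof -
  have "i \<noteq> j" using assms by auto
  then show ?thesis using assms by (auto simp: sgn_at_remove sgn_at_insert)
qed

text \<open>The operator given by the sum of dx_i \<and> E_i. Partial derivatives for E give d,
  multiplication by the partial derivatives of f gives df \<and>; one sign computation then serves
  both.\<close>

definition grad :: "(nat \<Rightarrow> pseries \<Rightarrow> pseries) \<Rightarrow> form \<Rightarrow> form" where
  "grad E \<omega> = (\<lambda>K a. \<Sum>i\<in>K. sgn_at i K * E i (\<omega> (K - {i})) a)"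

text \<open>Linearity is phrased through finite sums over sets of indices, so that the inner sum of
  an iterated \<open>grad\<close> can be pulled out in a single rewrite. Empty, one-element and
  two-element sets recover zero, scalars and addition.\<close>

definition lin_family :: "(nat \<Rightarrow> pseries \<Rightarrow> pseries) \<Rightarrow> bool" where
  "lin_family E \<longleftrightarrow> (\<forall>i (A :: nat set) c g d. E i (\<lambda>a. \<Sum>j\<in>A. c j * g j a) d = (\<Sum>j\<in>A. c j * E i (g j) d))"

lemma lin_family_pderiv_ps: "lin_family pderiv_ps"
  unfolding lin_family_def by (simp add: pderiv_ps_lincomb)

lemma lin_family_ps_mult: "lin_family (\<lambda>i. ps_mult (h i))"
  unfolding lin_family_def by (simp add: ps_mult_lincomb)

lemma lin_familyD: "lin_family E \<Longrightarrow> E i (\<lambda>a. \<Sum>j\<in>A. c j * g j a) d = (\<Sum>j\<in>(A :: nat set). c j * E i (g j) d)"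
  unfolding lin_family_def by blast

lemma lin_family_zero: "lin_family E \<Longrightarrow> E i (\<lambda>_. 0) = (\<lambda>_. 0)"
  using lin_familyD[where A = "{}"] by auto

lemma lin_family_add: "lin_family E \<Longrightarrow> E i (\<lambda>a. f a + g a) d = E i f d + E i g d"
  using lin_familyD[of E i "\<lambda>_. 1" "\<lambda>j. if j = 0 then f else g" "{0, 1}" d] by simp

lemma lin_family_smult: "lin_family E \<Longrightarrow> E i (\<lambda>a. c * f a) d = c * E i f d"
  using lin_familyD[of E i "\<lambda>_. c" "\<lambda>_. f" "{0}" d] by simp

lemma grad_add: "lin_family E \<Longrightarrow> grad E (\<lambda>I a. \<omega> I a + \<eta> I a) = (\<lambda>I a. grad E \<omega> I a + grad E \<eta> I a)"
  by (simp add: grad_def lin_family_add distrib_left sum.distrib)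

lemma grad_smult: "lin_family E \<Longrightarrow> grad E (\<lambda>I a. c * \<omega> I a) = (\<lambda>I a. c * grad E \<omega> I a)"
  by (simp add: grad_def lin_family_smult sum_distrib_left mult_ac)

text \<open>With the diagonal filled by 0 both indices range over K, so the sums can be exchanged,
  and the double sum equals its own negative.\<close>

lemma sum_antisymmetric:
  fixes h :: "nat \<Rightarrow> nat \<Rightarrow> complex"
  assumes "finite K" "\<And>i j. i \<in> K \<Longrightarrow> j \<in> K \<Longrightarrow> i \<noteq> j \<Longrightarrow> h i j = - h j i"
  shows "(\<Sum>i\<in>K. \<Sum>j\<in>K - {i}. h i j) = 0"
proof -
  let ?h = "\<lambda>i j. if i = j then 0 else h i j"
  have "(\<Sum>i\<in>K. \<Sum>j\<in>K - {i}. h i j) = (\<Sum>i\<in>K. \<Sum>j\<in>K. ?h i j)"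
  proof (rule sum.cong[OF refl])
    fix i assume "i \<in> K"
    have "(\<Sum>j\<in>K - {i}. h i j) = (\<Sum>j\<in>K - {i}. ?h i j)" by (rule sum.cong) auto
    also have "\<dots> = (\<Sum>j\<in>K. ?h i j)" by (rule sum.mono_neutral_left) (use assms(1) in auto)
    finally show "(\<Sum>j\<in>K - {i}. h i j) = (\<Sum>j\<in>K. ?h i j)" .
  qed
  moreover have "(\<Sum>i\<in>K. \<Sum>j\<in>K. ?h i j) = - (\<Sum>i\<in>K. \<Sum>j\<in>K. ?h i j)"
  proof -
    have "(\<Sum>i\<in>K. \<Sum>j\<in>K. ?h i j) = (\<Sum>j\<in>K. \<Sum>i\<in>K. ?h i j)" by (rule sum.swap)
    also have "\<dots> = (\<Sum>j\<in>K. \<Sum>i\<in>K. - ?h j i)"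
    proof (intro sum.cong refl)
      fix j i assume "j \<in> K" "i \<in> K"
      then show "?h i j = - ?h j i" using assms(2)[of i j] by auto
    qed
    finally show ?thesis by (simp add: sum_negf)
  qed
  ultimately show ?thesis by simp
qed

text \<open>The assumption \<open>sym\<close> says that the commutator of D_i and E_j is symmetric
  in i and j; equivalently, D_i E_j + E_i D_j is. The sign of removing i and then j is
  antisymmetric, so the sum of both orders vanishes. For df with itself the commutators are 0, for d
  with df they are multiplication by the second derivatives of f.\<close>

lemma grad_anticommute:
  assumes D: "lin_family D" and E: "lin_family E"
    and sym: "\<And>i j g a. D i (E j g) a - E j (D i g) a = D j (E i g) a - E i (D j g) a"
  shows "grad D (grad E \<omega>) = (\<lambda>K a. - grad E (grad D \<omega>) K a)"
proof (intro ext)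
  fix K a
  show "grad D (grad E \<omega>) K a = - grad E (grad D \<omega>) K a"
  proof (cases "finite K")
    case True
    let ?w = "\<lambda>i j. \<omega> (K - {i} - {j})"
    let ?s = "\<lambda>i j. sgn_at i K * sgn_at j (K - {i})"
    have exp: "grad D (grad E \<omega>) K a = (\<Sum>i\<in>K. \<Sum>j\<in>K - {i}. ?s i j * D i (E j (?w i j)) a)"
      if D: "lin_family D" for D E
      unfolding grad_def lin_familyD[OF D] by (simp add: sum_distrib_left mult.assoc)
    have "grad D (grad E \<omega>) K a + grad E (grad D \<omega>) K a
      = (\<Sum>i\<in>K. \<Sum>j\<in>K - {i}. ?s i j * (D i (E j (?w i j)) a + E i (D j (?w i j)) a))"
      unfolding exp[OF D] exp[OF E] by (simp add: sum.distrib distrib_left)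
    also have "\<dots> = 0"
    proof (rule sum_antisymmetric[OF True])
      fix i j assume ij: "i \<in> K" "j \<in> K" "i \<noteq> j"
      have "?w i j = ?w j i" by (simp add: Diff_insert2[symmetric] insert_commute flip: Diff_insert)
      then show "?s i j * (D i (E j (?w i j)) a + E i (D j (?w i j)) a)
        = - (?s j i * (D j (E i (?w j i)) a + E j (D i (?w j i)) a))"
        using sgn_at_swap[OF True ij] sym[of i j "?w j i" a] by (simp add: algebra_simps)
    qed
    finally show ?thesis by (simp add: eq_neg_iff_add_eq_0)
  qed (simp add: grad_def)
qed

section \<open>Exterior derivative, wedging with df, and multiplication by functions\<close>

lemma ext_deriv_eq: "ext_deriv = grad pderiv_ps"
  by (intro ext) (simp add: ext_deriv_def grad_def shuffle_sign_single)

lemma ext_deriv_zero_form: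
  "ext_deriv (zero_form f) I = (if \<exists>i. I = {i} then pderiv_ps (THE i. I = {i}) f else (\<lambda>_. 0))"
proof
  fix a
  show "ext_deriv (zero_form f) I a = (if \<exists>i. I = {i} then pderiv_ps (THE i. I = {i}) f else (\<lambda>_. 0)) a"
  proof (cases "\<exists>i. I = {i}")
    case True
    then obtain i where "I = {i}" by blast
    moreover have "sgn_at i {i} = 1"
    proof -
      have "{x \<in> {i}. x < i} = {}" by blast
      then show ?thesis by (simp only: sgn_at_def card.empty power_0)
    qed
    ultimately show ?thesis by (simp add: ext_deriv_eq grad_def zero_form_def)
  next
    case False
    have "I - {i} \<noteq> {}" if "i \<in> I" for i using False that by blast
    then show ?thesis using False by (simp add: ext_deriv_eq grad_def zero_form_def pderiv_ps_zero)
  qed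
qed

lemma df_wedge_eq: "df_wedge f = grad (\<lambda>i. ps_mult (pderiv_ps i f))"
proof (intro ext)
  fix \<omega> :: form and K a
  show "df_wedge f \<omega> K a = grad (\<lambda>i. ps_mult (pderiv_ps i f)) \<omega> K a"
  proof (cases "finite K")
    case True
    let ?t = "\<lambda>I. shuffle_sign I (K - I) * ps_mult (ext_deriv (zero_form f) I) (\<omega> (K - I)) a"
    have "df_wedge f \<omega> K a = sum ?t (Pow K)" by (simp add: df_wedge_def wedge_def)
    also have "\<dots> = sum ?t ((\<lambda>i. {i}) ` K)"
    proof (rule sum.mono_neutral_right)
      show "\<forall>I\<in>Pow K - (\<lambda>i. {i}) ` K. ?t I = 0"
      proof
        fix I assume "I \<in> Pow K - (\<lambda>i. {i}) ` K"
        then have "\<not> (\<exists>i. I = {i})" by auto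
        then show "?t I = 0" by (simp add: ext_deriv_zero_form ps_mult_zero)
      qed
    qed (use True in auto)
    also have "\<dots> = (\<Sum>i\<in>K. ?t {i})" by (subst sum.reindex) (auto simp: inj_on_def)
    also have "\<dots> = grad (\<lambda>i. ps_mult (pderiv_ps i f)) \<omega> K a"
      by (simp add: grad_def shuffle_sign_single ext_deriv_zero_form)
    finally show ?thesis .
  qed (simp add: df_wedge_def wedge_def grad_def finite_Pow_iff)
qed

text \<open>On an infinite K the sum over \<open>Pow K\<close> is 0 by convention, so the
  coefficients of \<omega> there have to vanish as well.\<close>

lemma fun_mult_eq:
  assumes "\<And>I. infinite I \<Longrightarrow> \<omega> I = (\<lambda>_. 0)"
  shows "fun_mult f \<omega> = (\<lambda>I. ps_mult f (\<omega> I))"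
proof (intro ext)
  fix K a
  show "fun_mult f \<omega> K a = ps_mult f (\<omega> K) a"
  proof (cases "finite K")
    case True
    have "fun_mult f \<omega> K a = (\<Sum>I\<in>Pow K. shuffle_sign I (K - I) * ps_mult (zero_form f I) (\<omega> (K - I)) a)"
      by (simp add: fun_mult_def wedge_def)
    also have "\<dots> = (\<Sum>I\<in>{{}}. shuffle_sign I (K - I) * ps_mult (zero_form f I) (\<omega> (K - I)) a)"
      by (rule sum.mono_neutral_right) (use True in \<open>auto simp: zero_form_def ps_mult_zero\<close>)
    also have "\<dots> = ps_mult f (\<omega> K) a" by (simp add: zero_form_def shuffle_sign_def)
    finally show ?thesis .
  qed (simp add: fun_mult_def wedge_def finite_Pow_iff assms ps_mult_zero)
qed

lemmas lin_family_df = lin_family_ps_mult[of "\<lambda>i. pderiv_ps i f" for f]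

lemma df_wedge_df_wedge: "df_wedge f (df_wedge f \<omega>) K a = 0"
proof -
  let ?E = "\<lambda>i. ps_mult (pderiv_ps i f)"
  have "grad ?E (grad ?E \<omega>) = (\<lambda>K a. - grad ?E (grad ?E \<omega>) K a)"
    by (rule grad_anticommute) (simp_all add: lin_family_df ps_mult_left_commute)
  from fun_cong[OF fun_cong[OF this]] have "grad ?E (grad ?E \<omega>) K a = - grad ?E (grad ?E \<omega>) K a" .
  then show ?thesis by (simp add: df_wedge_eq)
qed

lemma ext_deriv_df_wedge: "ext_deriv (df_wedge f \<omega>) = (\<lambda>K a. - df_wedge f (ext_deriv \<omega>) K a)"
  unfolding ext_deriv_eq df_wedge_eq
proof (rule grad_anticommute[OF lin_family_pderiv_ps lin_family_df])
  fix i j g a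
  show "pderiv_ps i (ps_mult (pderiv_ps j f) g) a - ps_mult (pderiv_ps j f) (pderiv_ps i g) a
    = pderiv_ps j (ps_mult (pderiv_ps i f) g) a - ps_mult (pderiv_ps i f) (pderiv_ps j g) a"
    by (simp add: pderiv_ps_mult pderiv_ps_commute[of i j])
qed

lemma ext_deriv_mult:
  "ext_deriv (\<lambda>I. ps_mult f (\<omega> I)) = (\<lambda>K a. df_wedge f \<omega> K a + ps_mult f (ext_deriv \<omega> K) a)"
proof (intro ext)
  fix K a
  have "ps_mult f (grad pderiv_ps \<omega> K) a = (\<Sum>i\<in>K. sgn_at i K * ps_mult f (pderiv_ps i (\<omega> (K - {i}))) a)"
    unfolding grad_def by (rule ps_mult_lincomb)
  then show "ext_deriv (\<lambda>I. ps_mult f (\<omega> I)) K a = df_wedge f \<omega> K a + ps_mult f (ext_deriv \<omega> K) a"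
    by (simp add: ext_deriv_eq df_wedge_eq grad_def pderiv_ps_mult distrib_left sum.distrib)
qed

lemma df_wedge_mult: "df_wedge f (\<lambda>I. ps_mult g (\<omega> I)) = (\<lambda>K. ps_mult g (df_wedge f \<omega> K))"
proof (intro ext)
  fix K a
  show "df_wedge f (\<lambda>I. ps_mult g (\<omega> I)) K a = ps_mult g (df_wedge f \<omega> K) a"
    unfolding df_wedge_eq grad_def ps_mult_lincomb by (simp add: ps_mult_left_commute)
qed

subsection \<open>The Poincare lemma\<close>

text \<open>Contraction with the Euler vector field, the sum of the x_j
  \<partial>/\<partial>x_j.\<close>

definition contract :: "nat \<Rightarrow> form \<Rightarrow> form" where
  "contract n \<omega> = (\<lambda>K a. \<Sum>j\<in>{..n} - K. sgn_at j K * var_mult j (\<omega> (insert j K)) a)"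

text \<open>Cartan's formula for the Euler field. The terms that remove and reinsert the same index
  contribute a_i + 1 for i in K, from differentiating x_i times a series, and a_j for j outside K,
  from x_j times a derivative; together |a| + |K|. The terms with two different indices cancel by
  \<open>sgn_at_exchange\<close>.\<close>

lemma cartan_formula:
  assumes K: "K \<subseteq> {..n}" and supp: "\<And>a. \<omega> K a \<noteq> 0 \<Longrightarrow> Poly_Mapping.keys a \<subseteq> {..n}"
  shows "ext_deriv (contract n \<omega>) K a + contract n (ext_deriv \<omega>) K a = of_nat (mono_deg a + card K) * \<omega> K a"
proof -
  have fin: "finite K" using K finite_subset by blast
  let ?N = "{..n}"
  let ?x = "\<lambda>i j. sgn_at i K * (sgn_at j (K - {i}) * pderiv_ps i (var_mult j (\<omega> (insert j (K - {i})))) a)"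
  let ?y = "\<lambda>i j. sgn_at j K * (sgn_at i (insert j K) * var_mult j (pderiv_ps i (\<omega> (insert j K - {i}))) a)"
  have 1: "ext_deriv (contract n \<omega>) K a = (\<Sum>i\<in>K. of_nat (Poly_Mapping.lookup a i + 1) * \<omega> K a) + (\<Sum>i\<in>K. \<Sum>j\<in>?N - K. ?x i j)"
  proof -
    have "ext_deriv (contract n \<omega>) K a = (\<Sum>i\<in>K. \<Sum>j\<in>?N - (K - {i}). ?x i j)"
      unfolding ext_deriv_eq grad_def contract_def pderiv_ps_lincomb sum_distrib_left ..
    also have "\<dots> = (\<Sum>i\<in>K. of_nat (Poly_Mapping.lookup a i + 1) * \<omega> K a + (\<Sum>j\<in>?N - K. ?x i j))"
    proof (rule sum.cong[OF refl])
      fix i assume i: "i \<in> K"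
      then have "?N - (K - {i}) = insert i (?N - K)" using K by auto
      moreover have "?x i i = of_nat (Poly_Mapping.lookup a i + 1) * \<omega> K a"
        using i by (simp add: sgn_at_insert_self pderiv_ps_var_mult insert_absorb sgn_at_square flip: mult.assoc)
      ultimately show "(\<Sum>j\<in>?N - (K - {i}). ?x i j) = of_nat (Poly_Mapping.lookup a i + 1) * \<omega> K a + (\<Sum>j\<in>?N - K. ?x i j)"
        using i by (simp del: of_nat_add of_nat_Suc)
    qed
    finally show ?thesis by (simp add: sum.distrib)
  qed
  have 2: "contract n (ext_deriv \<omega>) K a = (\<Sum>j\<in>?N - K. of_nat (Poly_Mapping.lookup a j) * \<omega> K a) + (\<Sum>i\<in>K. \<Sum>j\<in>?N - K. ?y i j)"
  proof -
    have "contract n (ext_deriv \<omega>) K a = (\<Sum>j\<in>?N - K. \<Sum>i\<in>insert j K. ?y i j)"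
      unfolding ext_deriv_eq grad_def contract_def var_mult_lincomb sum_distrib_left ..
    also have "\<dots> = (\<Sum>j\<in>?N - K. of_nat (Poly_Mapping.lookup a j) * \<omega> K a + (\<Sum>i\<in>K. ?y i j))"
    proof (rule sum.cong[OF refl])
      fix j assume j: "j \<in> ?N - K"
      then have "?y j j = of_nat (Poly_Mapping.lookup a j) * \<omega> K a"
        by (simp add: sgn_at_insert_self var_mult_pderiv_ps sgn_at_square flip: mult.assoc)
      then show "(\<Sum>i\<in>insert j K. ?y i j) = of_nat (Poly_Mapping.lookup a j) * \<omega> K a + (\<Sum>i\<in>K. ?y i j)"
        using j fin by simp
    qed
    also have "\<dots> = (\<Sum>j\<in>?N - K. of_nat (Poly_Mapping.lookup a j) * \<omega> K a) + (\<Sum>j\<in>?N - K. \<Sum>i\<in>K. ?y i j)"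
      by (simp add: sum.distrib)
    also have "(\<Sum>j\<in>?N - K. \<Sum>i\<in>K. ?y i j) = (\<Sum>i\<in>K. \<Sum>j\<in>?N - K. ?y i j)" by (rule sum.swap)
    finally show ?thesis .
  qed
  have "?x i j + ?y i j = 0" if i: "i \<in> K" and j: "j \<in> ?N - K" for i j
  proof -
    have ij: "i \<noteq> j" "insert j (K - {i}) = insert j K - {i}" using i j by auto
    have "?x i j = (sgn_at i K * sgn_at j (K - {i})) * var_mult j (pderiv_ps i (\<omega> (insert j K - {i}))) a"
      by (simp add: pderiv_ps_var_mult_neq[OF ij(1)] ij(2) mult.assoc)
    also have "\<dots> = - ?y i j"
      using sgn_at_exchange[OF fin i, of j] j by (simp add: mult.assoc)
    finally show ?thesis by simp
  qed
  then have "(\<Sum>i\<in>K. \<Sum>j\<in>?N - K. ?x i j) + (\<Sum>i\<in>K. \<Sum>j\<in>?N - K. ?y i j) = 0"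
    by (simp add: sum.distrib[symmetric])
  moreover have "(\<Sum>i\<in>K. of_nat (Poly_Mapping.lookup a i + 1) * \<omega> K a) + (\<Sum>j\<in>?N - K. of_nat (Poly_Mapping.lookup a j) * \<omega> K a)
    = of_nat (mono_deg a + card K) * \<omega> K a"
  proof (cases "\<omega> K a = 0")
    case False
    then have "mono_deg a = (\<Sum>i\<in>?N. Poly_Mapping.lookup a i)"
      using supp by (intro mono_deg_eq_sum) auto
    also have "\<dots> = (\<Sum>i\<in>?N - K. Poly_Mapping.lookup a i) + (\<Sum>i\<in>K. Poly_Mapping.lookup a i)"
      by (rule sum.subset_diff[OF K]) simp
    finally have "mono_deg a + card K = (\<Sum>i\<in>K. Poly_Mapping.lookup a i + 1) + (\<Sum>i\<in>?N - K. Poly_Mapping.lookup a i)"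
      by (simp add: sum_Suc)
    then show ?thesis by (simp only: of_nat_add of_nat_sum distrib_right sum_distrib_right)
  qed simp
  ultimately show ?thesis unfolding 1 2 by (simp add: algebra_simps)
qed

section \<open>The operators on germs of forms of fixed degree\<close>

lemma Omega_iff:
  "\<omega> \<in> carrier (Omega n k) \<longleftrightarrow> (\<forall>I. \<omega> I \<in> carrier (conv_ps n)) \<and>
     (\<forall>I. \<omega> I \<noteq> (\<lambda>_. 0) \<longrightarrow> I \<subseteq> {..n} \<and> int (card I) = k)"
  by (simp add: Omega_def)

lemma Omega_infinite: "\<omega> \<in> carrier (Omega n k) \<Longrightarrow> infinite I \<Longrightarrow> \<omega> I = (\<lambda>_. 0)"
  unfolding Omega_iff by (meson finite_atMost finite_subset)

lemma pderiv_ps_outside: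
  assumes "f \<in> carrier (conv_ps n)" "n < i"
  shows "pderiv_ps i f = (\<lambda>_. 0)"
proof
  fix a
  have "i \<in> Poly_Mapping.keys (a + unit_exp i)" by (simp add: in_keys_iff lookup_add)
  then have "f (a + unit_exp i) = 0" using assms unfolding conv_ps_iff by force
  then show "pderiv_ps i f a = 0" by (simp add: pderiv_ps_def)
qed

text \<open>\<open>grad\<close> runs over every i in K, including i > n. The assumption
  \<open>out\<close> prevents such i from producing forms with differentials beyond dx_n.\<close>

lemma grad_Omega:
  assumes E: "lin_family E" "\<And>i g. g \<in> carrier (conv_ps n) \<Longrightarrow> E i g \<in> carrier (conv_ps n)"
    and out: "\<And>i g. g \<in> carrier (conv_ps n) \<Longrightarrow> n < i \<Longrightarrow> E i g = (\<lambda>_. 0)"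
    and \<omega>: "\<omega> \<in> carrier (Omega n k)"
  shows "grad E \<omega> \<in> carrier (Omega n (k + 1))"
proof -
  note w = \<omega>[unfolded Omega_iff]
  have "grad E \<omega> I \<in> carrier (conv_ps n)" for I
  proof (cases "finite I")
    case True
    then show ?thesis unfolding grad_def by (rule conv_ps_sum) (use w E(2) in blast)
  next
    case False
    then have "grad E \<omega> I = (\<lambda>_. 0)" by (simp add: grad_def)
    then show ?thesis by (simp add: conv_ps_zero)
  qed
  moreover have "I \<subseteq> {..n} \<and> int (card I) = k + 1" if nz: "grad E \<omega> I \<noteq> (\<lambda>_. 0)" for I
  proof -
    have fin: "finite I" using nz by (rule contrapos_np) (simp add: grad_def)
    obtain a where "grad E \<omega> I a \<noteq> 0" using nz by auto
    then obtain i where i: "i \<in> I" "sgn_at i I * E i (\<omega> (I - {i})) a \<noteq> 0"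
      unfolding grad_def by (rule sum.not_neutral_contains_not_neutral)
    then have Ei: "E i (\<omega> (I - {i})) \<noteq> (\<lambda>_. 0)" by auto
    have "i \<le> n" using Ei out[of "\<omega> (I - {i})" i] w by (meson not_le)
    moreover have "\<omega> (I - {i}) \<noteq> (\<lambda>_. 0)" using Ei lin_family_zero[OF E(1), of i] by auto
    then have "I - {i} \<subseteq> {..n}" "int (card (I - {i})) = k" using w by blast+
    ultimately show ?thesis using i(1) fin card_Suc_Diff1[OF fin i(1)] by auto
  qed
  ultimately show ?thesis unfolding Omega_iff by blast
qed

lemma ext_deriv_Omega: "\<omega> \<in> carrier (Omega n k) \<Longrightarrow> ext_deriv \<omega> \<in> carrier (Omega n (k + 1))"
  unfolding ext_deriv_eq
  by (rule grad_Omega) (simp_all add: lin_family_pderiv_ps conv_ps_pderiv pderiv_ps_outside)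

lemma df_wedge_Omega:
  "f \<in> carrier (conv_ps n) \<Longrightarrow> \<omega> \<in> carrier (Omega n k) \<Longrightarrow> df_wedge f \<omega> \<in> carrier (Omega n (k + 1))"
  unfolding df_wedge_eq
  by (rule grad_Omega) (simp_all add: lin_family_df conv_ps_mult conv_ps_pderiv pderiv_ps_outside ps_mult_zero)

lemma fun_mult_Omega_eq: "\<omega> \<in> carrier (Omega n k) \<Longrightarrow> fun_mult f \<omega> = (\<lambda>I. ps_mult f (\<omega> I))"
  using fun_mult_eq Omega_infinite by blast

lemma fun_mult_Omega:
  assumes "f \<in> carrier (conv_ps n)" "\<omega> \<in> carrier (Omega n k)"
  shows "fun_mult f \<omega> \<in> carrier (Omega n k)"
proof -
  have "\<omega> I \<noteq> (\<lambda>_. 0)" if "ps_mult f (\<omega> I) \<noteq> (\<lambda>_. 0)" for I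
    using that by (rule contrapos_nn) (simp add: ps_mult_zero)
  then show ?thesis
    using assms conv_ps_mult unfolding fun_mult_Omega_eq[OF assms(2)] Omega_iff by blast
qed

lemma contract_Omega:
  assumes \<omega>: "\<omega> \<in> carrier (Omega n k)"
  shows "contract n \<omega> \<in> carrier (Omega n (k - 1))"
proof -
  note w = \<omega>[unfolded Omega_iff]
  have "contract n \<omega> I \<in> carrier (conv_ps n)" for I
    unfolding contract_def by (rule conv_ps_sum) (use w conv_ps_var_mult in auto)
  moreover have "I \<subseteq> {..n} \<and> int (card I) = k - 1" if nz: "contract n \<omega> I \<noteq> (\<lambda>_. 0)" for I
  proof -
    obtain a where "contract n \<omega> I a \<noteq> 0" using nz by auto
    then obtain j where j: "j \<in> {..n} - I" "sgn_at j I * var_mult j (\<omega> (insert j I)) a \<noteq> 0"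
      unfolding contract_def by (rule sum.not_neutral_contains_not_neutral)
    then have "\<omega> (insert j I) \<noteq> (\<lambda>_. 0)" by (auto simp: var_mult_zero)
    then have *: "insert j I \<subseteq> {..n}" "int (card (insert j I)) = k" using w by blast+
    then have "finite I" using finite_subset[of "insert j I" "{..n}"] by simp
    then show ?thesis using * j(1) by simp
  qed
  ultimately show ?thesis unfolding Omega_iff by blast
qed

text \<open>The Euler vector field has Lie derivative \<open>|a| + |I|\<close> on \<open>x\<^sup>a dx\<^sub>I\<close>, and the exterior
  derivative preserves this weight.\<close>

lemma poincare_lemma:
  assumes \<omega>: "\<omega> \<in> carrier (Omega n k)" and k: "k \<ge> 1" and closed: "\<And>K a. ext_deriv \<omega> K a = 0"
  shows "\<exists>\<eta>\<in>carrier (Omega n (k - 1)). ext_deriv \<eta> = \<omega>"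
proof -
  note w = \<omega>[unfolded Omega_iff]
  \<comment> \<open>The Euler contraction of \<omega> divided by its weight. Where the weight is 0
    the quotient is 0 by convention; elsewhere the divisor is at least 1. Coefficients thus never
    grow, and convergence is inherited from the contraction.\<close>
  define \<eta> :: form where "\<eta> = (\<lambda>K a. contract n \<omega> K a / of_nat (mono_deg a + card K))"
  note c = contract_Omega[OF \<omega>, unfolded Omega_iff]
  have "\<eta> I \<in> carrier (conv_ps n)" for I
  proof (rule conv_ps_le)
    show "contract n \<omega> I \<in> carrier (conv_ps n)" using c by blast
    fix a
    have *: "x / real m \<le> x" if "0 \<le> x" for x m using that by (cases m) (auto simp: field_simps)
    show "norm (\<eta> I a) \<le> norm (contract n \<omega> I a)"
      unfolding \<eta>_def norm_divide norm_of_nat by (rule *) (rule norm_ge_zero)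
  qed
  moreover have "contract n \<omega> I \<noteq> (\<lambda>_. 0)" if "\<eta> I \<noteq> (\<lambda>_. 0)" for I
    using that by (rule contrapos_nn) (simp add: \<eta>_def)
  ultimately have \<eta>: "\<eta> \<in> carrier (Omega n (k - 1))" using c unfolding Omega_iff by blast
  have d\<eta>: "ext_deriv \<eta> \<in> carrier (Omega n k)" using ext_deriv_Omega[OF \<eta>] by simp
  have "ext_deriv \<eta> K = \<omega> K" for K
  proof (cases "K \<subseteq> {..n} \<and> int (card K) = k")
    case False
    then have "ext_deriv \<eta> K = (\<lambda>_. 0)" "\<omega> K = (\<lambda>_. 0)" using d\<eta> \<omega> unfolding Omega_iff by blast+
    then show ?thesis by simp
  next
    case True
    then have K: "K \<subseteq> {..n}" "card K \<ge> 1" "finite K" using k finite_subset by auto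
    show ?thesis
    proof
      fix a
      let ?m = "of_nat (mono_deg a + card K) :: complex"
      have "ext_deriv \<eta> K a = ext_deriv (contract n \<omega>) K a / ?m"
        unfolding ext_deriv_eq grad_def sum_divide_distrib
      proof (rule sum.cong[OF refl])
        fix i assume i: "i \<in> K"
        have "mono_deg (a + unit_exp i) + card (K - {i}) = mono_deg a + card K"
          using card_Suc_Diff1[OF K(3) i] by (simp add: mono_deg_add mono_deg_unit_exp)
        then show "sgn_at i K * pderiv_ps i (\<eta> (K - {i})) a = sgn_at i K * pderiv_ps i (contract n \<omega> (K - {i})) a / ?m"
          by (simp only: pderiv_ps_def \<eta>_def times_divide_eq_right)
      qed
      also have "ext_deriv (contract n \<omega>) K a = ?m * \<omega> K a"
      proof -
        have "ext_deriv \<omega> = (\<lambda>_ _. 0)" using closed by blast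
        then have "contract n (ext_deriv \<omega>) K a = 0" by (simp add: contract_def var_mult_zero)
        then show ?thesis using cartan_formula[OF K(1), of \<omega> a] w unfolding conv_ps_iff by simp
      qed
      also have "?m * \<omega> K a / ?m = \<omega> K a"
      proof -
        have "?m \<noteq> 0" unfolding of_nat_eq_0_iff using K(2) by simp
        then show ?thesis by simp
      qed
      finally show "ext_deriv \<eta> K a = \<omega> K a" .
    qed
  qed
  then show ?thesis using \<eta> by blast
qed

lemma ext_deriv_top:
  assumes "\<omega> \<in> carrier (Omega_top n)"
  shows "ext_deriv \<omega> K a = 0"
proof (rule ccontr)
  assume "ext_deriv \<omega> K a \<noteq> 0"
  then have "ext_deriv \<omega> K \<noteq> (\<lambda>_. 0)" by auto
  then have "K \<subseteq> {..n}" "int (card K) = int n + 1 + 1"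
    using ext_deriv_Omega[OF assms] unfolding Omega_iff by blast+
  moreover from this(1) have "card K \<le> n + 1" using card_mono[of "{..n}" K] by simp
  ultimately show False by simp
qed

text \<open>Every class of the Brieskorn lattice is thereby of the form [d\<eta>], the shape in
  which \<open>dt_inv\<close> is given.\<close>

lemma top_form_exact: "\<omega> \<in> carrier (Omega_top n) \<Longrightarrow> \<exists>\<eta>\<in>carrier (Omega n (int n)). ext_deriv \<eta> = \<omega>"
  using poincare_lemma[of \<omega> n "int n + 1"] ext_deriv_top[of \<omega> n] by simp

subsection \<open>Vector spaces of series and forms\<close>

lemma Omega_simps:
  "\<zero>\<^bsub>Omega n k\<^esub> = (\<lambda>_ _. 0)" "\<omega> \<oplus>\<^bsub>Omega n k\<^esub> \<eta> = (\<lambda>I a. \<omega> I a + \<eta> I a)"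
  "c \<odot>\<^bsub>Omega n k\<^esub> \<omega> = (\<lambda>I a. c * \<omega> I a)"
  by (simp_all add: Omega_def)

lemma conv_ps_simps:
  "\<zero>\<^bsub>conv_ps n\<^esub> = (\<lambda>_. 0)" "f \<oplus>\<^bsub>conv_ps n\<^esub> g = (\<lambda>a. f a + g a)"
  "c \<odot>\<^bsub>conv_ps n\<^esub> f = (\<lambda>a. c * f a)" "f \<otimes>\<^bsub>conv_ps n\<^esub> g = ps_mult f g"
  "\<one>\<^bsub>conv_ps n\<^esub> = (\<lambda>a. if a = 0 then 1 else 0)"
  by (simp_all add: conv_ps_def)

lemma conv_ps_vs: "cvs (conv_ps n)"
proof (rule vs_criteria[OF class_field])
  show "\<forall>v\<in>carrier (conv_ps n). \<exists>neg_v\<in>carrier (conv_ps n). v \<oplus>\<^bsub>conv_ps n\<^esub> neg_v = \<zero>\<^bsub>conv_ps n\<^esub>"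
  proof
    fix v assume "v \<in> carrier (conv_ps n)"
    from conv_ps_smult[OF this, of "-1"]
    show "\<exists>neg_v\<in>carrier (conv_ps n). v \<oplus>\<^bsub>conv_ps n\<^esub> neg_v = \<zero>\<^bsub>conv_ps n\<^esub>"
      by (rule rev_bexI) (simp add: conv_ps_simps)
  qed
qed (simp_all add: conv_ps_simps conv_ps_zero conv_ps_add conv_ps_smult algebra_simps)

lemma Omega_add:
  assumes "\<omega> \<in> carrier (Omega n k)" "\<eta> \<in> carrier (Omega n k)"
  shows "(\<lambda>I a. \<omega> I a + \<eta> I a) \<in> carrier (Omega n k)"
proof -
  have "\<omega> I \<noteq> (\<lambda>_. 0) \<or> \<eta> I \<noteq> (\<lambda>_. 0)" if "(\<lambda>a. \<omega> I a + \<eta> I a) \<noteq> (\<lambda>_. 0)" for I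
    using that by (rule contrapos_np) simp
  then show ?thesis using assms conv_ps_add unfolding Omega_iff by blast
qed

lemma Omega_smult:
  assumes "\<omega> \<in> carrier (Omega n k)"
  shows "(\<lambda>I a. c * \<omega> I a) \<in> carrier (Omega n k)"
proof -
  have "\<omega> I \<noteq> (\<lambda>_. 0)" if "(\<lambda>a. c * \<omega> I a) \<noteq> (\<lambda>_. 0)" for I
    using that by (rule contrapos_nn) simp
  then show ?thesis using assms conv_ps_smult unfolding Omega_iff by blast
qed

lemma Omega_vs: "cvs (Omega n k)"
proof (rule vs_criteria[OF class_field])
  show "\<zero>\<^bsub>Omega n k\<^esub> \<in> carrier (Omega n k)"
    by (simp add: Omega_simps) (simp add: Omega_iff conv_ps_zero)
  show "\<forall>v\<in>carrier (Omega n k). \<exists>neg_v\<in>carrier (Omega n k). v \<oplus>\<^bsub>Omega n k\<^esub> neg_v = \<zero>\<^bsub>Omega n k\<^esub>"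
  proof
    fix v assume "v \<in> carrier (Omega n k)"
    from Omega_smult[OF this, of "-1"]
    show "\<exists>neg_v\<in>carrier (Omega n k). v \<oplus>\<^bsub>Omega n k\<^esub> neg_v = \<zero>\<^bsub>Omega n k\<^esub>"
      by (rule rev_bexI) (simp add: Omega_simps)
  qed
qed (simp_all add: Omega_simps Omega_add Omega_smult algebra_simps)

lemma Omega_minus:
  assumes "\<omega> \<in> carrier (Omega n k)" "\<eta> \<in> carrier (Omega n k)"
  shows "\<omega> \<ominus>\<^bsub>Omega n k\<^esub> \<eta> = (\<lambda>I a. \<omega> I a - \<eta> I a)"
  using cvs_smult(6)[OF Omega_vs assms(2,1)] by (simp add: Omega_simps)

lemma ext_deriv_chom: "ext_deriv \<in> chom (Omega n k) (Omega n (k + 1))"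
  by (rule chomI)
    (simp_all add: Omega_simps ext_deriv_Omega ext_deriv_eq[symmetric] grad_add[OF lin_family_pderiv_ps, folded ext_deriv_eq]
      grad_smult[OF lin_family_pderiv_ps, folded ext_deriv_eq])

lemma df_wedge_chom: "f \<in> carrier (conv_ps n) \<Longrightarrow> df_wedge f \<in> chom (Omega n k) (Omega n (k + 1))"
  by (rule chomI)
    (simp_all add: Omega_simps df_wedge_Omega grad_add[OF lin_family_df, folded df_wedge_eq]
      grad_smult[OF lin_family_df, folded df_wedge_eq])

lemma fun_mult_chom:
  assumes "f \<in> carrier (conv_ps n)"
  shows "fun_mult f \<in> chom (Omega n k) (Omega n k)"
proof (rule chomI)
  show "fun_mult f v \<in> carrier (Omega n k)" if "v \<in> carrier (Omega n k)" for v
    by (rule fun_mult_Omega[OF assms that])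
  show "fun_mult f (v \<oplus>\<^bsub>Omega n k\<^esub> w) = fun_mult f v \<oplus>\<^bsub>Omega n k\<^esub> fun_mult f w"
    if "v \<in> carrier (Omega n k)" "w \<in> carrier (Omega n k)" for v w
    using Omega_add[OF that] that by (simp add: Omega_simps fun_mult_Omega_eq ps_mult_add)
  show "fun_mult f (c \<odot>\<^bsub>Omega n k\<^esub> v) = c \<odot>\<^bsub>Omega n k\<^esub> fun_mult f v"
    if "v \<in> carrier (Omega n k)" for c v
    using Omega_smult[OF that, of c] that by (simp add: Omega_simps fun_mult_Omega_eq ps_mult_smult)
qed

lemma conv_ps_cring: "cring (conv_ps n)"
proof -
  interpret vectorspace class_ring "conv_ps n" by (rule conv_ps_vs)
  have one: "\<one>\<^bsub>conv_ps n\<^esub> \<in> carrier (conv_ps n)" using conv_ps_const[of 1] by (simp add: conv_ps_simps)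
  have "Group.comm_monoid (conv_ps n)"
  proof (rule comm_monoidI)
    show "\<one>\<^bsub>conv_ps n\<^esub> \<otimes>\<^bsub>conv_ps n\<^esub> x = x" for x
      by (simp add: conv_ps_simps ps_mult_const)
    show "x \<otimes>\<^bsub>conv_ps n\<^esub> y = y \<otimes>\<^bsub>conv_ps n\<^esub> x" for x y
      unfolding conv_ps_simps by (rule ps_mult_commute)
  qed (use one in \<open>simp_all add: conv_ps_simps conv_ps_mult ps_mult_assoc\<close>)
  then show ?thesis
  proof (rule cringI[OF M.abelian_group_axioms])
    show "(x \<oplus>\<^bsub>conv_ps n\<^esub> y) \<otimes>\<^bsub>conv_ps n\<^esub> z = x \<otimes>\<^bsub>conv_ps n\<^esub> z \<oplus>\<^bsub>conv_ps n\<^esub> y \<otimes>\<^bsub>conv_ps n\<^esub> z" for x y z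
      by (simp add: conv_ps_simps ps_mult_commute[of _ z] ps_mult_add)
  qed
qed

subsection \<open>Maps between quotient spaces\<close>

lemma coset_map_chom:
  assumes "csub U M" "csub U' N" "g \<in> chom N M" "\<And>u. u \<in> U' \<Longrightarrow> g u \<in> U"
  shows "coset_map M U g \<in> chom (quot_space N U') (quot_space M U)"
proof (rule chomI)
  note N = csubD(1)[OF assms(2)]
  note c = coset_map_coset[OF assms(1-3) _ assms(4)] and g = chomD[OF assms(3)]
  show "coset_map M U g v \<in> carrier (quot_space M U)" if "v \<in> carrier (quot_space N U')" for v
    using that by (auto simp: quot_space_simps c g(1))
  show "coset_map M U g (v \<oplus>\<^bsub>quot_space N U'\<^esub> w)
      = coset_map M U g v \<oplus>\<^bsub>quot_space M U\<^esub> coset_map M U g w"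
    if "v \<in> carrier (quot_space N U')" "w \<in> carrier (quot_space N U')" for v w
    using that by (auto simp: quot_space_simps quot_add[OF assms(2)] quot_add[OF assms(1)] c g cvs_closed[OF N])
  show "coset_map M U g (k \<odot>\<^bsub>quot_space N U'\<^esub> v) = k \<odot>\<^bsub>quot_space M U\<^esub> coset_map M U g v"
    if "v \<in> carrier (quot_space N U')" for k v
    using that by (auto simp: quot_space_simps quot_smult[OF assms(2)] quot_smult[OF assms(1)] c g cvs_closed[OF N])
qed

subsection \<open>The Brieskorn lattice\<close>

context
  fixes n :: nat and f :: pseries
  assumes f: "f \<in> carrier (conv_ps n)"
begin

abbreviation "Om \<equiv> Omega_top n"
abbreviation "Bd \<equiv> brieskorn_denom n f"
abbreviation "Ud \<equiv> Omega_f_denom n f"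

lemma df_chom: "df_wedge f \<in> chom (Omega n (int n)) Om"
  using df_wedge_chom[OF f, of "int n"] by simp

lemma d_chom: "ext_deriv \<in> chom (Omega n (int n - 1)) (Omega n (int n))"
  using ext_deriv_chom[of n "int n - 1"] by simp

lemma d_top_chom: "ext_deriv \<in> chom (Omega n (int n)) Om"
  using ext_deriv_chom[of n "int n"] by simp

lemma Bd_csub: "csub Bd Om"
  using csub_image[OF Omega_vs chom_comp[OF d_chom df_chom] csub_carrier[OF Omega_vs]]
  by (simp add: brieskorn_denom_def o_def)

lemma Ud_csub: "csub Ud Om"
  unfolding Omega_f_denom_def by (rule csub_image[OF Omega_vs df_chom csub_carrier[OF Omega_vs]])

lemma Bd_le: "Bd \<subseteq> Ud"
  unfolding brieskorn_denom_def Omega_f_denom_def using chomD(1)[OF d_chom] by blast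

text \<open>From d(f\<xi>) = df \<and> \<xi> + f d\<xi> and df \<and> df = 0 one gets f df \<and>
  d\<xi> = df \<and> d(f\<xi>).\<close>

lemma fun_mult_Bd:
  assumes "u \<in> Bd" shows "fun_mult f u \<in> Bd"
proof -
  obtain \<xi> where x: "\<xi> \<in> carrier (Omega n (int n - 1))" "u = df_wedge f (ext_deriv \<xi>)"
    using assms by (auto simp: brieskorn_denom_def)
  let ?g = "\<lambda>I. ps_mult f (\<xi> I)"
  have g: "?g \<in> carrier (Omega n (int n - 1))"
    using fun_mult_Omega[OF f x(1)] by (simp add: fun_mult_Omega_eq[OF x(1)])
  have d: "ext_deriv \<xi> \<in> carrier (Omega n (int n))" "df_wedge f \<xi> \<in> carrier (Omega n (int n))"
    using chomD(1)[OF d_chom x(1)] df_wedge_Omega[OF f x(1)] by simp_all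
  have u: "u \<in> carrier Om" using x(2) chomD(1)[OF df_chom d(1)] by simp
  have "df_wedge f (ext_deriv ?g) = (\<lambda>K. ps_mult f (df_wedge f (ext_deriv \<xi>) K))"
  proof -
    have "ext_deriv ?g = (\<lambda>K a. df_wedge f \<xi> K a + (\<lambda>K. ps_mult f (ext_deriv \<xi> K)) K a)"
      by (simp add: ext_deriv_mult)
    then have "df_wedge f (ext_deriv ?g)
      = (\<lambda>K a. df_wedge f (df_wedge f \<xi>) K a + df_wedge f (\<lambda>K. ps_mult f (ext_deriv \<xi> K)) K a)"
      by (simp only: df_wedge_eq grad_add[OF lin_family_df])
    then show ?thesis by (simp add: df_wedge_df_wedge df_wedge_mult)
  qed
  then have "fun_mult f u = df_wedge f (ext_deriv ?g)"
    by (simp only: fun_mult_Omega_eq[OF u]) (simp add: x(2))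
  then show ?thesis using g by (auto simp: brieskorn_denom_def)
qed

lemma fun_mult_Ud:
  assumes "g \<in> carrier (conv_ps n)" "u \<in> Ud"
  shows "fun_mult g u \<in> Ud"
proof -
  obtain \<eta> where x: "\<eta> \<in> carrier (Omega n (int n))" "u = df_wedge f \<eta>"
    using assms(2) by (auto simp: Omega_f_denom_def)
  have "u \<in> carrier Om" using x(2) chomD(1)[OF df_chom x(1)] by simp
  then have "fun_mult g u = df_wedge f (fun_mult g \<eta>)"
    unfolding fun_mult_Omega_eq[OF x(1)] df_wedge_mult x(2) by (rule fun_mult_Omega_eq)
  then show ?thesis using fun_mult_Omega[OF assms(1) x(1)] by (auto simp: Omega_f_denom_def)
qed

lemma brieskorn_vs: "cvs (brieskorn n f)"
  unfolding brieskorn_def by (rule quot_vs[OF Bd_csub])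

lemma t_op_coset: "\<omega> \<in> carrier Om \<Longrightarrow> t_op n f (Bd +>\<^bsub>Om\<^esub> \<omega>) = Bd +>\<^bsub>Om\<^esub> fun_mult f \<omega>"
  unfolding t_op_def by (rule coset_map_coset[OF Bd_csub Bd_csub fun_mult_chom[OF f] _ fun_mult_Bd])

lemma t_op_chom: "t_op n f \<in> chom (brieskorn n f) (brieskorn n f)"
  unfolding t_op_def brieskorn_def
  by (rule coset_map_chom[OF Bd_csub Bd_csub fun_mult_chom[OF f] fun_mult_Bd])

text \<open>The Poincare lemma in degree \<open>n \<ge> 1\<close> makes \<open>\<partial>\<^sub>t\<^sup>-\<^sup>1\<close> well defined; for \<open>n = 0\<close> it is not, because
  constants are closed but not exact.\<close>

context
  assumes n: "n \<ge> 1"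
begin

lemma dt_inv_coset:
  assumes \<eta>: "\<eta> \<in> carrier (Omega n (int n))"
  shows "dt_inv n f (Bd +>\<^bsub>Om\<^esub> ext_deriv \<eta>) = Bd +>\<^bsub>Om\<^esub> df_wedge f \<eta>"
proof -
  let ?S = "{\<eta>' \<in> carrier (Omega n (int n)). ext_deriv \<eta>' \<in> Bd +>\<^bsub>Om\<^esub> ext_deriv \<eta>}"
  have d\<eta>: "ext_deriv \<eta> \<in> carrier Om" by (rule chomD(1)[OF d_top_chom \<eta>])
  have "\<eta> \<in> ?S"
    using \<eta> d\<eta> csubD(3)[OF Bd_csub] by (simp add: quot_coset_mem[OF Bd_csub] cvs_add(3)[OF Omega_vs])
  then have "?S \<noteq> {}" by blast
  then show ?thesis
    unfolding dt_inv_def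
  proof (rule SUP_eq_const)
    fix \<eta>' assume "\<eta>' \<in> ?S"
    then have \<eta>': "\<eta>' \<in> carrier (Omega n (int n))" "ext_deriv \<eta>' \<ominus>\<^bsub>Om\<^esub> ext_deriv \<eta> \<in> Bd"
      using d\<eta> by (simp_all add: quot_coset_mem[OF Bd_csub])
    have d\<eta>': "ext_deriv \<eta>' \<in> carrier Om" by (rule chomD(1)[OF d_top_chom \<eta>'(1)])
    obtain \<xi> where \<xi>: "\<xi> \<in> carrier (Omega n (int n - 1))"
      "(\<lambda>I a. ext_deriv \<eta>' I a - ext_deriv \<eta> I a) = df_wedge f (ext_deriv \<xi>)"
      using \<eta>'(2) unfolding Omega_minus[OF d\<eta>' d\<eta>] brieskorn_denom_def by blast
    have df\<xi>: "df_wedge f \<xi> \<in> carrier (Omega n (int n))" using df_wedge_Omega[OF f \<xi>(1)] by simp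
    \<comment> \<open>By the choice of \<xi>, d(\<eta>' - \<eta>) = df \<and> d\<xi>. Since d
      anticommutes with df \<and>, adding df \<and> \<xi> makes the difference closed, and df \<and>
      annihilates this correction afterwards.\<close>
    define \<theta> where "\<theta> = (\<eta>' \<ominus>\<^bsub>Omega n (int n)\<^esub> \<eta>) \<oplus>\<^bsub>Omega n (int n)\<^esub> df_wedge f \<xi>"
    have m: "\<eta>' \<ominus>\<^bsub>Omega n (int n)\<^esub> \<eta> \<in> carrier (Omega n (int n))"
      by (rule cvs_closed(3)[OF Omega_vs \<eta>'(1) \<eta>])
    have \<theta>: "\<theta> \<in> carrier (Omega n (int n))"
      unfolding \<theta>_def by (rule cvs_closed(2)[OF Omega_vs m df\<xi>])
    have "ext_deriv \<theta> = (ext_deriv \<eta>' \<ominus>\<^bsub>Om\<^esub> ext_deriv \<eta>) \<oplus>\<^bsub>Om\<^esub> ext_deriv (df_wedge f \<xi>)"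
      unfolding \<theta>_def chomD(2)[OF d_top_chom m df\<xi>]
        chom_minus[OF Omega_vs Omega_vs d_top_chom \<eta>'(1) \<eta>] ..
    also have "\<dots> = (\<lambda>K a. df_wedge f (ext_deriv \<xi>) K a + - df_wedge f (ext_deriv \<xi>) K a)"
      unfolding Omega_simps Omega_minus[OF d\<eta>' d\<eta>] \<xi>(2) ext_deriv_df_wedge ..
    finally have "ext_deriv \<theta> K a = 0" for K a by simp
    then obtain \<zeta> where \<zeta>: "\<zeta> \<in> carrier (Omega n (int n - 1))" "ext_deriv \<zeta> = \<theta>"
      using poincare_lemma[OF \<theta>] n by auto
    have "df_wedge f \<theta> = (df_wedge f \<eta>' \<ominus>\<^bsub>Om\<^esub> df_wedge f \<eta>) \<oplus>\<^bsub>Om\<^esub> df_wedge f (df_wedge f \<xi>)"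
      unfolding \<theta>_def chomD(2)[OF df_chom m df\<xi>]
        chom_minus[OF Omega_vs Omega_vs df_chom \<eta>'(1) \<eta>] ..
    also have "\<dots> = df_wedge f \<eta>' \<ominus>\<^bsub>Om\<^esub> df_wedge f \<eta>"
      unfolding Omega_simps by (simp add: df_wedge_df_wedge)
    finally have "df_wedge f \<eta>' \<ominus>\<^bsub>Om\<^esub> df_wedge f \<eta> = df_wedge f (ext_deriv \<zeta>)"
      using \<zeta>(2) by simp
    then have "df_wedge f \<eta>' \<ominus>\<^bsub>Om\<^esub> df_wedge f \<eta> \<in> Bd"
      using \<zeta>(1) by (auto simp: brieskorn_denom_def)
    then show "Bd +>\<^bsub>Om\<^esub> df_wedge f \<eta>' = Bd +>\<^bsub>Om\<^esub> df_wedge f \<eta>"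
      using quot_coset_eq_iff[OF Bd_csub chomD(1)[OF df_chom \<eta>'(1)] chomD(1)[OF df_chom \<eta>]] by blast
  qed
qed

lemma brieskorn_cases:
  assumes "A \<in> carrier (brieskorn n f)"
  obtains \<eta> where "\<eta> \<in> carrier (Omega n (int n))" "A = Bd +>\<^bsub>Om\<^esub> ext_deriv \<eta>"
  using assms top_form_exact unfolding brieskorn_def quot_space_simps by blast

lemma brieskorn_coset_simps:
  assumes "a \<in> carrier Om" "b \<in> carrier Om"
  shows "(Bd +>\<^bsub>Om\<^esub> a) \<oplus>\<^bsub>brieskorn n f\<^esub> (Bd +>\<^bsub>Om\<^esub> b) = Bd +>\<^bsub>Om\<^esub> (a \<oplus>\<^bsub>Om\<^esub> b)"
    "c \<odot>\<^bsub>brieskorn n f\<^esub> (Bd +>\<^bsub>Om\<^esub> a) = Bd +>\<^bsub>Om\<^esub> (c \<odot>\<^bsub>Om\<^esub> a)"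
    "Bd +>\<^bsub>Om\<^esub> a \<in> carrier (brieskorn n f)"
  unfolding brieskorn_def using assms
  by (simp_all add: quot_add[OF Bd_csub] quot_smult[OF Bd_csub] quot_space_simps)

lemma dt_inv_chom: "dt_inv n f \<in> chom (brieskorn n f) (brieskorn n f)"
proof (rule chomI)
  note dc = chomD[OF d_top_chom] and wc = chomD[OF df_chom]
  fix v assume "v \<in> carrier (brieskorn n f)"
  then obtain \<eta> where \<eta>: "\<eta> \<in> carrier (Omega n (int n))" "v = Bd +>\<^bsub>Om\<^esub> ext_deriv \<eta>"
    by (rule brieskorn_cases)
  show "dt_inv n f v \<in> carrier (brieskorn n f)"
    unfolding \<eta>(2) dt_inv_coset[OF \<eta>(1)] by (rule brieskorn_coset_simps(3)[OF wc(1)[OF \<eta>(1)] wc(1)[OF \<eta>(1)]])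
  show "dt_inv n f (c \<odot>\<^bsub>brieskorn n f\<^esub> v) = c \<odot>\<^bsub>brieskorn n f\<^esub> dt_inv n f v" for c
  proof -
    have s: "c \<odot>\<^bsub>Omega n (int n)\<^esub> \<eta> \<in> carrier (Omega n (int n))" by (rule cvs_closed(4)[OF Omega_vs \<eta>(1)])
    show ?thesis
      unfolding \<eta>(2) dt_inv_coset[OF \<eta>(1)]
        brieskorn_coset_simps(2)[OF dc(1)[OF \<eta>(1)] dc(1)[OF \<eta>(1)]]
        brieskorn_coset_simps(2)[OF wc(1)[OF \<eta>(1)] wc(1)[OF \<eta>(1)]]
        dc(3)[OF \<eta>(1), symmetric] wc(3)[OF \<eta>(1), symmetric] by (rule dt_inv_coset[OF s])
  qed
  fix w assume "w \<in> carrier (brieskorn n f)"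
  then obtain \<kappa> where \<kappa>: "\<kappa> \<in> carrier (Omega n (int n))" "w = Bd +>\<^bsub>Om\<^esub> ext_deriv \<kappa>"
    by (rule brieskorn_cases)
  have s: "\<eta> \<oplus>\<^bsub>Omega n (int n)\<^esub> \<kappa> \<in> carrier (Omega n (int n))" by (rule cvs_closed(2)[OF Omega_vs \<eta>(1) \<kappa>(1)])
  show "dt_inv n f (v \<oplus>\<^bsub>brieskorn n f\<^esub> w) = dt_inv n f v \<oplus>\<^bsub>brieskorn n f\<^esub> dt_inv n f w"
    unfolding \<eta>(2) \<kappa>(2) dt_inv_coset[OF \<eta>(1)] dt_inv_coset[OF \<kappa>(1)]
      brieskorn_coset_simps(1)[OF dc(1)[OF \<eta>(1)] dc(1)[OF \<kappa>(1)]]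
      brieskorn_coset_simps(1)[OF wc(1)[OF \<eta>(1)] wc(1)[OF \<kappa>(1)]]
      dc(2)[OF \<eta>(1) \<kappa>(1), symmetric] wc(2)[OF \<eta>(1) \<kappa>(1), symmetric] by (rule dt_inv_coset[OF s])
qed

text \<open>For A = [d\<eta>] the Leibniz rule says that t A + \<open>dt_inv\<close> A =
  [d(f\<eta>)]. Applying \<open>dt_inv\<close> once more gives [df \<and> f\<eta>], which is t
  applied to [df \<and> \<eta>].\<close>

lemma t_dt_inv:
  assumes "A \<in> carrier (brieskorn n f)"
  shows "t_op n f (dt_inv n f A)
    = dt_inv n f (t_op n f A) \<oplus>\<^bsub>brieskorn n f\<^esub> dt_inv n f (dt_inv n f A)"
proof -
  note dc = chomD[OF d_top_chom] and wc = chomD[OF df_chom]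
  obtain \<eta> where \<eta>: "\<eta> \<in> carrier (Omega n (int n))" "A = Bd +>\<^bsub>Om\<^esub> ext_deriv \<eta>"
    using assms by (rule brieskorn_cases)
  note d\<eta> = dc(1)[OF \<eta>(1)] and w\<eta> = wc(1)[OF \<eta>(1)]
  have f\<eta>: "fun_mult f \<eta> \<in> carrier (Omega n (int n))" by (rule fun_mult_Omega[OF f \<eta>(1)])
  have fd: "fun_mult f (ext_deriv \<eta>) \<in> carrier Om" by (rule fun_mult_Omega[OF f d\<eta>])
  have "fun_mult f (ext_deriv \<eta>) \<oplus>\<^bsub>Om\<^esub> df_wedge f \<eta> = ext_deriv (fun_mult f \<eta>)"
    unfolding fun_mult_Omega_eq[OF \<eta>(1)] fun_mult_Omega_eq[OF d\<eta>] ext_deriv_mult Omega_simps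
    by (simp add: add.commute)
  then have "t_op n f A \<oplus>\<^bsub>brieskorn n f\<^esub> dt_inv n f A = Bd +>\<^bsub>Om\<^esub> ext_deriv (fun_mult f \<eta>)"
    unfolding \<eta>(2) t_op_coset[OF d\<eta>] dt_inv_coset[OF \<eta>(1)] brieskorn_coset_simps(1)[OF fd w\<eta>] by simp
  then have "dt_inv n f (t_op n f A \<oplus>\<^bsub>brieskorn n f\<^esub> dt_inv n f A) = Bd +>\<^bsub>Om\<^esub> df_wedge f (fun_mult f \<eta>)"
    using dt_inv_coset[OF f\<eta>] by simp
  also have "df_wedge f (fun_mult f \<eta>) = fun_mult f (df_wedge f \<eta>)"
    unfolding fun_mult_Omega_eq[OF \<eta>(1)] fun_mult_Omega_eq[OF w\<eta>] by (rule df_wedge_mult)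
  also have "Bd +>\<^bsub>Om\<^esub> fun_mult f (df_wedge f \<eta>) = t_op n f (dt_inv n f A)"
    unfolding \<eta>(2) dt_inv_coset[OF \<eta>(1)] t_op_coset[OF w\<eta>] ..
  finally show ?thesis
    using chomD(2)[OF dt_inv_chom chomD(1)[OF t_op_chom assms] chomD(1)[OF dt_inv_chom assms]] by simp
qed

lemma gm_operators: "gauss_manin_operators (brieskorn n f) (dt_inv n f) (t_op n f)"
  by (intro gauss_manin_operators.intro endomorphism.intro gauss_manin_operators_axioms.intro
      brieskorn_vs dt_inv_chom t_op_chom t_dt_inv)

interpretation GM: gauss_manin_operators "brieskorn n f" "dt_inv n f" "t_op n f"
  by (rule gm_operators)

lemma gm_V_eq: "gm_V n f a = GM.V a"
proof -
  have 1: "gm_dt n f = GM.D" "gm_dt_inv n f = GM.S" "gm_t n f = GM.T"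
    by (intro ext, simp add: gm_dt_def gm_dt_inv_def gm_t_def GM.D_def GM.S_def GM.T_def)+
  have 2: "gm_eigen n f = GM.eigen"
    by (intro ext) (simp add: gm_eigen_def GM.eigen_def 1 gauss_manin_def)
  have 3: "gm_sums n f = GM.micro_sums"
    by (intro ext) (simp add: gm_sums_def GM.micro_sums_def 1 gauss_manin_def)
  show ?thesis unfolding gm_V_def GM.V_def GM.gen_def 2 3 gauss_manin_def ..
qed

lemma brieskorn_V_csub: "csub (brieskorn_V n f a) (brieskorn n f)"
  unfolding brieskorn_V_def gm_V_eq by (rule csub_vimage[OF brieskorn_vs GM.fr_chom GM.V_csub])

lemma brieskorn_V_antimono: "a \<le> b \<Longrightarrow> brieskorn_V n f b \<subseteq> brieskorn_V n f a"
  unfolding brieskorn_V_def gm_V_eq using GM.V_antimono by blast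

lemma t_op_brieskorn_V:
  assumes "A \<in> brieskorn_V n f a"
  shows "\<exists>B\<in>carrier (brieskorn n f). t_op n f A \<ominus>\<^bsub>brieskorn n f\<^esub> dt_inv n f B \<in> brieskorn_V n f (a + 1)"
proof -
  have A: "A \<in> carrier (brieskorn n f)" "gm_frac n f A 0 \<in> GM.V a"
    using assms by (simp_all add: brieskorn_V_def gm_V_eq)
  obtain B where B: "B \<in> carrier (brieskorn n f)"
    "gm_frac n f (t_op n f A \<ominus>\<^bsub>brieskorn n f\<^esub> dt_inv n f B) 0 \<in> GM.V (a + 1)"
    using GM.t_V[OF A] by blast
  have "t_op n f A \<ominus>\<^bsub>brieskorn n f\<^esub> dt_inv n f B \<in> carrier (brieskorn n f)"
    by (intro cvs_closed(3)[OF brieskorn_vs] chomD(1)[OF t_op_chom A(1)] chomD(1)[OF dt_inv_chom B(1)])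
  then show ?thesis using B by (auto simp: brieskorn_V_def gm_V_eq)
qed

end

subsection \<open>The filtered Jacobian module\<close>

text \<open>\<open>Pr\<close> is the projection of the Brieskorn lattice onto
  \<open>Omega_f\<close>, and \<open>Ph\<close> is multiplication by f on
  \<open>Omega_f\<close>.\<close>

abbreviation "Pr \<equiv> coset_map Om Ud (\<lambda>\<omega>. \<omega>)"
abbreviation "Ph \<equiv> coset_map Om Ud (fun_mult f)"

lemma id_chom: "(\<lambda>\<omega>. \<omega>) \<in> chom N N"
  by (rule chomI) auto

lemma Pr_coset: "\<omega> \<in> carrier Om \<Longrightarrow> Pr (Bd +>\<^bsub>Om\<^esub> \<omega>) = Ud +>\<^bsub>Om\<^esub> \<omega>"
  by (rule coset_map_coset[OF Ud_csub Bd_csub id_chom]) (use Bd_le in auto)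

lemma Pr_chom: "Pr \<in> chom (brieskorn n f) (Omega_f n f)"
  unfolding brieskorn_def Omega_f_def
  by (rule coset_map_chom[OF Ud_csub Bd_csub id_chom]) (use Bd_le in auto)

lemma Ph_coset: "\<omega> \<in> carrier Om \<Longrightarrow> Ph (Ud +>\<^bsub>Om\<^esub> \<omega>) = Ud +>\<^bsub>Om\<^esub> fun_mult f \<omega>"
  by (rule coset_map_coset[OF Ud_csub Ud_csub fun_mult_chom[OF f] _ fun_mult_Ud[OF f]])

lemma Ph_chom: "Ph \<in> chom (Omega_f n f) (Omega_f n f)"
  unfolding Omega_f_def
  by (rule coset_map_chom[OF Ud_csub Ud_csub fun_mult_chom[OF f] fun_mult_Ud[OF f]])

lemma Omega_f_vs: "cvs (Omega_f n f)"
  unfolding Omega_f_def by (rule quot_vs[OF Ud_csub])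

text \<open>\<open>Pr\<close> turns t into multiplication by f and kills the image of
  \<open>dt_inv\<close>, whose classes are represented by df \<and> \<eta>. The correction term of
  \<open>t_op_brieskorn_V\<close> therefore disappears in \<open>Omega_f\<close>.\<close>

lemma Ph_shift:
  assumes n: "n \<ge> 1"
  shows "Ph ` Omega_f_V n f a \<subseteq> Omega_f_V n f (a + 1)"
proof
  fix y assume "y \<in> Ph ` Omega_f_V n f a"
  then obtain A where A: "A \<in> brieskorn_V n f a" "y = Ph (Pr A)"
    by (auto simp: Omega_f_V_def)
  have AM: "A \<in> carrier (brieskorn n f)" using A(1) by (simp add: brieskorn_V_def)
  obtain \<omega> where \<omega>: "\<omega> \<in> carrier Om" "A = Bd +>\<^bsub>Om\<^esub> \<omega>"
    using AM by (auto simp: brieskorn_def quot_space_simps)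
  obtain B where B: "B \<in> carrier (brieskorn n f)"
    "t_op n f A \<ominus>\<^bsub>brieskorn n f\<^esub> dt_inv n f B \<in> brieskorn_V n f (a + 1)"
    using t_op_brieskorn_V[OF n A(1)] by blast
  obtain \<eta> where \<eta>: "\<eta> \<in> carrier (Omega n (int n))" "B = Bd +>\<^bsub>Om\<^esub> ext_deriv \<eta>"
    using B(1) by (rule brieskorn_cases[OF n])
  have fw: "fun_mult f \<omega> \<in> carrier Om" by (rule fun_mult_Omega[OF f \<omega>(1)])
  have w\<eta>: "df_wedge f \<eta> \<in> carrier Om" by (rule chomD(1)[OF df_chom \<eta>(1)])
  have "Pr (dt_inv n f B) = Ud +>\<^bsub>Om\<^esub> df_wedge f \<eta>"
    unfolding \<eta>(2) dt_inv_coset[OF n \<eta>(1)] by (rule Pr_coset[OF w\<eta>])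
  also have "\<dots> = \<zero>\<^bsub>Omega_f n f\<^esub>"
    unfolding Omega_f_def quot_proj_eq_zero_iff[OF Ud_csub w\<eta>] using \<eta>(1) by (simp add: Omega_f_denom_def)
  finally have 0: "Pr (dt_inv n f B) = \<zero>\<^bsub>Omega_f n f\<^esub>" .
  have "Pr (t_op n f A) = Ud +>\<^bsub>Om\<^esub> fun_mult f \<omega>"
    unfolding \<omega>(2) t_op_coset[OF \<omega>(1)] by (rule Pr_coset[OF fw])
  also have "\<dots> = y"
    unfolding A(2) \<omega>(2) Pr_coset[OF \<omega>(1)] Ph_coset[OF \<omega>(1)] ..
  finally have y: "Pr (t_op n f A) = y" .
  have yW: "y \<in> carrier (Omega_f n f)"
    unfolding y[symmetric] by (rule chomD(1)[OF Pr_chom chomD(1)[OF t_op_chom AM]])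
  have "Pr (t_op n f A \<ominus>\<^bsub>brieskorn n f\<^esub> dt_inv n f B) = y \<ominus>\<^bsub>Omega_f n f\<^esub> \<zero>\<^bsub>Omega_f n f\<^esub>"
    unfolding chom_minus[OF brieskorn_vs Omega_f_vs Pr_chom chomD(1)[OF t_op_chom AM] chomD(1)[OF dt_inv_chom[OF n] B(1)]]
      0 y ..
  also have "\<dots> = y"
    using yW cvs_closed(1)[OF Omega_f_vs]
    by (simp add: cvs_smult(6)[OF Omega_f_vs] cvs_smult_zero[OF Omega_f_vs] cvs_add(1)[OF Omega_f_vs])
  finally show "y \<in> Omega_f_V n f (a + 1)" unfolding Omega_f_V_def using B(2) by (metis imageI)
qed

lemma Omega_f_filtered:
  assumes "n \<ge> 1" "vectorspace.fin_dim (class_ring :: complex ring) (Omega_f n f)"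
  shows "filtered_space (Omega_f n f) (Omega_f_V n f)"
proof (rule filtered_space.intro[OF assms(2)])
  show "csub (Omega_f_V n f a) (Omega_f n f)" for a
    unfolding Omega_f_V_def by (rule csub_image[OF Omega_f_vs Pr_chom brieskorn_V_csub[OF assms(1)]])
  show "Omega_f_V n f b \<subseteq> Omega_f_V n f a" if "a \<le> b" for a b
    unfolding Omega_f_V_def by (rule image_mono[OF brieskorn_V_antimono[OF assms(1) that]])
qed

subsection \<open>The Milnor number\<close>

definition top_form :: "pseries \<Rightarrow> form" where
  "top_form g = (\<lambda>I. if I = {..n} then g else (\<lambda>_. 0))"

abbreviation "Jac \<equiv> Idl\<^bsub>conv_ps n\<^esub> ((\<lambda>i. pderiv_ps i f) ` {..n})"

lemma top_form_chom: "top_form \<in> chom (conv_ps n) Om"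
proof (rule chomI)
  show "top_form v \<in> carrier Om" if "v \<in> carrier (conv_ps n)" for v
    using that by (auto simp: Omega_iff top_form_def conv_ps_zero split: if_splits)
qed (auto simp: top_form_def Omega_simps conv_ps_simps fun_eq_iff)

lemma top_form_surj: "\<omega> \<in> carrier Om \<Longrightarrow> \<omega> = top_form (\<omega> {..n})"
proof
  fix I assume \<omega>: "\<omega> \<in> carrier Om"
  show "\<omega> I = top_form (\<omega> {..n}) I"
  proof (cases "\<omega> I = (\<lambda>_. 0)")
    case False
    then have "I \<subseteq> {..n}" "int (card I) = int n + 1" using \<omega> unfolding Omega_iff by blast+
    then have "I = {..n}" by (intro card_subset_eq) auto
    then show ?thesis by (simp add: top_form_def)
  qed (auto simp: top_form_def)
qed

lemma top_form_mult: "g \<in> carrier (conv_ps n) \<Longrightarrow> top_form (ps_mult h g) = fun_mult h (top_form g)"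
  using fun_mult_Omega_eq[OF chomD(1)[OF top_form_chom]] by (auto simp: top_form_def ps_mult_zero)

lemma Jac_gens: "(\<lambda>i. pderiv_ps i f) ` {..n} \<subseteq> carrier (conv_ps n)"
  using conv_ps_pderiv[OF f] by auto

text \<open>Scalars act as constant series, so closure under ring multiplication includes closure
  under scalars.\<close>

lemma ideal_csub:
  assumes "ideal I (conv_ps n)" shows "csub I (conv_ps n)"
proof (rule csubI[OF conv_ps_vs])
  interpret ideal I "conv_ps n" by (rule assms)
  show "I \<subseteq> carrier (conv_ps n)" by (rule a_subset)
  show "\<zero>\<^bsub>conv_ps n\<^esub> \<in> I" by (rule additive_subgroup.zero_closed[OF is_additive_subgroup])
  show "v \<oplus>\<^bsub>conv_ps n\<^esub> w \<in> I" if "v \<in> I" "w \<in> I" for v w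
    using that by (rule additive_subgroup.a_closed[OF is_additive_subgroup])
  show "c \<odot>\<^bsub>conv_ps n\<^esub> v \<in> I" if "v \<in> I" for c v
    using I_l_closed[OF that conv_ps_const[of c]] by (simp add: conv_ps_simps ps_mult_const)
qed

lemma pderiv_top_form_Ud:
  assumes i: "i \<le> n"
  shows "top_form (pderiv_ps i f) \<in> Ud"
proof -
  let ?K = "{..n}"
  \<comment> \<open>Up to sign, the product of all dx_j except dx_i. The sign is the one that arises
    when dx_i is wedged back in, so the two multiply to 1.\<close>
  define \<eta> :: form where "\<eta> = (\<lambda>I. if I = ?K - {i} then (\<lambda>a. if a = 0 then sgn_at i ?K else 0) else (\<lambda>_. 0))"
  have "int (card (?K - {i})) = int n" using i by simp
  then have \<eta>: "\<eta> \<in> carrier (Omega n (int n))"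
    using conv_ps_const conv_ps_zero by (auto simp: Omega_iff \<eta>_def)
  have "df_wedge f \<eta> ?K a = pderiv_ps i f a" for a
  proof -
    let ?t = "\<lambda>j. sgn_at j ?K * ps_mult (pderiv_ps j f) (\<eta> (?K - {j})) a"
    have "df_wedge f \<eta> ?K a = sum ?t ?K" by (simp add: df_wedge_eq grad_def)
    also have "\<dots> = sum ?t {i}"
    proof (rule sum.mono_neutral_right)
      show "\<forall>j\<in>?K - {i}. ?t j = 0"
      proof
        fix j assume j: "j \<in> ?K - {i}"
        then have "?K - {j} \<noteq> ?K - {i}" by blast
        then show "?t j = 0" by (simp add: \<eta>_def ps_mult_zero)
      qed
    qed (use i in auto)
    also have "\<dots> = sgn_at i ?K * sgn_at i ?K * pderiv_ps i f a"
      by (simp add: \<eta>_def ps_mult_commute[of "pderiv_ps i f"] ps_mult_const)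
    finally show ?thesis by (simp add: sgn_at_square)
  qed
  then have "df_wedge f \<eta> ?K = pderiv_ps i f" by blast
  then have "df_wedge f \<eta> = top_form (pderiv_ps i f)"
    using top_form_surj[OF chomD(1)[OF df_chom \<eta>]] by simp
  then show ?thesis unfolding Omega_f_denom_def using \<eta> by (metis imageI)
qed

text \<open>The preimage of df \<and> \<Omega>^n under \<open>top_form\<close> is an ideal and
  contains the partial derivatives. This inclusion makes the map from the Jacobian algebra to
  \<open>Omega_f\<close> well defined; it is onto, which gives the upper bound on the
  dimension.\<close>

lemma top_form_Jac:
  assumes "g \<in> Jac" shows "top_form g \<in> Ud"
proof -
  interpret C: cring "conv_ps n" by (rule conv_ps_cring)
  let ?I = "{g \<in> carrier (conv_ps n). top_form g \<in> Ud}"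
  have I: "csub ?I (conv_ps n)" by (rule csub_vimage[OF conv_ps_vs top_form_chom Ud_csub])
  have mult: "h \<otimes>\<^bsub>conv_ps n\<^esub> g \<in> ?I" if "g \<in> ?I" "h \<in> carrier (conv_ps n)" for g h
    using that conv_ps_mult by (simp add: conv_ps_simps top_form_mult fun_mult_Ud)
  have "ideal ?I (conv_ps n)"
  proof (rule idealI[OF C.ring_axioms])
    show "subgroup ?I (add_monoid (conv_ps n))"
      using csub_abelian_subgroup[OF I] by (simp add: abelian_subgroup_def additive_subgroup_def)
    show "x \<otimes>\<^bsub>conv_ps n\<^esub> a \<in> ?I" if "a \<in> ?I" "x \<in> carrier (conv_ps n)" for a x
      using that by (rule mult)
    show "a \<otimes>\<^bsub>conv_ps n\<^esub> x \<in> ?I" if "a \<in> ?I" "x \<in> carrier (conv_ps n)" for a x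
      using mult[OF that] C.m_comm that by simp
  qed
  moreover have "(\<lambda>i. pderiv_ps i f) ` {..n} \<subseteq> ?I"
    using Jac_gens pderiv_top_form_Ud by auto
  ultimately show ?thesis using C.genideal_minimal[of ?I] assms by blast
qed

lemma Jac_csub: "csub Jac (conv_ps n)"
proof -
  interpret C: cring "conv_ps n" by (rule conv_ps_cring)
  show ?thesis by (rule ideal_csub[OF C.genideal_ideal[OF Jac_gens]])
qed

text \<open>\<open>cdim\<close> is 0 for infinite dimension, so a nonzero Milnor number certifies
  that the Jacobian algebra is finite-dimensional. Its quotient \<open>Omega_f\<close> is then
  finite-dimensional too, of dimension at most \<mu>.\<close>

lemma Omega_f_dim:
  assumes "milnor_number n f \<noteq> 0"
  shows "vectorspace.fin_dim (class_ring :: complex ring) (Omega_f n f)"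
    and "cdim (Omega_f n f) \<le> milnor_number n f"
proof -
  let ?Q = "quot_space (conv_ps n) Jac" and ?G = "coset_map Om Ud top_form"
  have fd: "vectorspace.fin_dim (class_ring :: complex ring) ?Q"
    using assms unfolding milnor_number_def cdim_def by (auto split: if_splits)
  have G: "?G \<in> chom ?Q (Omega_f n f)"
    unfolding Omega_f_def by (rule coset_map_chom[OF Ud_csub Jac_csub top_form_chom top_form_Jac])
  have Gc: "?G (Jac +>\<^bsub>conv_ps n\<^esub> g) = Ud +>\<^bsub>Om\<^esub> top_form g" if "g \<in> carrier (conv_ps n)" for g
    by (rule coset_map_coset[OF Ud_csub Jac_csub top_form_chom that top_form_Jac])
  have surj: "?G ` carrier ?Q = carrier (Omega_f n f)"
  proof
    show "?G ` carrier ?Q \<subseteq> carrier (Omega_f n f)" using chomD(1)[OF G] by blast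
    show "carrier (Omega_f n f) \<subseteq> ?G ` carrier ?Q"
    proof
      fix y assume "y \<in> carrier (Omega_f n f)"
      then obtain \<omega> where \<omega>: "\<omega> \<in> carrier Om" "y = Ud +>\<^bsub>Om\<^esub> \<omega>"
        by (auto simp: Omega_f_def quot_space_simps)
      have g: "\<omega> {..n} \<in> carrier (conv_ps n)" using \<omega>(1) unfolding Omega_iff by blast
      have "y = ?G (Jac +>\<^bsub>conv_ps n\<^esub> \<omega> {..n})"
        unfolding Gc[OF g] \<omega>(2) using top_form_surj[OF \<omega>(1)] by simp
      then show "y \<in> ?G ` carrier ?Q" using g by (auto simp: quot_space_simps)
    qed
  qed
  have Qvs: "cvs ?Q" by (rule quot_vs[OF Jac_csub])
  note r = rank_nullity_csub[OF Omega_f_vs G csub_carrier[OF Qvs] fd, unfolded surj]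
  show "vectorspace.fin_dim (class_ring :: complex ring) (Omega_f n f)" using r(2) by simp
  show "cdim (Omega_f n f) \<le> milnor_number n f" using r(1) by (simp add: milnor_number_def)
qed

lemma size_missing_spectrum_le:
  assumes "n \<ge> 1" "milnor_number n f \<noteq> 0" "is_spectrum n f S" "is_tjurina_spectrum n f T"
  shows "size {#x \<in># S - T. x < b + 1#} \<le> size {#x \<in># S. x < b#}"
proof -
  interpret F: filtered_space "Omega_f n f" "Omega_f_V n f"
    by (rule Omega_f_filtered[OF assms(1) Omega_f_dim(1)[OF assms(2)]])
  show ?thesis
  proof (rule F.size_diff_spectra_le[OF Ph_chom Ph_shift[OF assms(1)]])
    show "count S a = gr_dim (Omega_f n f) (Omega_f_V n f) a" for a
      using assms(3) by (simp add: is_spectrum_def)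
    show "cdim (Omega_f n f) \<le> size S"
      using Omega_f_dim(2)[OF assms(2)] assms(3) by (simp add: is_spectrum_def)
    have "Omega_T_V n f = (\<lambda>a. (\<lambda>v. (Ph ` carrier (Omega_f n f)) +>\<^bsub>Omega_f n f\<^esub> v) ` Omega_f_V n f a)"
      by (rule ext) (simp add: Omega_T_V_def f_Omega_f_def)
    then show "count T a = gr_dim (quot_space (Omega_f n f) (Ph ` carrier (Omega_f n f)))
        (\<lambda>a. (\<lambda>v. (Ph ` carrier (Omega_f n f)) +>\<^bsub>Omega_f n f\<^esub> v) ` Omega_f_V n f a) a" for a
      using assms(4) by (simp add: is_tjurina_spectrum_def Omega_T_def f_Omega_f_def)
  qed
qed

end

subsection \<open>One variable\<close>

text \<open>The passage to \<open>fps\<close> gives access to inverses of units that keep a positive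
  radius of convergence.\<close>

definition ps_of_fps :: "complex fps \<Rightarrow> pseries" where
  "ps_of_fps h = (\<lambda>a. if Poly_Mapping.keys a \<subseteq> {0} then fps_nth h (Poly_Mapping.lookup a 0) else 0)"

lemma keys_subset_0_iff: "Poly_Mapping.keys a \<subseteq> {0::nat} \<longleftrightarrow> a = Poly_Mapping.single 0 (Poly_Mapping.lookup a 0)"
proof
  assume *: "Poly_Mapping.keys a \<subseteq> {0}"
  show "a = Poly_Mapping.single 0 (Poly_Mapping.lookup a 0)"
  proof (rule poly_mapping_eqI)
    fix k show "Poly_Mapping.lookup a k = Poly_Mapping.lookup (Poly_Mapping.single 0 (Poly_Mapping.lookup a 0)) k"
      using * by (cases "k = 0") (auto simp: lookup_single when_def in_keys_iff)
  qed
next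
  assume "a = Poly_Mapping.single 0 (Poly_Mapping.lookup a 0)"
  then show "Poly_Mapping.keys a \<subseteq> {0}" by (metis keys_single empty_subsetI order_refl)
qed

lemma mono_deg_keys_0: "Poly_Mapping.keys a \<subseteq> {0} \<Longrightarrow> mono_deg a = Poly_Mapping.lookup a 0"
  by (subst mono_deg_eq_sum[of "{0}"]) auto

lemma ps_of_fps_conv:
  assumes "fps_conv_radius h > 0"
  shows "ps_of_fps h \<in> carrier (conv_ps 0)"
proof -
  obtain r :: real where r: "0 < ereal r" "ereal r < fps_conv_radius h"
    using ereal_dense2[OF assms] by (auto simp: zero_ereal_def)
  have s: "summable (\<lambda>m. norm (fps_nth h m * of_real r ^ m))"
    using r by (intro abs_summable_in_conv_radius) (simp add: fps_conv_radius_def)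
  have "bounded_at r (ps_of_fps h) (suminf (\<lambda>m. norm (fps_nth h m * of_real r ^ m)))"
    unfolding bounded_at_def
  proof (intro allI impI)
    fix F :: "(nat \<Rightarrow>\<^sub>0 nat) set" assume F: "finite F"
    let ?G = "{a \<in> F. Poly_Mapping.keys a \<subseteq> {0}}" and ?t = "\<lambda>m. norm (fps_nth h m * of_real r ^ m)"
    have inj: "inj_on (\<lambda>a. Poly_Mapping.lookup a 0) ?G"
      by (rule inj_onI) (metis (mono_tags, lifting) keys_subset_0_iff mem_Collect_eq)
    have "(\<Sum>a\<in>F. norm (ps_of_fps h a) * r ^ mono_deg a) = (\<Sum>a\<in>?G. norm (ps_of_fps h a) * r ^ mono_deg a)"
      by (rule sum.mono_neutral_right) (use F in \<open>auto simp: ps_of_fps_def\<close>)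
    also have "\<dots> = (\<Sum>a\<in>?G. ?t (Poly_Mapping.lookup a 0))"
      by (rule sum.cong) (use r in \<open>auto simp: ps_of_fps_def mono_deg_keys_0 norm_mult norm_power\<close>)
    also have "\<dots> = sum ?t ((\<lambda>a. Poly_Mapping.lookup a 0) ` ?G)"
      by (simp add: sum.reindex[OF inj])
    also have "\<dots> \<le> suminf ?t" by (rule sum_le_suminf[OF s]) (use F in auto)
    finally show "(\<Sum>a\<in>F. norm (ps_of_fps h a) * r ^ mono_deg a) \<le> suminf ?t" .
  qed
  moreover have "r > 0" using r(1) by simp
  ultimately show ?thesis unfolding conv_ps_iff by (auto simp: ps_of_fps_def split: if_splits)
qed

lemma conv_ps_0_fps:
  assumes "f \<in> carrier (conv_ps 0)"
  obtains F where "fps_conv_radius F > 0" "f = ps_of_fps F"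
proof
  define F where "F = Abs_fps (\<lambda>m. f (Poly_Mapping.single 0 m))"
  obtain r B where r: "r > 0" "bounded_at r f B" using assms unfolding conv_ps_iff by blast
  show "f = ps_of_fps F"
  proof
    fix a
    show "f a = ps_of_fps F a"
    proof (cases "Poly_Mapping.keys a \<subseteq> {0}")
      case True
      then show ?thesis using keys_subset_0_iff[of a] by (simp add: ps_of_fps_def F_def)
    next
      case False
      then have "f a = 0" using assms unfolding conv_ps_iff by auto
      then show ?thesis using False by (simp add: ps_of_fps_def)
    qed
  qed
  have "summable (\<lambda>m. norm (fps_nth F m * of_real r ^ m))"
  proof (rule bounded_imp_summable)
    show "0 \<le> norm (fps_nth F m * of_real r ^ m)" for m by simp
    fix m :: nat
    have inj: "inj_on (Poly_Mapping.single (0::nat)) {..m}"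
      by (rule inj_onI) (metis lookup_single_eq)
    have "(\<Sum>k\<le>m. norm (fps_nth F k * of_real r ^ k)) = (\<Sum>a\<in>Poly_Mapping.single 0 ` {..m}. norm (f a) * r ^ mono_deg a)"
      unfolding sum.reindex[OF inj] using r(1)
      by (intro sum.cong) (auto simp: F_def norm_mult norm_power mono_deg_keys_0)
    also have "\<dots> \<le> B" using r(2) unfolding bounded_at_def by simp
    finally show "(\<Sum>k\<le>m. norm (fps_nth F k * of_real r ^ k)) \<le> B" .
  qed
  then have "summable (\<lambda>m. fps_nth F m * of_real r ^ m)" by (rule summable_norm_cancel)
  then have "ereal (norm (of_real r :: complex)) \<le> fps_conv_radius F"
    unfolding fps_conv_radius_def by (rule conv_radius_geI)
  then show "fps_conv_radius F > 0" using r(1) by (auto intro: less_le_trans[rotated] simp: zero_ereal_def)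
qed

lemma ps_of_fps_mult: "ps_mult (ps_of_fps g) (ps_of_fps h) = ps_of_fps (g * h)"
proof
  fix c
  show "ps_mult (ps_of_fps g) (ps_of_fps h) c = ps_of_fps (g * h) c"
  proof (cases "Poly_Mapping.keys c \<subseteq> {0}")
    case False
    have 0: "ps_of_fps g (fst x) * ps_of_fps h (snd x) = 0" if x: "x \<in> decomps c" for x
    proof -
      have "Poly_Mapping.keys c \<subseteq> Poly_Mapping.keys (fst x) \<union> Poly_Mapping.keys (snd x)"
        using x keys_add[of "fst x" "snd x"] by auto
      then show ?thesis using False by (auto simp: ps_of_fps_def)
    qed
    have "ps_mult (ps_of_fps g) (ps_of_fps h) c = 0"
      unfolding ps_mult_sum by (rule sum.neutral) (use 0 in blast)
    then show ?thesis using False by (simp add: ps_of_fps_def[of "g * h"])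
  next
    case True
    let ?m = "Poly_Mapping.lookup c 0" and ?e = "Poly_Mapping.single (0::nat)"
    have c: "c = ?e ?m" using True keys_subset_0_iff by blast
    have "ps_mult (ps_of_fps g) (ps_of_fps h) c = (\<Sum>i=0..?m. fps_nth g i * fps_nth h (?m - i))"
      unfolding ps_mult_sum
    proof (rule sum.reindex_bij_witness[of _ "\<lambda>i. (?e i, ?e (?m - i))" "\<lambda>x. Poly_Mapping.lookup (fst x) 0"])
      fix x assume "x \<in> decomps c"
      then have x: "fst x + snd x = c" by auto
      have k: "Poly_Mapping.keys (fst x) \<subseteq> {0}" "Poly_Mapping.keys (snd x) \<subseteq> {0}"
        using True unfolding x[symmetric] by (auto simp: in_keys_iff lookup_add subset_iff)
      have m: "?m = Poly_Mapping.lookup (fst x) 0 + Poly_Mapping.lookup (snd x) 0"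
        unfolding x[symmetric] by (simp add: lookup_add)
      show "(?e (Poly_Mapping.lookup (fst x) 0), ?e (?m - Poly_Mapping.lookup (fst x) 0)) = x"
        using k m unfolding keys_subset_0_iff by (simp add: prod_eq_iff)
      show "Poly_Mapping.lookup (fst x) 0 \<in> {0..?m}" using m by simp
      show "fps_nth g (Poly_Mapping.lookup (fst x) 0) * fps_nth h (?m - Poly_Mapping.lookup (fst x) 0)
        = ps_of_fps g (fst x) * ps_of_fps h (snd x)"
        using k m by (simp add: ps_of_fps_def)
    next
      fix i assume i: "i \<in> {0..?m}"
      then have "?e i + ?e (?m - i) = c" by (subst c) (simp flip: single_add)
      then show "(?e i, ?e (?m - i)) \<in> decomps c" by simp
      show "Poly_Mapping.lookup (fst (?e i, ?e (?m - i))) 0 = i" by simp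
    qed
    then show ?thesis using True by (simp add: ps_of_fps_def fps_mult_nth)
  qed
qed

lemma pderiv_ps_of_fps: "pderiv_ps 0 (ps_of_fps h) = ps_of_fps (fps_deriv h)"
proof
  fix a
  have "Poly_Mapping.keys (a + unit_exp 0) \<subseteq> {0} \<longleftrightarrow> Poly_Mapping.keys a \<subseteq> {0}"
    by (auto simp: in_keys_iff lookup_add lookup_unit_exp subset_iff split: if_splits)
  then show "pderiv_ps 0 (ps_of_fps h) a = ps_of_fps (fps_deriv h) a"
    by (simp add: pderiv_ps_def ps_of_fps_def lookup_add)
qed

text \<open>If F = x^N H has order N \<ge> 1, then F' = x^(N-1) P, where P(0) is N times the leading
  coefficient and so nonzero. Hence F = (x H / P) F', and dividing by the unit P preserves
  convergence.\<close>

lemma fps_eq_mult_deriv: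
  fixes F :: "complex fps"
  assumes "fps_nth F 0 = 0" "fps_conv_radius F > 0"
  obtains G where "fps_conv_radius G > 0" "F = G * fps_deriv F"
proof (cases "F = 0")
  case True
  then show ?thesis using that[of 0] by (simp add: fps_conv_radius_def)
next
  case False
  define N where "N = subdegree F"
  have N: "N \<ge> 1" "fps_nth F N \<noteq> 0"
    using assms(1) False nth_subdegree_nonzero[OF False] unfolding N_def by (metis less_one not_le, blast)
  define P where "P = fps_shift (N - 1) (fps_deriv F)"
  have dN: "fps_nth (fps_deriv F) (N - 1) \<noteq> 0" using N by simp
  then have "fps_deriv F \<noteq> 0" by (metis fps_zero_nth)
  then have "N - 1 \<le> subdegree (fps_deriv F)"
  proof (rule subdegree_geI)
    fix i assume "i < N - 1"
    then have "fps_nth F (i + 1) = 0" unfolding N_def by (intro nth_less_subdegree_zero) simp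
    then show "fps_nth (fps_deriv F) i = 0" by simp
  qed
  then have P: "P * fps_X ^ (N - 1) = fps_deriv F" unfolding P_def by (rule fps_shift_times_fps_X_power)
  have P0: "fps_nth P 0 \<noteq> 0" using dN by (simp add: P_def)
  have H: "fps_shift N F * fps_X ^ N = F" unfolding N_def by (rule fps_shift_times_fps_X_power) simp
  have "fps_conv_radius P > 0"
    unfolding P_def fps_conv_radius_shift using fps_conv_radius_deriv[of F] assms(2) by (rule less_le_trans[rotated])
  then have iP: "fps_conv_radius (inverse P) > 0" by (rule fps_conv_radius_inverse_pos[OF P0])
  define G where "G = fps_shift N F * inverse P * fps_X"
  have "fps_conv_radius (fps_shift N F * inverse P) > 0"
    by (rule less_le_trans[OF _ fps_conv_radius_mult]) (use iP assms(2) in simp)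
  then have "fps_conv_radius G > 0"
    unfolding G_def by (intro less_le_trans[OF _ fps_conv_radius_mult]) simp
  moreover have "G * fps_deriv F = F"
  proof -
    have "inverse P * P = 1" using P0 by (rule inverse_mult_eq_1)
    have "G * fps_deriv F = fps_shift N F * (inverse P * P) * (fps_X * fps_X ^ (N - 1))"
      unfolding G_def P[symmetric] by (simp only: mult_ac)
    also have "\<dots> = fps_shift N F * fps_X ^ N"
      using N(1) \<open>inverse P * P = 1\<close> by (simp flip: power_Suc)
    finally show ?thesis using H by simp
  qed
  ultimately show ?thesis using that by metis
qed

lemma ps_eval_zero: "ps_eval f (\<lambda>_. 0) = f 0"
proof -
  have "(\<Prod>i\<in>Poly_Mapping.keys a. (0::complex) ^ Poly_Mapping.lookup a i) = (if a = 0 then 1 else 0)" for a :: "nat \<Rightarrow>\<^sub>0 nat"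
  proof (cases "a = 0")
    case False
    then obtain i where "i \<in> Poly_Mapping.keys a" by (metis ex_in_conv keys_eq_empty)
    then have "(\<Prod>i\<in>Poly_Mapping.keys a. (0::complex) ^ Poly_Mapping.lookup a i) = 0"
      by (intro prod_zero) (auto simp: in_keys_iff)
    then show ?thesis using False by simp
  qed simp
  then have "ps_eval f (\<lambda>_. 0) = infsum (\<lambda>a. if a = 0 then f 0 else 0) (UNIV :: (nat \<Rightarrow>\<^sub>0 nat) set)"
    unfolding ps_eval_def by (intro infsum_cong) simp
  also have "\<dots> = infsum (\<lambda>_. f 0) {0 :: nat \<Rightarrow>\<^sub>0 nat}" by (rule infsum_cong_neutral) auto
  finally show ?thesis by simp
qed

text \<open>In one variable \<open>f\<close> is a multiple of \<open>f'\<close>.\<close>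

lemma tjurina_eq_milnor_0:
  assumes f: "f \<in> carrier (conv_ps 0)" and f0: "f 0 = 0"
  shows "tjurina_number 0 f = milnor_number 0 f"
proof -
  interpret C: cring "conv_ps 0" by (rule conv_ps_cring)
  let ?S = "(\<lambda>i. pderiv_ps i f) ` {..0}"
  note S = Jac_gens[OF f]
  obtain F where F: "fps_conv_radius F > 0" "f = ps_of_fps F" using conv_ps_0_fps[OF f] .
  have "fps_nth F 0 = 0" using f0 by (simp add: F(2) ps_of_fps_def)
  then obtain G where G: "fps_conv_radius G > 0" "F = G * fps_deriv F"
    using fps_eq_mult_deriv F(1) by blast
  interpret I: ideal "Idl\<^bsub>conv_ps 0\<^esub> ?S" "conv_ps 0" by (rule C.genideal_ideal[OF S])
  have "f = ps_mult (ps_of_fps G) (pderiv_ps 0 f)"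
    unfolding F(2) pderiv_ps_of_fps ps_of_fps_mult using G(2) by simp
  moreover have "pderiv_ps 0 f \<in> Idl\<^bsub>conv_ps 0\<^esub> ?S" using C.genideal_self[OF S] by auto
  ultimately have fI: "f \<in> Idl\<^bsub>conv_ps 0\<^esub> ?S"
    using I.I_l_closed[OF _ ps_of_fps_conv[OF G(1)], of "pderiv_ps 0 f"] by (simp add: conv_ps_simps)
  have fS: "insert f ?S \<subseteq> carrier (conv_ps 0)" using S f by blast
  have "Idl\<^bsub>conv_ps 0\<^esub> (insert f ?S) = Idl\<^bsub>conv_ps 0\<^esub> ?S"
  proof
    show "Idl\<^bsub>conv_ps 0\<^esub> (insert f ?S) \<subseteq> Idl\<^bsub>conv_ps 0\<^esub> ?S"
      by (rule C.genideal_minimal[OF I.ideal_axioms]) (use fI C.genideal_self[OF S] in blast)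
    show "Idl\<^bsub>conv_ps 0\<^esub> ?S \<subseteq> Idl\<^bsub>conv_ps 0\<^esub> (insert f ?S)"
      by (rule C.genideal_minimal[OF C.genideal_ideal[OF fS]]) (use C.genideal_self[OF fS] in blast)
  qed
  then show ?thesis by (simp only: tjurina_number_def milnor_number_def)
qed

subsection \<open>Counting\<close>

text \<open>If the k-th missing number were below \<alpha>_k + 1, so would be the first k missing
  numbers. By \<open>le\<close> at least k spectrum numbers would then be below \<alpha>_k, but by
  monotonicity these have indices less than k.\<close>

lemma missing_value_ge:
  fixes \<alpha> :: "nat \<Rightarrow> rat"
  assumes mono: "mono_on {1..\<mu>} \<alpha>" and i: "strict_mono_on {1..d} i" "i ` {1..d} \<subseteq> {1..\<mu>}"
    and le: "\<And>b. size {#x \<in># image_mset (\<lambda>k. \<alpha> (i k)) (mset_set {1..d}). x < b + 1#}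
      \<le> size {#x \<in># image_mset \<alpha> (mset_set {1..\<mu>}). x < b#}"
    and k: "k \<in> {1..d}"
  shows "\<alpha> (i k) \<ge> \<alpha> k + 1"
proof (rule ccontr)
  assume "\<not> \<alpha> (i k) \<ge> \<alpha> k + 1"
  then have less: "\<alpha> (i k) < \<alpha> k + 1" by simp
  have size: "size {#x \<in># image_mset g (mset_set {1..m}). P x#} = card {q \<in> {1..m}. P (g q)}"
    for g :: "nat \<Rightarrow> rat" and m P
    by (simp add: filter_mset_image_mset)
  have "d \<le> \<mu>"
    using card_inj_on_le[OF strict_mono_on_imp_inj_on[OF i(1)] i(2)] by simp
  have "\<alpha> (i q) < \<alpha> k + 1" if q: "q \<in> {1..k}" for q
  proof -
    have "q \<in> {1..d}" using q k by auto
    moreover have "i q \<le> i k"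
      using q by (intro mono_onD[OF strict_mono_on_imp_mono_on[OF i(1)] \<open>q \<in> {1..d}\<close> k]) simp
    moreover have "i q \<in> {1..\<mu>}" "i k \<in> {1..\<mu>}" using i(2) k \<open>q \<in> {1..d}\<close> by blast+
    ultimately have "\<alpha> (i q) \<le> \<alpha> (i k)" by (intro mono_onD[OF mono])
    then show ?thesis using less by simp
  qed
  then have "{1..k} \<subseteq> {q \<in> {1..d}. \<alpha> (i q) < \<alpha> k + 1}" using k by auto
  from card_mono[OF _ this] have "k \<le> card {q \<in> {1..d}. \<alpha> (i q) < \<alpha> k + 1}" by simp
  also have "\<dots> \<le> card {q \<in> {1..\<mu>}. \<alpha> q < \<alpha> k}" using le[of "\<alpha> k"] unfolding size .
  also have "\<dots> \<le> card {1..<k}"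
  proof (rule card_mono)
    show "{q \<in> {1..\<mu>}. \<alpha> q < \<alpha> k} \<subseteq> {1..<k}"
    proof
      fix q assume q: "q \<in> {q \<in> {1..\<mu>}. \<alpha> q < \<alpha> k}"
      then have "\<not> k \<le> q" using mono_onD[OF mono, of k q] k \<open>d \<le> \<mu>\<close> by auto
      then show "q \<in> {1..<k}" using q by auto
    qed
  qed simp
  finally show False using k by (cases k) auto
qed

theorem theoremB:
  fixes n :: nat and f :: pseries and \<mu> \<tau> d t :: nat
    and \<alpha> :: "nat \<Rightarrow> rat" and j i :: "nat \<Rightarrow> nat" and Tj :: "rat multiset"
  assumes f: "f \<in> carrier (conv_ps n)" "isolated_hypersurface_singularity n f"
    and \<mu>: "\<mu> = milnor_number n f"
    and \<tau>: "\<tau> = tjurina_number n f"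
    and d: "d = \<mu> - \<tau>"
    and spectrum: "mono_on {1..\<mu>} \<alpha>" "is_spectrum n f (image_mset \<alpha> (mset_set {1..\<mu>}))"
    and distinct_values: "strict_mono_on {1..t} (\<lambda>l. \<alpha> (j l))" "\<alpha> ` {1..\<mu>} = (\<lambda>l. \<alpha> (j l)) ` {1..t}"
    and distinct_indices: "j ` {1..t} \<subseteq> {1..\<mu>}"
      "\<And>l. 1 \<le> l \<Longrightarrow> l < t \<Longrightarrow> \<alpha> (j l) < \<alpha> (j l + 1)" "t \<ge> 1 \<Longrightarrow> j t = \<mu>"
    and tjurina: "is_tjurina_spectrum n f Tj"
    and not_tjurina: "strict_mono_on {1..d} i" "i ` {1..d} \<subseteq> {1..\<mu>}"
      "image_mset (\<lambda>k. \<alpha> (i k)) (mset_set {1..d}) = image_mset \<alpha> (mset_set {1..\<mu>}) - Tj"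
  shows "(\<forall>k\<in>{1..d}. \<forall>r\<in>{1..t}.
            card {q \<in> {1..\<mu>}. \<alpha> q \<le> \<alpha> (j r)} \<le> k \<and>
            (\<forall>r'\<in>{1..t}. card {q \<in> {1..\<mu>}. \<alpha> q \<le> \<alpha> (j r')} \<le> k \<longrightarrow> r' \<le> r)
            \<longrightarrow> \<alpha> (i k) \<ge> \<alpha> (j r) + 1)
       \<and> (d \<ge> 1 \<longrightarrow> \<alpha> (i 1) \<ge> \<alpha> 1 + 1)
       \<and> (d \<ge> 2 \<longrightarrow> \<alpha> (i 2) \<ge> \<alpha> 2 + 1)"
proof -
  have ge: "\<alpha> (i k) \<ge> \<alpha> k + 1" if k: "k \<in> {1..d}" for k
  proof (rule missing_value_ge[OF spectrum(1) not_tjurina(1,2) _ k])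
    fix b
    \<comment> \<open>Since k lies in {1..d}, d is positive, and d = \<mu> - \<tau> on
      \<open>nat\<close>.\<close>
    have \<mu>0: "milnor_number n f \<noteq> 0" using d k \<mu> by auto
    have f0: "f 0 = 0"
      using f(2) ps_eval_zero unfolding isolated_hypersurface_singularity_def sing_point_def by metis
    have "n \<ge> 1"
    proof (rule ccontr)
      assume "\<not> n \<ge> 1"
      then have "n = 0" by simp
      then have "d = 0" using tjurina_eq_milnor_0 f(1) f0 d \<mu> \<tau> by simp
      then show False using k by simp
    qed
    then show "size {#x \<in># image_mset (\<lambda>k. \<alpha> (i k)) (mset_set {1..d}). x < b + 1#}
      \<le> size {#x \<in># image_mset \<alpha> (mset_set {1..\<mu>}). x < b#}"
      unfolding not_tjurina(3) by (rule size_missing_spectrum_le[OF f(1) _ \<mu>0 spectrum(2) tjurina])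
  qed
  have "d \<le> \<mu>" using d by simp
  have "\<alpha> (i k) \<ge> \<alpha> (j r) + 1"
    if k: "k \<in> {1..d}" and r: "r \<in> {1..t}" and card: "card {q \<in> {1..\<mu>}. \<alpha> q \<le> \<alpha> (j r)} \<le> k" for k r
  proof -
    \<comment> \<open>Otherwise j r lies outside {1..k}, and these k + 1 indices all have values at
      most \<alpha> (j r), contrary to the count for r.\<close>
    have "\<alpha> (j r) \<le> \<alpha> k"
    proof (rule ccontr)
      assume "\<not> \<alpha> (j r) \<le> \<alpha> k"
      then have less: "\<alpha> k < \<alpha> (j r)" by simp
      have jr: "j r \<in> {1..\<mu>}" using distinct_indices(1) r by blast
      have q: "\<alpha> q \<le> \<alpha> k" if "q \<in> {1..k}" for q
        using that k \<open>d \<le> \<mu>\<close> by (intro mono_onD[OF spectrum(1)]) auto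
      have "insert (j r) {1..k} \<subseteq> {q \<in> {1..\<mu>}. \<alpha> q \<le> \<alpha> (j r)}"
        using jr q less k \<open>d \<le> \<mu>\<close> by force
      from card_mono[OF _ this] have "card (insert (j r) {1..k}) \<le> k" using card by simp
      moreover have "j r \<notin> {1..k}" using q[of "j r"] less by linarith
      ultimately show False by simp
    qed
    then show ?thesis using ge[OF k] by simp
  qed
  then show ?thesis using ge[of 1] ge[of 2] by auto
qed

end
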